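(* Let $d\ge 1$, let $A\in GL_d(\mathbb{Q})$ have no (complex) eigenvalue of norm $1$, and let $G=\mathbb{Z}\ltimes_A H$, where $H\subset\mathbb{Q}^d$ is a subgroup with $A(H)=H$ and $\mathrm{rank}_{\mathbb{Q}}(H)=d$. Assume that $G$ acts by orientation-preserving $C^1$ diffeomorphisms of the circle with non-Abelian image. Then the action admits a finite orbit.
   Context: The $\mathbb{Q}$-rank of $H$, $\mathrm{rank}_{\mathbb{Q}}(H)$, is the smallest $d'$ such that $H$ embeds into $\mathbb{Q}^{d'}$. $\mathbb{Z}\ltimes_A H$ is the semidirect product in which the generator $a$ of $\mathbb{Z}$ acts on $H$ by $a\,b\,a^{-1}=A(b)$, $b\in H$. *)

theory Defs
  imports "HOL-Analysis.Analysis" "HOL-Algebra.Algebra" "Jordan_Normal_Form.Char_Poly"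
begin

(* The additive group \<rat>^d. *)
abbreviation rat_space :: "nat \<Rightarrow> rat vec monoid" where
  "rat_space d \<equiv> monoid_vec TYPE(rat) d"

(* Meaningful only if K embeds into some \<rat>^d; this holds for all subgroups of \<rat>^d,
   see rank_rat_le below. *)
definition rank_rat :: "('a, 'b) monoid_scheme \<Rightarrow> nat" where
  "rank_rat K = (LEAST d. mon K (rat_space d) \<noteq> {})"

(* The semidirect product of \<int> and N in which the generator of \<int> acts by the automorphism f.
   The pair (m, x) stands for the element x a^m, where a = (1, 1_N), so that
   (x a^m) (y a^n) = x f^m(y) a^(m+n). *)
definition int_semidirect ::
  "('a \<Rightarrow> 'a) \<Rightarrow> ('a, 'b) monoid_scheme \<Rightarrow> (int \<times> 'a) monoid" where
  "int_semidirect f N =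
    \<lparr>carrier = UNIV \<times> carrier N,
     mult = (\<lambda>(m, x) (n, y). (m + n, x \<otimes>\<^bsub>N\<^esub> (f [^]\<^bsub>AutoGroup N\<^esub> m) y)),
     one = (0, \<one>\<^bsub>N\<^esub>)\<rparr>"

abbreviation circle :: "complex set" where
  "circle \<equiv> sphere 0 1"

(* cis is a local diffeomorphism from the line onto the circle, and the circle is a submanifold
   of the plane, so a self-map of the circle is C^1 iff its composition with cis is C^1
   as a map from the line into the plane. *)
definition C1_circle_map :: "(complex \<Rightarrow> complex) \<Rightarrow> bool" where
  "C1_circle_map f \<longleftrightarrow> f ` circle \<subseteq> circle \<and> (\<lambda>t. f (cis t)) C1_differentiable_on UNIV"

definition C1_circle_diffeo :: "(complex \<Rightarrow> complex) \<Rightarrow> bool" where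
  "C1_circle_diffeo f \<longleftrightarrow>
     bij_betw f circle circle \<and> C1_circle_map f \<and> C1_circle_map (inv_into circle f)"

(* Used only for homeomorphisms f of the circle: some (equivalently, every) lift of f to the
   universal cover is increasing. *)
definition circle_orientation_preserving :: "(complex \<Rightarrow> complex) \<Rightarrow> bool" where
  "circle_orientation_preserving f \<longleftrightarrow>
     (\<exists>F :: real \<Rightarrow> real. continuous_on UNIV F \<and> strict_mono F \<and> (\<forall>t. f (cis t) = cis (F t)))"

lemma group_rat_space: "group (rat_space d)"
proof (rule groupI)
  fix x assume "x \<in> carrier (rat_space d)"
  then show "\<exists>y\<in>carrier (rat_space d). y \<otimes>\<^bsub>rat_space d\<^esub> x = \<one>\<^bsub>rat_space d\<^esub>"
    by (intro bexI[of _ "- x"]) (auto simp: monoid_vec_simps)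
qed (auto simp: monoid_vec_simps assoc_add_vec[of _ d])

lemma rank_rat_le:
  assumes "subgroup H (rat_space d)"
  shows "rank_rat (rat_space d\<lparr>carrier := H\<rparr>) \<le> d"
proof -
  have "id \<in> mon (rat_space d\<lparr>carrier := H\<rparr>) (rat_space d)"
    using subgroup.subset[OF assms] by (auto simp: mon_def hom_def)
  then show ?thesis
    unfolding rank_rat_def by (intro Least_le) auto
qed

lemma mat_auto:
  assumes A: "A \<in> carrier_mat d d" "invertible_mat A"
    and H: "subgroup H (rat_space d)" "(\<lambda>v. A *\<^sub>v v) ` H = H"
  shows "(\<lambda>v\<in>H. A *\<^sub>v v) \<in> auto (rat_space d\<lparr>carrier := H\<rparr>)"
proof -
  have sub: "H \<subseteq> carrier_vec d"
    using subgroup.subset[OF H(1)] by (simp add: monoid_vec_simps)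
  have add: "x + y \<in> H" if "x \<in> H" "y \<in> H" for x y
    using subgroup.m_closed[OF H(1) that] by (simp add: monoid_vec_simps)
  obtain B where B: "inverts_mat A B" "inverts_mat B A"
    using A(2) by (auto simp: invertible_mat_def)
  have BA: "B * A = 1\<^sub>m (dim_row B)" and AB: "A * B = 1\<^sub>m d"
    using B A(1) by (auto simp: inverts_mat_def)
  have "dim_col (A * B) = d" "dim_col (B * A) = dim_row B"
    unfolding AB BA by auto
  then have Bc: "B \<in> carrier_mat d d"
    using A(1) by auto
  have inj: "inj_on (\<lambda>v. A *\<^sub>v v) H"
  proof (rule inj_onI)
    fix x y assume xy: "x \<in> H" "y \<in> H" "A *\<^sub>v x = A *\<^sub>v y"
    then have "(B * A) *\<^sub>v x = (B * A) *\<^sub>v y"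
      using sub A(1) Bc by (metis assoc_mult_mat_vec subsetD)
    then show "x = y"
      using xy sub Bc BA by (auto simp: subset_iff)
  qed
  have "(\<lambda>v\<in>H. A *\<^sub>v v) \<in> hom (rat_space d\<lparr>carrier := H\<rparr>) (rat_space d\<lparr>carrier := H\<rparr>)"
    using H(2) sub add A(1)
    by (auto simp: hom_def monoid_vec_simps mult_add_distrib_mat_vec subset_iff)
  moreover have "bij_betw (\<lambda>v\<in>H. A *\<^sub>v v) H H"
    using inj H(2) by (simp add: bij_betw_def)
  ultimately show ?thesis
    by (simp add: auto_def Bij_def)
qed

lemma
  assumes N: "group N" and f: "f \<in> auto N"
  shows group_int_semidirect: "group (int_semidirect f N)" (is "group ?G")
    and int_semidirect_conj: "b \<in> carrier N \<Longrightarrow>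
      (1, \<one>\<^bsub>N\<^esub>) \<otimes>\<^bsub>int_semidirect f N\<^esub> (0, b) \<otimes>\<^bsub>int_semidirect f N\<^esub>
        inv\<^bsub>int_semidirect f N\<^esub> (1, \<one>\<^bsub>N\<^esub>) = (0, f b)"
proof -
  interpret N: group N by fact
  interpret Aut: group "AutoGroup N" by (rule N.AutoGroup)
  define P where "P m = f [^]\<^bsub>AutoGroup N\<^esub> m" for m :: int
  have f': "f \<in> carrier (AutoGroup N)"
    using f by (simp add: AutoGroup_def)
  have P: "P m \<in> auto N" for m
    using Aut.int_pow_closed[OF f', of m] by (simp add: P_def AutoGroup_def)
  have clo: "P m x \<in> carrier N" if "x \<in> carrier N" for m x
    using P[of m] that by (auto simp: auto_def hom_def)
  have hom: "P m (x \<otimes>\<^bsub>N\<^esub> y) = P m x \<otimes>\<^bsub>N\<^esub> P m y"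
    if "x \<in> carrier N" "y \<in> carrier N" for m x y
    using P[of m] that by (auto simp: auto_def hom_def)
  have one: "P m \<one>\<^bsub>N\<^esub> = \<one>\<^bsub>N\<^esub>" for m
    using P[of m] N.is_group by (auto simp: auto_def intro: hom_one)
  have zero: "P 0 x = x" if "x \<in> carrier N" for x
    using that by (simp add: P_def AutoGroup_def BijGroup_def)
  have P1: "P 1 = f"
    using f' by (simp add: P_def Aut.int_pow_1)
  have add: "P (m + n) x = P m (P n x)" if "x \<in> carrier N" for m n x
  proof -
    have "P (m + n) = P m \<otimes>\<^bsub>AutoGroup N\<^esub> P n"
      unfolding P_def by (rule Aut.int_pow_mult[OF f'])
    moreover have "P m \<in> Bij (carrier N)" "P n \<in> Bij (carrier N)"
      using P by (auto simp: auto_def)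
    ultimately show ?thesis
      using that by (simp add: AutoGroup_def BijGroup_def compose_def)
  qed
  have carr: "carrier ?G = UNIV \<times> carrier N"
    and mul: "(m, x) \<otimes>\<^bsub>?G\<^esub> (n, y) = (m + n, x \<otimes>\<^bsub>N\<^esub> P m y)"
    and on: "\<one>\<^bsub>?G\<^esub> = (0, \<one>\<^bsub>N\<^esub>)" for m n x y
    by (simp_all add: int_semidirect_def P_def)
  show G: "group ?G"
  proof (rule groupI)
    fix z assume "z \<in> carrier ?G"
    then obtain m x where z: "z = (m, x)" "x \<in> carrier N" by (auto simp: carr)
    have "(- m, P (- m) (inv\<^bsub>N\<^esub> x)) \<otimes>\<^bsub>?G\<^esub> z = \<one>\<^bsub>?G\<^esub>"
      using z by (simp add: mul on hom[symmetric] one)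
    then show "\<exists>y\<in>carrier ?G. y \<otimes>\<^bsub>?G\<^esub> z = \<one>\<^bsub>?G\<^esub>"
      using z by (intro bexI) (auto simp: carr clo)
  qed (auto simp: carr mul on clo zero hom add N.m_assoc)
  interpret G: group ?G by (rule G)
  have i: "inv\<^bsub>?G\<^esub> (1, \<one>\<^bsub>N\<^esub>) = (-1, \<one>\<^bsub>N\<^esub>)"
    by (rule G.inv_equality) (auto simp: carr mul on one)
  show "(1, \<one>\<^bsub>N\<^esub>) \<otimes>\<^bsub>?G\<^esub> (0, b) \<otimes>\<^bsub>?G\<^esub> inv\<^bsub>?G\<^esub> (1, \<one>\<^bsub>N\<^esub>) = (0, f b)"
    if "b \<in> carrier N"
    using that clo[OF that, of 1] one[of 1] by (simp add: i mul P1)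
qed

end

theory Submission
  imports Defs "HOL-Library.Function_Algebras"
begin

text \<open>
  Lift the action to the line. Lifts of commuting circle maps commute, and a quotient of a lift by a
  conjugate of it has translation number zero, so A - id maps H into the subgroup H0 of the
  elements with a fixed point on the circle; as 1 is not an eigenvalue of A, a multiple of every
  element of H lies in H0. The elements of H0 have a nonempty closed set K of common fixed points,
  invariant under the lift B of the generator a, and the H-orbit of a point of K is finite on the circle.
  If B has a periodic point on the circle, then it has one in K and the G-orbit of that point is finite.
  If not and K is the whole line, then H0 acts trivially and the image of G is Abelian.

  In the remaining case B has a wandering gap (u, v) of K, on which H0 acts with no common fixed point.
  For x in (u, v), comparing positions of the points h(x) gives an additive order functional
  (translation number) on the subgroup generated by an A-orbit. The gaps B^n(u, v) shrink, and
  each element of H0 fixes their endpoints, so its derivative there is close to 1: it acts almost as a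
  translation and displacements are almost proportional to the functional. A displacement is at most
  the length of the gap, and B distorts ratios of lengths on small gaps very little; hence the functional
  grows subexponentially along the A-orbit in both directions of time. It satisfies the linear
  recurrence given by the characteristic polynomial of A, which has no root of modulus 1, so it
  vanishes, a contradiction.
\<close>

text \<open>With C1 regularity alone the distortion of long iterates of the generator need not be
  bounded; only the loss in a single step tends to 0 along shrinking gaps. The losses may pile up,
  but no faster than \<open>lam ^ n\<close> for every \<open>lam > 1\<close>, and a spectrum off the
  unit circle is what makes so weak a bound decisive. The bound concerns an infinite A-orbit, whose
  members have no common modulus of continuity for their derivatives. The way out is to move the gap
  and not the element: conjugation by \<open>B ^^ n\<close> turns A^(k-n) h on (u, v) into A^k h on
  the n-th gap, so that finitely many fixed maps on shrinking gaps carry the whole orbit. The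
  functional is defined once, on (u, v); only order comparisons are transported, and increasing maps
  preserve these. H is a group and not a vector space, so the characteristic polynomial is
  multiplied by a common denominator. The recurrence then determines an end term only up to an
  integer factor, which is why closure under division by integers has to be proved along the
  way.\<close>

section \<open>Two-sided linear recurrences and the Cayley-Hamilton theorem\<close>

text \<open>Polynomials act on sequences through the shift. The product
  \<open>[:- z, 1:] * Q\<close> acts as \<open>Q\<close> after (shift - z), so that one root at a
  time can be split off.\<close>

lemma coeff_sum_linear_factor:
  fixes w :: "int \<Rightarrow> complex"
  shows "(\<Sum>j\<le>Suc (Polynomial.degree Q). poly.coeff ([:- z, 1:] * Q) j * w (k + int j)) =
    (\<Sum>j\<le>Polynomial.degree Q. poly.coeff Q j * (w (k + int j + 1) - z * w (k + int j)))"
proof -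
  have "(\<Sum>j\<le>Suc (Polynomial.degree Q). poly.coeff ([:- z, 1:] * Q) j * w (k + int j)) =
      (\<Sum>j\<le>Suc (Polynomial.degree Q). poly.coeff (pCons 0 Q) j * w (k + int j)) -
      z * (\<Sum>j\<le>Suc (Polynomial.degree Q). poly.coeff Q j * w (k + int j))"
    by (simp add: mult_pCons_left sum_distrib_left sum_subtractf[symmetric] algebra_simps del: sum.atMost_Suc)
  also have "(\<Sum>j\<le>Suc (Polynomial.degree Q). poly.coeff (pCons 0 Q) j * w (k + int j)) =
      (\<Sum>j\<le>Polynomial.degree Q. poly.coeff Q j * w (k + int j + 1))"
    by (subst sum.atMost_Suc_shift) (simp add: algebra_simps)
  also have "(\<Sum>j\<le>Suc (Polynomial.degree Q). poly.coeff Q j * w (k + int j)) = (\<Sum>j\<le>Polynomial.degree Q. poly.coeff Q j * w (k + int j))"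
    by (simp add: coeff_eq_0)
  finally show ?thesis
    by (simp add: sum_distrib_left sum_subtractf[symmetric] algebra_simps)
qed

text \<open>The sequence is geometric with ratio z. If z has modulus above 1, the bound fails for k
  going to plus infinity, otherwise for k going to minus infinity; hence the bound in both
  directions.\<close>

lemma geometric_subexponential_zero:
  fixes w :: "int \<Rightarrow> complex"
  assumes z: "cmod z \<noteq> 1"
    and bd: "\<And>l. l > 1 \<Longrightarrow> \<exists>C. \<forall>k. cmod (w k) \<le> C * l ^ nat \<bar>k\<bar>"
    and rec: "\<And>k. w (k + 1) = z * w k"
  shows "w k = 0"
proof (rule ccontr)
  assume nz: "w k \<noteq> 0"
  have pw: "w (j + int n) = z ^ n * w j" for j n
  proof (induction n)
    case (Suc n)
    then show ?case using rec[of "j + int n"] by (simp add: algebra_simps)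
  qed simp
  have pow_le: "l ^ nat \<bar>k + s * int n\<bar> \<le> l ^ nat \<bar>k\<bar> * l ^ n" if "l > 1" "\<bar>s\<bar> = 1" for l :: real and s n
  proof -
    have "\<bar>s * int n\<bar> = int n"
      using that(2) by (simp add: abs_mult)
    then have "\<bar>k + s * int n\<bar> \<le> \<bar>k\<bar> + int n"
      using abs_triangle_ineq[of k "s * int n"] by linarith
    then have "nat \<bar>k + s * int n\<bar> \<le> nat \<bar>k\<bar> + n" by linarith
    then show ?thesis
      using that(1) by (metis less_imp_le power_add power_increasing)
  qed
  consider "cmod z > 1" | "cmod z < 1" using z by linarith
  then show False
  proof cases
    case 1
    then obtain l where l: "1 < l" "l < cmod z" using dense by blast
    obtain C where C: "\<And>k. cmod (w k) \<le> C * l ^ nat \<bar>k\<bar>" using bd[OF l(1)] by blast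
    have C0: "C \<ge> 0" using C[of 0] order_trans[OF norm_ge_zero] by force
    have "(cmod z / l) ^ n \<le> C * l ^ nat \<bar>k\<bar> / cmod (w k)" for n
    proof -
      have "cmod z ^ n * cmod (w k) \<le> C * l ^ nat \<bar>k + 1 * int n\<bar>"
        using C[of "k + int n"] by (simp add: pw norm_mult norm_power)
      also have "\<dots> \<le> C * (l ^ nat \<bar>k\<bar> * l ^ n)"
        by (intro mult_left_mono pow_le l C0) auto
      finally show ?thesis using l nz by (simp add: power_divide field_simps)
    qed
    moreover obtain n where "(cmod z / l) ^ n > C * l ^ nat \<bar>k\<bar> / cmod (w k)"
      using real_arch_pow[of "cmod z / l"] l by auto
    ultimately show False by (meson not_le)
  next
    case 2
    \<comment> \<open>With a the modulus of z, this rate exceeds 1 while l a = 2 a / (1 + a) is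
      still below 1, so going back n steps bounds \<open>w k\<close> by a multiple of (l
      a)^n.\<close>
    define l where "l = 2 / (1 + cmod z)"
    have l: "l > 1" "l * cmod z < 1"
      using 2 norm_ge_zero[of z] by (auto simp: l_def divide_simps add_pos_nonneg)
    obtain C where C: "\<And>k. cmod (w k) \<le> C * l ^ nat \<bar>k\<bar>" using bd[OF l(1)] by blast
    have C0: "C \<ge> 0" using C[of 0] order_trans[OF norm_ge_zero] by force
    have le: "cmod (w k) \<le> C * l ^ nat \<bar>k\<bar> * (l * cmod z) ^ n" for n
    proof -
      have "cmod (w k) = cmod z ^ n * cmod (w (k + (-1) * int n))"
        using pw[of "k - int n" n] by (simp add: norm_mult norm_power)
      also have "\<dots> \<le> cmod z ^ n * (C * l ^ nat \<bar>k + (-1) * int n\<bar>)"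
        by (intro mult_left_mono C) auto
      also have "\<dots> \<le> cmod z ^ n * (C * (l ^ nat \<bar>k\<bar> * l ^ n))"
        by (intro mult_left_mono pow_le l C0) auto
      finally show ?thesis by (simp add: power_mult_distrib mult_ac)
    qed
    have "(\<lambda>n. C * l ^ nat \<bar>k\<bar> * (l * cmod z) ^ n) \<longlonglongrightarrow> C * l ^ nat \<bar>k\<bar> * 0"
      using l by (intro tendsto_intros LIMSEQ_power_zero) (auto simp: abs_mult)
    then have "cmod (w k) \<le> C * l ^ nat \<bar>k\<bar> * 0"
      by (rule LIMSEQ_le_const) (use le in blast)
    then show False using nz by simp
  qed
qed

text \<open>Induction on the degree: for a root z of P, the sequence (shift - z) w satisfies the
  recurrence of the quotient polynomial and bounds of the same kind. It therefore vanishes, and w is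
  geometric with ratio z.\<close>

lemma subexponential_recurrence_zero:
  fixes w :: "int \<Rightarrow> complex"
  assumes "P \<noteq> 0" and "\<And>z. poly P z = 0 \<Longrightarrow> cmod z \<noteq> 1"
    and "\<And>l. l > 1 \<Longrightarrow> \<exists>C. \<forall>k. cmod (w k) \<le> C * l ^ nat \<bar>k\<bar>"
    and "\<And>k. (\<Sum>j\<le>Polynomial.degree P. poly.coeff P j * w (k + int j)) = 0"
  shows "w k = 0"
  using assms
proof (induction "Polynomial.degree P" arbitrary: P w k)
  case 0
  then obtain c where "P = [:c:]" by (metis degree_eq_zeroE)
  with 0 show ?case by (metis (no_types, lifting) add.right_neutral atMost_0 coeff_pCons_0
        degree_pCons_0 empty_iff finite.emptyI mult_eq_0_iff of_nat_0 pCons_0_0 sum.empty sum.insert)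
next
  case (Suc n)
  have "\<not> constant (poly P)" using Suc(2) by (simp add: constant_degree)
  then obtain z where z: "poly P z = 0" using fundamental_theorem_of_algebra by blast
  then obtain Q where Q: "P = [:- z, 1:] * Q" by (auto simp: poly_eq_0_iff_dvd)
  have Q0: "Q \<noteq> 0" using Suc(3) Q by auto
  have dP: "Polynomial.degree P = Suc (Polynomial.degree Q)"
    using Q Q0 by (simp only:) (subst degree_mult_eq, auto)
  define v where "v k = w (k + 1) - z * w k" for k
  have "v k = 0" for k
  proof (rule Suc(1)[of Q v])
    show "n = Polynomial.degree Q" using dP Suc(2) by simp
    show "cmod z' \<noteq> 1" if "poly Q z' = 0" for z' using Suc(4)[of z'] that Q by simp
    show "\<exists>C. \<forall>k. cmod (v k) \<le> C * l ^ nat \<bar>k\<bar>" if l: "l > 1" for l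
    proof -
      obtain C where C: "\<And>k. cmod (w k) \<le> C * l ^ nat \<bar>k\<bar>" using Suc(5)[OF l] by blast
      have C0: "C \<ge> 0" using C[of 0] order_trans[OF norm_ge_zero] by force
      have "cmod (v k) \<le> (C * l + cmod z * C) * l ^ nat \<bar>k\<bar>" for k
      proof -
        have "cmod (v k) \<le> cmod (w (k + 1)) + cmod z * cmod (w k)"
          unfolding v_def by (metis norm_mult norm_triangle_ineq4)
        moreover have "cmod (w (k + 1)) \<le> C * l ^ nat \<bar>k + 1\<bar>" by (rule C)
        moreover have "C * l ^ nat \<bar>k + 1\<bar> \<le> C * (l ^ (nat \<bar>k\<bar> + 1))"
          using l by (intro mult_left_mono power_increasing C0) auto
        moreover have "cmod z * cmod (w k) \<le> cmod z * (C * l ^ nat \<bar>k\<bar>)"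
          by (intro mult_left_mono C) auto
        ultimately show ?thesis by (simp add: algebra_simps)
      qed
      then show ?thesis by blast
    qed
    show "(\<Sum>j\<le>Polynomial.degree Q. poly.coeff Q j * v (k + int j)) = 0" for k
      using Suc(6)[of k] unfolding dP unfolding Q coeff_sum_linear_factor v_def .
  qed (rule Q0)
  then have "w (k + 1) = z * w k" for k by (simp add: v_def)
  then show ?case
    using geometric_subexponential_zero[of z w] Suc(4)[OF z] Suc(5) by blast
qed

text \<open>The Cayley--Hamilton theorem, applied to a vector: comparing coefficients in
  $(X - A)\,\mathrm{adj}(X - A) = \chi_A$ makes the sum telescope.\<close>

lemma cayley_hamilton_vec:
  fixes A :: "'a :: field mat"
  assumes A: "A \<in> carrier_mat d d" and v: "v \<in> carrier_vec d" and i: "i < d"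
  shows "(\<Sum>j\<le>Polynomial.degree (char_poly A). poly.coeff (char_poly A) j * (((*\<^sub>v) A ^^ j) v $ i)) = 0"
proof -
  define M where "M = char_poly_matrix A"
  have M: "M \<in> carrier_mat d d" using A by (simp add: M_def)
  define J where "J = adj_mat M"
  have J: "J \<in> carrier_mat d d" and MJ: "M * J = char_poly A \<cdot>\<^sub>m 1\<^sub>m d"
    using adj_mat[OF M] by (auto simp: J_def char_poly_def M_def)
  define p where "p = poly.coeff (char_poly A)"
  define B where "B k = mat d d (\<lambda>(i, j). poly.coeff (J $$ (i, j)) k)" for k
  define u where "u k = B k *\<^sub>v v" for k
  have B: "B k \<in> carrier_mat d d" for k by (simp add: B_def)
  have u: "u k \<in> carrier_vec d" for k unfolding u_def using B v by (rule mult_mat_vec_carrier)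
  define I where "I j w = ((*\<^sub>v) A ^^ j) w" for j w
  have I_carr: "I j w \<in> carrier_vec d" if "w \<in> carrier_vec d" for j w
    using that A unfolding I_def by (induction j) auto
  have I_sub: "I j (x - y) = I j x - I j y" if "x \<in> carrier_vec d" "y \<in> carrier_vec d" for j x y
  proof (induction j)
    case (Suc j)
    then show ?case using I_carr[OF that(1), of j] I_carr[OF that(2), of j] A
      by (simp add: I_def mult_minus_distrib_mat_vec)
  qed (simp add: I_def)
  have I_smult: "I j (c \<cdot>\<^sub>v x) = c \<cdot>\<^sub>v I j x" if "x \<in> carrier_vec d" for j x c
  proof (induction j)
    case (Suc j)
    then show ?case using I_carr[OF that(1), of j] A
      by (simp add: I_def mult_mat_vec)
  qed (simp add: I_def)
  have I_A: "I j (A *\<^sub>v x) = I (Suc j) x" for j x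
    by (simp add: I_def funpow_swap1)
  define bb where "bb k = (case k of 0 \<Rightarrow> 0\<^sub>m d d | Suc l \<Rightarrow> B l)" for k
  have bb: "bb k \<in> carrier_mat d d" for k by (auto simp: bb_def B split: nat.split)
  have coef: "p k \<cdot>\<^sub>m 1\<^sub>m d = bb k - A * B k" for k
  proof (rule eq_matI)
    fix r s assume "r < dim_row (bb k - A * B k)" "s < dim_col (bb k - A * B k)"
    then have rs: "r < d" "s < d" using A B[of k] by auto
    have Mrs: "M $$ (r, l) = (if r = l then [:0, 1:] else 0) - [:A $$ (r, l):]" if "l < d" for l
      using A rs that by (auto simp: M_def char_poly_matrix_def)
    have "(if r = s then p k else 0) = poly.coeff ((M * J) $$ (r, s)) k"
      using rs by (simp add: MJ p_def)
    also have "(M * J) $$ (r, s) = (\<Sum>l<d. M $$ (r, l) * J $$ (l, s))"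
      using M J rs by (simp add: scalar_prod_def atLeast0LessThan)
    also have "\<dots> = (\<Sum>l<d. (if r = l then [:0, 1:] * J $$ (l, s) else 0) - [:A $$ (r, l):] * J $$ (l, s))"
      by (intro sum.cong refl) (auto simp: Mrs left_diff_distrib)
    also have "\<dots> = pCons 0 (J $$ (r, s)) - (\<Sum>l<d. [:A $$ (r, l):] * J $$ (l, s))"
      using rs by (simp add: sum_subtractf)
    also have "poly.coeff \<dots> k = poly.coeff (pCons 0 (J $$ (r, s))) k - (\<Sum>l<d. A $$ (r, l) * poly.coeff (J $$ (l, s)) k)"
      by (simp add: coeff_sum)
    also have "(\<Sum>l<d. A $$ (r, l) * poly.coeff (J $$ (l, s)) k) = (A * B k) $$ (r, s)"
      using A rs by (simp add: scalar_prod_def atLeast0LessThan B_def)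
    also have "poly.coeff (pCons 0 (J $$ (r, s))) k = bb k $$ (r, s)"
      using rs by (simp add: bb_def B_def coeff_pCons split: nat.split)
    finally show "(p k \<cdot>\<^sub>m 1\<^sub>m d) $$ (r, s) = (bb k - A * B k) $$ (r, s)"
      using rs A B[of k] bb[of k] by auto
  qed (use A B[of k] bb in auto)
  define f where "f k = I k (bb k *\<^sub>v v) $ i" for k
  have step: "p k * I k v $ i = f k - f (Suc k)" for k
  proof -
    have "p k \<cdot>\<^sub>v v = (p k \<cdot>\<^sub>m 1\<^sub>m d) *\<^sub>v v"
      using v by (intro eq_vecI) (auto simp: smult_scalar_prod_distrib)
    also have "\<dots> = bb k *\<^sub>v v - A *\<^sub>v u k"
      unfolding coef u_def using A B[of k] v bb[of k]
      by (subst minus_mult_distrib_mat_vec[of _ d d]) (auto simp: assoc_mult_mat_vec[of A d d "B k" d v])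
    finally have "I k (p k \<cdot>\<^sub>v v) = I k (bb k *\<^sub>v v) - I (Suc k) (u k)"
      using I_sub[of "bb k *\<^sub>v v" "A *\<^sub>v u k" k] bb[of k] v u[of k] A by (simp add: I_A)
    moreover have "bb (Suc k) = B k" by (simp add: bb_def)
    ultimately show ?thesis
      using I_smult[OF v, of k "p k"] I_carr[OF v, of k] I_carr[OF u, of "Suc k" k] i
      by (simp add: f_def u_def) (metis carrier_vecD index_minus_vec(1) index_smult_vec(1))
  qed
  define n where "n = Polynomial.degree (char_poly A)"
  \<comment> \<open>Beyond the degrees of all entries of the adjugate the coefficient matrices
    vanish, which kills the last term of the telescoping sum.\<close>
  have "\<exists>m\<ge>n. \<forall>r<d. \<forall>s<d. Polynomial.degree (J $$ (r, s)) < m"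
  proof -
    define D where "D = Max (insert 0 ((\<lambda>(r, s). Polynomial.degree (J $$ (r, s))) ` ({..<d} \<times> {..<d})))"
    have "Polynomial.degree (J $$ (r, s)) \<le> D" if "r < d" "s < d" for r s
      unfolding D_def using that by (intro Max_ge) auto
    then show ?thesis by (intro exI[of _ "max n (Suc D)"]) (auto simp: less_max_iff_disj less_Suc_eq_le)
  qed
  then obtain m where m: "m \<ge> n" "\<And>r s. r < d \<Longrightarrow> s < d \<Longrightarrow> Polynomial.degree (J $$ (r, s)) < m" by blast
  have sm: "0 \<cdot>\<^sub>v x = 0\<^sub>v d" if "x \<in> carrier_vec d" for x :: "'a vec"
    using that by (intro eq_vecI) auto
  have zero: "0\<^sub>m d d *\<^sub>v v = 0\<^sub>v d" using v by (intro eq_vecI) auto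
  have "bb (Suc m) = 0\<^sub>m d d"
    using m(2) by (auto simp: bb_def B_def coeff_eq_0)
  then have "f (Suc m) = I (Suc m) (0\<^sub>v d) $ i" using v by (auto simp: f_def zero)
  also have "I (Suc m) (0\<^sub>v d) = 0\<^sub>v d" 
    using I_smult[of "0\<^sub>v d" "Suc m" 0] I_carr[of "0\<^sub>v d" "Suc m"] sm by (metis zero_carrier_vec)
  finally have fm: "f (Suc m) = 0" using i by simp
  have "f 0 = 0" using v i by (simp add: f_def bb_def I_def zero)
  have "(\<Sum>j\<le>n. p j * I j v $ i) = (\<Sum>j\<le>m. p j * I j v $ i)"
    by (rule sum.mono_neutral_left) (use m in \<open>auto simp: p_def n_def coeff_eq_0\<close>)
  also have "\<dots> = f 0 - f (Suc m)"
    unfolding step by (rule sum_telescope)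
  finally show ?thesis using fm \<open>f 0 = 0\<close> by (simp add: p_def n_def I_def)
qed

subsection \<open>Degree-one lifts\<close>

definition deg1 :: "(real \<Rightarrow> real) \<Rightarrow> bool" where
  "deg1 F \<longleftrightarrow> continuous_on UNIV F \<and> strict_mono F \<and> (\<forall>t. F (t + 2 * pi) = F t + 2 * pi)"

lemma deg1_less_iff: "deg1 F \<Longrightarrow> F s < F t \<longleftrightarrow> s < t"
  and deg1_le_iff: "deg1 F \<Longrightarrow> F s \<le> F t \<longleftrightarrow> s \<le> t"
  and deg1_eq_iff: "deg1 F \<Longrightarrow> F s = F t \<longleftrightarrow> s = t"
  by (auto simp: deg1_def strict_mono_less strict_mono_less_eq strict_mono_eq)

lemma deg1_id [simp]: "deg1 (\<lambda>t. t)"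
  by (auto simp: deg1_def strict_mono_def)

lemma deg1_compose: "deg1 F \<Longrightarrow> deg1 G \<Longrightarrow> deg1 (\<lambda>t. F (G t))"
  unfolding deg1_def strict_mono_def by (auto intro: continuous_on_compose2)

lemma deg1_funpow: "deg1 F \<Longrightarrow> deg1 (F ^^ n)"
  by (induction n) (auto simp: id_def o_def intro: deg1_compose)

lemma deg1_int:
  assumes "deg1 F" shows "F (t + 2 * pi * of_int k) = F t + 2 * pi * of_int k"
proof (induction k rule: int_induct[where k = 0])
  case (step1 i)
  then show ?case using assms
    by (metis (no_types, lifting) ab_semigroup_add_class.add_ac(1) deg1_def distrib_left mult.right_neutral of_int_1 of_int_add)
next
  case (step2 i)
  have "F (t + 2 * pi * of_int (i - 1) + 2 * pi) = F (t + 2 * pi * of_int (i - 1)) + 2 * pi"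
    using assms by (simp add: deg1_def)
  then show ?case using step2 by (simp add: algebra_simps)
qed simp

lemma deg1_add_int: "deg1 F \<Longrightarrow> deg1 (\<lambda>t. F t + 2 * pi * of_int k)"
  by (auto simp: deg1_def strict_mono_def intro!: continuous_intros)

lemma period_reduce:
  obtains s k where "0 \<le> s" "s < 2 * pi" "t = s + 2 * pi * of_int k"
proof
  let ?k = "\<lfloor>t / (2 * pi)\<rfloor>"
  show "t = (t - 2 * pi * of_int ?k) + 2 * pi * of_int ?k" by simp
  have "of_int ?k * (2 * pi) \<le> t"
    using of_int_floor_le[of "t / (2 * pi)"] by (subst (asm) pos_le_divide_eq) auto
  moreover have "t < (of_int ?k + 1) * (2 * pi)"
    using floor_correct[of "t / (2 * pi)"] by (subst pos_divide_less_eq[symmetric]) auto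
  ultimately show "0 \<le> t - 2 * pi * of_int ?k" "t - 2 * pi * of_int ?k < 2 * pi"
    by (auto simp: algebra_simps)
qed

text \<open>The displacement \<open>F s - s\<close> is periodic, so s may be moved into [t, t + 2
  pi). There both \<open>F s - F t\<close> and \<open>s - t\<close> lie between 0 and 2 pi. The
  bound does not depend on F, so it holds for all powers of F alike.\<close>

lemma deg1_oscillation:
  assumes F: "deg1 F" shows "\<bar>(F s - s) - (F t - t)\<bar> \<le> 2 * pi"
proof -
  obtain u k where u: "0 \<le> u" "u < 2 * pi" "s - t = u + 2 * pi * of_int k" using period_reduce .
  have s: "s = (t + u) + 2 * pi * of_int k" using u by simp
  have "F s = F (t + u) + 2 * pi * of_int k" unfolding s by (rule deg1_int[OF F])
  moreover have "F t \<le> F (t + u)" "F (t + u) \<le> F (t + 2 * pi)" using u F by (auto simp: deg1_le_iff)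
  moreover have "F (t + 2 * pi) = F t + 2 * pi" using F by (simp add: deg1_def)
  ultimately show ?thesis using u s by linarith
qed

lemma deg1_surj:
  assumes F: "deg1 F" shows "\<exists>t. F t = y"
proof -
  obtain u k where u: "0 \<le> u" "u < 2 * pi" "y - F 0 = u + 2 * pi * of_int k" using period_reduce .
  have *: "F (2 * pi) = F 0 + 2 * pi" using F by (metis add_0 deg1_def)
  have "\<exists>t\<ge>0. t \<le> 2 * pi \<and> F t = F 0 + u"
    using u * F by (intro IVT') (auto simp: deg1_def intro: continuous_on_subset)
  then obtain t where "F t = F 0 + u" by blast
  then have "F (t + 2 * pi * of_int k) = y" using u deg1_int[OF F, of t k] by simp
  then show ?thesis by blast
qed

lemma deg1_inv:
  assumes F: "deg1 F"
  shows "deg1 (inv_into UNIV F)" "F (inv_into UNIV F t) = t" "inv_into UNIV F (F t) = t"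
proof -
  have s: "surj F" and i: "inj F" using deg1_surj[OF F] deg1_eq_iff[OF F] by (metis surj_def, simp add: inj_def)
  show 1: "F (inv_into UNIV F t) = t" for t using s by (simp add: surj_f_inv_f)
  show 2: "inv_into UNIV F (F t) = t" for t using i by simp
  have m: "strict_mono (inv_into UNIV F)" unfolding strict_mono_def using 1 deg1_less_iff[OF F] by metis
  moreover have "continuous_on UNIV (inv_into UNIV F)"
  proof (rule continuous_onI_mono)
    have "range (inv_into UNIV F) = UNIV" using 2 by (metis surjI)
    then show "open (range (inv_into UNIV F))" by simp
  qed (use m in \<open>auto simp: strict_mono_less_eq\<close>)
  moreover have "inv_into UNIV F (t + 2 * pi) = inv_into UNIV F t + 2 * pi" for t using 1 2 F by (metis deg1_def)
  ultimately show "deg1 (inv_into UNIV F)" by (simp add: deg1_def)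
qed

lemma cis_eq_iff: "cis s = cis t \<longleftrightarrow> (\<exists>k::int. s = t + 2 * pi * of_int k)"
  using sin_cos_eq_iff[of s t] by (auto simp: complex_eq_iff)

text \<open>The difference divided by 2 pi is continuous and integer-valued on the connected line,
  hence constant.\<close>

lemma lifts_differ_by_period:
  fixes F G :: "real \<Rightarrow> real"
  assumes F: "continuous_on UNIV F" and G: "continuous_on UNIV G"
    and eq: "\<And>t. cis (F t) = cis (G t)"
  obtains k :: int where "\<And>t. F t = G t + 2 * pi * of_int k"
proof -
  define D where "D t = (F t - G t) / (2 * pi)" for t
  have D: "D t \<in> \<int>" for t
  proof -
    obtain k :: int where "F t = G t + 2 * pi * of_int k" using eq cis_eq_iff by blast
    then show ?thesis by (simp add: D_def)
  qed
  have "D constant_on UNIV"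
  proof (rule continuous_discrete_range_constant)
    show "continuous_on UNIV D" unfolding D_def by (intro continuous_intros F G) auto
    show "\<exists>e>0. \<forall>y. y \<in> UNIV \<and> D y \<noteq> D x \<longrightarrow> e \<le> norm (D y - D x)" for x
    proof (intro exI[of _ 1] conjI allI impI)
      fix y assume "y \<in> UNIV \<and> D y \<noteq> D x"
      then show "1 \<le> norm (D y - D x)"
        using D[of x] D[of y] by (metis Ints_diff Ints_nonzero_abs_ge1 eq_iff_diff_eq_0 real_norm_def)
    qed simp
  qed (rule convex_connected[OF convex_UNIV])
  then obtain c where c: "\<And>t. D t = c" unfolding constant_on_def by blast
  have "c \<in> \<int>" using D[of 0] c[of 0] by simp
  then obtain k :: int where "c = of_int k" by (rule Ints_cases)
  then have "F t = G t + 2 * pi * of_int k" for t using c[of t] by (simp add: D_def field_simps)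
  then show thesis by (rule that)
qed

text \<open>A lift satisfies F (t + 2 pi) = F t + 2 pi k for a fixed integer k, the degree.
  Monotonicity gives k >= 1, and injectivity on the circle excludes k >= 2.\<close>

lemma lift_of_circle_bijection:
  fixes F :: "real \<Rightarrow> real"
  assumes f: "inj_on f circle"
    and F: "continuous_on UNIV F" "strict_mono F" "\<And>t. f (cis t) = cis (F t)"
  shows "deg1 F"
proof -
  have "cis (F (t + 2 * pi)) = cis (F t)" for t
    by (metis F(3) cis_2pi cis_mult mult.right_neutral)
  moreover have "continuous_on UNIV (\<lambda>t. F (t + 2 * pi))"
    by (rule continuous_on_compose2[OF F(1)]) (auto intro!: continuous_intros)
  ultimately obtain k where k: "\<And>t. F (t + 2 * pi) = F t + 2 * pi * of_int k"
    using lifts_differ_by_period[of "\<lambda>t. F (t + 2 * pi)" F] F(1) by metis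
  have "F 0 < F (0 + 2 * pi)" using F(2) by (simp add: strict_mono_def)
  then have k1: "k \<ge> 1" using k[of 0] by (simp add: zero_less_mult_iff)
  have "k = 1"
  proof (rule ccontr)
    assume "k \<noteq> 1"
    then have "k \<ge> 2" using k1 by simp
    then have "real_of_int k \<ge> 2" by linarith
    then have "2 * pi * real_of_int k \<ge> 2 * pi * 2" by (intro mult_left_mono) auto
    then have le: "F 0 + 2 * pi < F (2 * pi)" using k[of 0] pi_gt_zero by simp
    \<comment> \<open>With degree at least 2, F gains a full period strictly inside (0, 2 pi), at a
      point with the same image on the circle as 0.\<close>
    have "\<exists>t\<ge>0. t \<le> 2 * pi \<and> F t = F 0 + 2 * pi"
      using le by (intro IVT') (auto intro: continuous_on_subset F(1))
    then obtain t where t: "0 \<le> t" "t \<le> 2 * pi" "F t = F 0 + 2 * pi" by blast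
    have "cis (F t) = cis (F 0)" using t by (metis cis_2pi cis_mult mult.right_neutral)
    then have "f (cis t) = f (cis 0)" by (simp only: F(3))
    then have "cis t = cis 0" using f by (auto simp: inj_on_def)
    then obtain j :: int where j: "t = 2 * pi * of_int j" using cis_eq_iff[of t 0] by auto
    have "t \<noteq> 0" "t \<noteq> 2 * pi" using t le by auto
    then have "j \<noteq> 0" "j \<noteq> 1" using j by auto
    moreover have "j \<ge> 0" using j t(1) pi_gt_zero by (auto simp: zero_le_mult_iff)
    moreover have "j \<le> 1" using j t(2) by simp
    ultimately show False by linarith
  qed
  then show ?thesis using F k by (simp add: deg1_def)
qed

text \<open>Iterating G multiplies the defect: F and G^n commute up to n k periods. The defect is
  bounded independently of n by the oscillations of F and of G^n.\<close>

lemma lifts_commute: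
  assumes F: "deg1 F" and G: "deg1 G" and eq: "\<And>t. F (G t) = G (F t) + 2 * pi * of_int k"
  shows "k = 0"
proof -
  have "F ((G ^^ n) t) = (G ^^ n) (F t) + 2 * pi * of_int (k * int n)" for n t
  proof (induction n)
    case (Suc n)
    then show ?case
      using eq[of "(G ^^ n) t"] deg1_int[OF G, of "(G ^^ n) (F t)" "k * int n"] by (simp add: algebra_simps)
  qed simp
  \<comment> \<open>The two oscillations amount to at most 2 periods, so n = 3 is enough: 3 |k| <= 2
    forces k = 0.\<close>
  from this[of 3 0] have "F ((G ^^ 3) 0) - (G ^^ 3) (F 0) = 2 * pi * of_int (k * 3)" by simp
  moreover have "\<bar>(F ((G ^^ 3) 0) - (G ^^ 3) 0) - (F 0 - 0)\<bar> \<le> 2 * pi"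
    by (rule deg1_oscillation[OF F])
  moreover have "\<bar>((G ^^ 3) (F 0) - F 0) - ((G ^^ 3) 0 - 0)\<bar> \<le> 2 * pi"
    by (rule deg1_oscillation[OF deg1_funpow[OF G]])
  ultimately have "\<bar>2 * pi * real_of_int (k * 3)\<bar> \<le> 2 * pi * 2" by linarith
  then have "2 * pi * \<bar>real_of_int (k * 3)\<bar> \<le> 2 * pi * 2" by (simp add: abs_mult)
  then have "\<bar>real_of_int (k * 3)\<bar> \<le> 2" by (subst (asm) mult_le_cancel_left_pos) auto
  then have "\<bar>k * 3\<bar> \<le> 2" by linarith
  then show ?thesis by linarith
qed

section \<open>Displacements and fixed points of lifts\<close>

text \<open>The displacement is periodic and attains its minimum over one period. A uniform gap
  makes the iterates of Q drift to infinity, which is how the existence of fixed points is proved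
  below.\<close>

lemma deg1_displacement_gap:
  assumes Q: "deg1 Q" and pos: "\<And>t. Q t > t"
  obtains e where "e > 0" "\<And>t. Q t \<ge> t + e"
proof -
  have "\<exists>x\<in>{0..2*pi}. \<forall>y\<in>{0..2*pi}. Q x - x \<le> Q y - y"
    by (rule continuous_attains_inf) (use Q in \<open>auto simp: deg1_def intro!: continuous_intros intro: continuous_on_subset\<close>)
  then obtain x where x: "\<And>y. y \<in> {0..2*pi} \<Longrightarrow> Q x - x \<le> Q y - y" by blast
  show thesis
  proof
    show "Q x - x > 0" using pos[of x] by simp
    fix t
    obtain s k where s: "0 \<le> s" "s < 2 * pi" "t = s + 2 * pi * of_int k" using period_reduce .
    then show "Q t \<ge> t + (Q x - x)" using deg1_int[OF Q, of s k] x[of s] by simp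
  qed
qed

lemma deg1_no_fixed_point_cases:
  assumes Q: "deg1 Q" and nf: "\<And>t. Q t \<noteq> t"
  shows "(\<forall>t. Q t > t) \<or> (\<forall>t. Q t < t)"
proof (rule ccontr)
  assume "\<not> ?thesis"
  then obtain s t where st: "Q s < s" "Q t > t" using nf by (meson linorder_neqE_linordered_idom)
  have cont: "continuous_on V (\<lambda>t. Q t - t)" for V
    using Q by (auto simp: deg1_def intro!: continuous_intros intro: continuous_on_subset)
  have "\<exists>x. Q x - x = 0"
  proof (cases "s \<le> t")
    case True
    then show ?thesis using IVT'[of "\<lambda>t. Q t - t" s 0 t] st cont by force
  next
    case False
    then show ?thesis using IVT2'[of "\<lambda>t. Q t - t" s 0 t] st cont by force
  qed
  then show False using nf by simp
qed

text \<open>The quotient Q of F and its conjugate by B satisfies Q^n = B F^n B^{-1} F^{-n}, which stays at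
  bounded distance from the identity; hence Q has translation number zero.\<close>

lemma commutator_fixed_point:
  assumes Q: "deg1 Q" and F: "deg1 F" and B: "deg1 B"
    and comm: "\<And>t. Q (F t) = F (Q t)" and conj: "\<And>t. B (F t) = Q (F (B t))"
  shows "\<exists>t. Q t = t"
proof (rule ccontr)
  assume nf: "\<nexists>t. Q t = t"
  have QF: "F ((Q ^^ n) t) = (Q ^^ n) (F t)" for n t
    by (induction n arbitrary: t) (auto simp: comm[symmetric])
  have pow: "B ((F ^^ n) t) = (Q ^^ n) ((F ^^ n) (B t))" for n t
    by (induction n arbitrary: t) (auto simp: conj QF)
  have bd: "\<bar>(Q ^^ n) ((F ^^ n) (B 0)) - (F ^^ n) (B 0)\<bar> \<le> 4 * pi" for n
  proof -
    have "\<bar>(B ((F ^^ n) 0) - (F ^^ n) 0) - (B 0 - 0)\<bar> \<le> 2 * pi" by (rule deg1_oscillation[OF B])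
    moreover have "\<bar>((F ^^ n) (B 0) - B 0) - ((F ^^ n) 0 - 0)\<bar> \<le> 2 * pi"
      by (rule deg1_oscillation[OF deg1_funpow[OF F]])
    ultimately show ?thesis using pow[of n 0] by linarith
  qed
  from deg1_no_fixed_point_cases[OF Q] nf consider "\<And>t. Q t > t" | "\<And>t. Q t < t" by blast
  then show False
  proof cases
    case 1
    obtain e where e: "e > 0" "\<And>t. Q t \<ge> t + e" using deg1_displacement_gap[OF Q 1] by blast
    have "(Q ^^ n) t \<ge> t + n * e" for n t
    proof (induction n)
      case (Suc n)
      then show ?case using e(2)[of "(Q ^^ n) t"] by (simp add: algebra_simps)
    qed simp
    moreover obtain n :: nat where "n * e > 4 * pi" using e(1) ex_less_of_nat_mult by blast
    ultimately show False using bd[of n] by (smt (verit))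
  next
    case 2
    have i: "deg1 (inv_into UNIV Q)" "\<And>t. inv_into UNIV Q t > t"
      using deg1_inv[OF Q] 2 by (auto, metis)
    obtain e where e: "e > 0" "\<And>t. inv_into UNIV Q t \<ge> t + e" using deg1_displacement_gap[OF i] by blast
    have e': "Q t \<le> t - e" for t using e(2)[of "Q t"] deg1_inv(3)[OF Q] by simp
    have "(Q ^^ n) t \<le> t - n * e" for n t
    proof (induction n)
      case (Suc n)
      then show ?case using e'[of "(Q ^^ n) t"] by (simp add: algebra_simps)
    qed simp
    moreover obtain n :: nat where "n * e > 4 * pi" using e(1) ex_less_of_nat_mult by blast
    ultimately show False using bd[of n] by (smt (verit))
  qed
qed

lemma monotone_orbit_fixed_point:
  assumes cont: "continuous_on UNIV G" and lim: "(\<lambda>n. (G ^^ n) x) \<longlonglongrightarrow> y"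
  shows "G y = (y :: real)"
proof -
  have "(\<lambda>n. G ((G ^^ n) x)) \<longlonglongrightarrow> G y"
    using cont lim by (metis UNIV_I continuous_on_def isCont_tendsto_compose continuous_on_eq_continuous_at open_UNIV)
  moreover have "(\<lambda>n. G ((G ^^ n) x)) \<longlonglongrightarrow> y"
    using LIMSEQ_Suc[OF lim] by simp
  ultimately show ?thesis by (rule LIMSEQ_unique)
qed

text \<open>The orbit of x is trapped between two consecutive translates of the fixed point p, and
  it is monotone. So it converges; its limit is fixed by G and lies in the closed set K.\<close>

lemma deg1_fixed_point_in_closed:
  assumes G: "deg1 G" and p: "G p = p" and K: "closed K" "x \<in> K" "\<And>t. t \<in> K \<Longrightarrow> G t \<in> K"
  shows "\<exists>t\<in>K. G t = t"
proof -
  have cont: "continuous_on UNIV G" using G by (simp add: deg1_def)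
  have fixk: "G (p + 2 * pi * of_int k) = p + 2 * pi * of_int k" for k using deg1_int[OF G] p by simp
  have inK: "(G ^^ n) x \<in> K" for n by (induction n) (auto simp: K)
  have "\<exists>y. (\<lambda>n. (G ^^ n) x) \<longlonglongrightarrow> y"
  proof -
    obtain s j where s: "0 \<le> s" "s < 2 * pi" "x - p = s + 2 * pi * of_int j" using period_reduce .
    have lo: "p + 2 * pi * of_int j \<le> (G ^^ n) x" for n
    proof (induction n)
      case (Suc n)
      then show ?case using deg1_le_iff[OF G] fixk by (metis comp_apply funpow.simps(2))
    qed (use s in simp)
    have hi: "(G ^^ n) x \<le> p + 2 * pi * of_int (j + 1)" for n
    proof (induction n)
      case (Suc n)
      then show ?case using deg1_le_iff[OF G] fixk by (metis comp_apply funpow.simps(2))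
    qed (use s in \<open>simp add: algebra_simps\<close>)
    have "monoseq (\<lambda>n. (G ^^ n) x)"
    proof (cases "x \<le> G x")
      case True
      have "(G ^^ n) x \<le> (G ^^ Suc n) x" for n
        by (induction n) (use True deg1_le_iff[OF G] in auto)
      then show ?thesis by (intro mono_SucI1) auto
    next
      case False
      have "(G ^^ Suc n) x \<le> (G ^^ n) x" for n
        by (induction n) (use False deg1_le_iff[OF G] in auto)
      then show ?thesis by (intro mono_SucI2) auto
    qed
    moreover have "Bseq (\<lambda>n. (G ^^ n) x)"
    proof (rule BseqI')
      show "norm ((G ^^ n) x) \<le> \<bar>p + 2 * pi * of_int j\<bar> + \<bar>p + 2 * pi * of_int (j + 1)\<bar>" for n
        using lo[of n] hi[of n] by simp
    qed
    ultimately show ?thesis using Bseq_monoseq_convergent convergent_def by blast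
  qed
  then obtain y where y: "(\<lambda>n. (G ^^ n) x) \<longlonglongrightarrow> y" by blast
  moreover have "y \<in> K" using closed_sequentially[OF K(1) _ y] inK by blast
  ultimately show ?thesis using monotone_orbit_fixed_point[OF cont] by blast
qed

subsection \<open>Order functionals and windows of displacements\<close>

text \<open>Hoelder's construction for an Archimedean order on an Abelian group. The order is that
  of the positions \<open>val x\<close>, and \<open>c\<close> is the unit. The type class serves to
  write integer multiples as products with \<open>of_nat\<close> and \<open>of_int\<close>. Elements
  may share a value of \<tau> without being equal, so strict inequalities pass only from \<tau> to
  \<open>val\<close>.\<close>

lemma order_functional:
  fixes val :: "'h :: comm_ring_1 \<Rightarrow> real"
  assumes E: "0 \<in> E" "\<And>x y. x \<in> E \<Longrightarrow> y \<in> E \<Longrightarrow> x + y \<in> E" "\<And>x. x \<in> E \<Longrightarrow> - x \<in> E"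
    and tr: "\<And>x y z. x \<in> E \<Longrightarrow> y \<in> E \<Longrightarrow> z \<in> E \<Longrightarrow> val x \<le> val y \<Longrightarrow> val (x + z) \<le> val (y + z)"
    and c: "c \<in> E" "val 0 < val c"
    and arch: "\<And>x. x \<in> E \<Longrightarrow> \<exists>n::nat. val x \<le> val (of_nat n * c)"
  obtains \<tau> :: "'h \<Rightarrow> real" where "\<And>x y. x \<in> E \<Longrightarrow> y \<in> E \<Longrightarrow> \<tau> (x + y) = \<tau> x + \<tau> y" "\<tau> c = 1"
    "\<And>x. x \<in> E \<Longrightarrow> \<tau> x > 0 \<Longrightarrow> val 0 < val x"
proof -
  define le where "le x y \<longleftrightarrow> val x \<le> val y" for x y
  have En: "of_nat n * x \<in> E" if "x \<in> E" for n x
    by (induction n) (auto simp: E that distrib_right)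
  have Ei: "of_int i * x \<in> E" if "x \<in> E" for i x
  proof (cases i rule: int_cases2)
    case (nonneg n)
    then show ?thesis using En[OF that] by simp
  next
    case (nonpos n)
    then show ?thesis using E(3)[OF En[OF that, of n]] by simp
  qed
  have le_tr: "le x z" if "le x y" "le y z" for x y z using that by (simp add: le_def)
  have le_lin: "le x y \<or> le y x" for x y by (auto simp: le_def)
  have le_add: "le (x + z) (y + w)" if "le x y" "le z w" "x \<in> E" "y \<in> E" "z \<in> E" "w \<in> E" for x y z w
    using tr[of x y z] tr[of z w y] that by (simp add: le_def add.commute)
  have le_neg: "le (- y) (- x)" if "le x y" "x \<in> E" "y \<in> E" for x y
    using tr[OF that(2,3) E(2)[OF E(3)[OF that(2)] E(3)[OF that(3)]]] that(1) by (simp add: le_def)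
  have le_nat: "le (of_nat n * x) (of_nat n * y)" if "le x y" "x \<in> E" "y \<in> E" for n x y
    by (induction n) (use that En in \<open>auto simp: le_def[of 0] distrib_right intro!: le_add\<close>)
  have c_mono: "le (of_int i * c) (of_int j * c)" if "i \<le> j" for i j
  proof -
    have "le (of_nat (nat (j - i)) * 0) (of_nat (nat (j - i)) * c)"
      using c E by (intro le_nat) (auto simp: le_def)
    then have "le (of_int i * c + 0) (of_int i * c + of_int (j - i) * c)"
      using that c E Ei by (intro le_add) (auto simp: le_def simp del: of_int_diff)
    then show ?thesis by (simp add: left_diff_distrib)
  qed
  have c_cancel: "i \<le> j" if "le (of_int i * c) (of_int j * c)" for i j
  proof (rule ccontr)
    assume "\<not> i \<le> j"
    then have "le (of_int (j + 1) * c) (of_int i * c)" by (intro c_mono) simp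
    then have "le (of_int (j + 1) * c) (of_int j * c)" using that le_tr by blast
    then have "le (of_int (j + 1) * c + - (of_int j * c)) (of_int j * c + - (of_int j * c))"
      using c E Ei by (intro le_add) (auto simp: le_def simp del: of_int_add)
    then show False using c(2) by (simp add: le_def distrib_right)
  qed
  \<comment> \<open>The lower Dedekind cut of h: the fractions j/m with j c <= m h.\<close>
  define V where "V h = {of_int j / real m | j m. m > 0 \<and> le (of_int j * c) (of_nat m * h)}" for h
  define \<tau> where "\<tau> h = Sup (V h)" for h
  have V_ne: "V h \<noteq> {}" if h: "h \<in> E" for h
  proof -
    obtain n :: nat where "le (- h) (of_nat n * c)" using arch[OF E(3)[OF h]] by (auto simp: le_def)
    from le_neg[OF this] h E En c have "le (of_int (- int n) * c) (of_nat 1 * h)" by simp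
    then have "of_int (- int n) / real 1 \<in> V h" unfolding V_def by (intro CollectI exI[of _ "- int n"] exI[of _ "1 :: nat"]) auto
    then show ?thesis by blast
  qed
  have V_bdd: "bdd_above (V h)" if h: "h \<in> E" for h
  proof -
    obtain n :: nat where n: "le h (of_nat n * c)" using arch[OF h] by (auto simp: le_def)
    have "x \<le> n" if x': "x \<in> V h" for x
    proof -
      obtain j m where x: "x = of_int j / real m" "m > 0" "le (of_int j * c) (of_nat m * h)"
        using x' by (auto simp: V_def)
      have "le (of_nat m * h) (of_nat m * (of_nat n * c))" using n h En c by (intro le_nat) auto
      then have "le (of_int j * c) (of_int (int (m * n)) * c)" using le_tr[OF x(3)] by (simp add: mult.assoc)
      then have "j \<le> int (m * n)" by (rule c_cancel)
      then have "real_of_int j \<le> real m * real n" by (metis of_int_le_iff of_int_of_nat_eq of_nat_mult)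
      then show ?thesis using x by (simp add: divide_le_eq mult.commute)
    qed
    then show ?thesis by (intro bdd_aboveI)
  qed
  have upper: "x \<le> \<tau> h" if "h \<in> E" "x \<in> V h" for h x
    unfolding \<tau>_def using that V_bdd by (intro cSup_upper)
  have least: "\<tau> h \<le> z" if "h \<in> E" "\<And>x. x \<in> V h \<Longrightarrow> x \<le> z" for h z
    unfolding \<tau>_def using that V_ne by (intro cSup_least)
  \<comment> \<open>Fractions in the two cuts are added over a common denominator. Superadditivity
    together with \<tau> (- h) = - \<tau> h gives additivity, by applying it also to x + y and -
    y.\<close>
  have super: "\<tau> h + \<tau> k \<le> \<tau> (h + k)" if hk: "h \<in> E" "k \<in> E" for h k
  proof -
    have V_add: "x + y \<in> V (h + k)" if x': "x \<in> V h" and y': "y \<in> V k" for x y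
    proof -
      obtain j m where x: "x = of_int j / real m" "m > 0" "le (of_int j * c) (of_nat m * h)"
        using x' by (auto simp: V_def)
      obtain j' m' where y: "y = of_int j' / real m'" "m' > 0" "le (of_int j' * c) (of_nat m' * k)"
        using y' by (auto simp: V_def)
      have "le (of_nat m' * (of_int j * c)) (of_nat m' * (of_nat m * h))"
        using x hk En Ei c by (intro le_nat) auto
      moreover have "le (of_nat m * (of_int j' * c)) (of_nat m * (of_nat m' * k))"
        using y hk En Ei c by (intro le_nat) auto
      ultimately have "le (of_nat m' * (of_int j * c) + of_nat m * (of_int j' * c))
          (of_nat m' * (of_nat m * h) + of_nat m * (of_nat m' * k))"
        using hk En Ei c by (intro le_add) auto
      then have "le (of_int (int m' * j + int m * j') * c) (of_nat (m * m') * (h + k))"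
        by (simp add: algebra_simps)
      moreover have "x + y = of_int (int m' * j + int m * j') / real (m * m')"
        using x y by (simp add: field_simps)
      ultimately show ?thesis using x y unfolding V_def by (auto intro!: exI[of _ "m * m'"] exI[of _ "int m' * j + int m * j'"])
    qed
    have "\<tau> h \<le> \<tau> (h + k) - y" if "y \<in> V k" for y
      using V_add[OF _ that] upper[of "h + k"] hk E by (intro least) (auto simp: le_diff_eq)
    then have "\<tau> k \<le> \<tau> (h + k) - \<tau> h" using hk by (intro least) (auto simp: algebra_simps)
    then show ?thesis by simp
  qed
  have zero: "\<tau> 0 \<le> 0"
  proof (rule least)
    fix x assume "x \<in> V 0"
    then obtain j m where x: "x = of_int j / real m" "m > 0" "le (of_int j * c) (of_int 0 * c)"
      by (auto simp: V_def)
    from c_cancel[OF x(3)] x show "x \<le> 0" by (simp add: divide_le_0_iff)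
  qed (rule E)
  have neg: "\<tau> (- h) = - \<tau> h" if h: "h \<in> E" for h
  proof (rule antisym)
    show "\<tau> (- h) \<le> - \<tau> h" using super[of h "- h"] zero h E by simp
    show "- \<tau> h \<le> \<tau> (- h)"
    proof (rule ccontr)
      assume "\<not> ?thesis"
      then have "\<tau> h < - \<tau> (- h)" by simp
      \<comment> \<open>Such a fraction q = j/m lies above the cut of h, so totality of the order
        gives m h <= j c; negating puts - q into the cut of - h, although - q exceeds \<tau> (-
        h).\<close>
      then obtain q where q: "q \<in> \<rat>" "\<tau> h < q" "q < - \<tau> (- h)" using Rats_dense_in_real by blast
      then obtain j :: int and m :: nat where m: "m \<noteq> 0" "q = of_int j / real m"
        unfolding Rats_eq_int_div_nat by blast
      have "q \<notin> V h" using upper[OF h] q by force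
      then have "\<not> le (of_int j * c) (of_nat m * h)" using m by (auto simp: V_def)
      then have "le (of_nat m * h) (of_int j * c)" using le_lin by blast
      from le_neg[OF this] En Ei h c have "le (of_int (- j) * c) (of_nat m * (- h))" by simp
      then have "of_int (- j) / real m \<in> V (- h)" using m unfolding V_def by blast
      then have "- q \<in> V (- h)" using m by simp
      then show False using upper[OF E(3)[OF h]] q by force
    qed
  qed
  show thesis
  proof
    fix x y assume xy: "x \<in> E" "y \<in> E"
    show "\<tau> (x + y) = \<tau> x + \<tau> y"
      using super[of x y] super[of "x + y" "- y"] neg[of y] xy E by simp
  next
    have "1 \<in> V c" unfolding V_def by (auto simp: le_def intro!: exI[of _ 1])
    moreover have "x \<le> 1" if "x \<in> V c" for x
    proof -
      obtain j m where x: "x = of_int j / real m" "m > 0" "le (of_int j * c) (of_int (int m) * c)"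
        using \<open>x \<in> V c\<close> by (auto simp: V_def)
      from c_cancel[OF x(3)] have "real_of_int j \<le> real m" by linarith
      then show ?thesis using x by simp
    qed
    ultimately show "\<tau> c = 1" using upper[OF c(1)] least[OF c(1)] by (intro antisym) auto
  next
    fix x assume x: "x \<in> E" "\<tau> x > 0"
    then obtain z where "z \<in> V x" "z > 0" using least[of x 0] by (meson not_le)
    then obtain j m where z: "of_int j / real m > 0" "m > 0" "le (of_int j * c) (of_nat m * x)"
      by (auto simp: V_def)
    then have "j \<ge> 1" by (simp add: zero_less_divide_iff)
    then have "le (of_int 1 * c) (of_int j * c)" by (rule c_mono)
    then have cx: "le c (of_nat m * x)" using z le_tr by fastforce
    show "val 0 < val x"
    proof (rule ccontr)
      assume "\<not> ?thesis"
      then have "le (of_nat m * x) (of_nat m * 0)" using x E by (intro le_nat) (auto simp: le_def)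
      then have "le c 0" using le_tr[OF cx] by simp
      then show False using c(2) by (simp add: le_def)
    qed
  qed
qed

text \<open>Each step of the orbit of y differs from the preceding one by a factor between 1 - e and
  1 + e. Summing the q steps, with the exponents replaced by their worst value q, leaves bounds in
  product form that can be multiplied and cancelled later.\<close>

lemma near_translation_powers:
  fixes g :: "real \<Rightarrow> real"
  assumes mono: "strict_mono g" and fixd: "g u = u" "g v = v" and y: "u \<le> y" "y \<le> v"
    and e: "0 < e" "e < 1"
    and near: "\<And>s t. u \<le> s \<Longrightarrow> s \<le> t \<Longrightarrow> t \<le> v \<Longrightarrow>
      (1 - e) * (t - s) \<le> g t - g s \<and> g t - g s \<le> (1 + e) * (t - s)"
    and W: "g y - y \<ge> 0"
  shows "(g y - y) * q * (1 - e) ^ q \<le> (g ^^ q) y - y" "(g ^^ q) y - y \<le> (g y - y) * q * (1 + e) ^ q"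
proof -
  define W where "W = g y - y"
  have W0: "W \<ge> 0" using W by (simp add: W_def)
  have ran: "u \<le> (g ^^ k) y \<and> (g ^^ k) y \<le> v" for k
  proof (induction k)
    case (Suc k)
    then show ?case using mono fixd by (metis comp_apply funpow.simps(2) strict_mono_less_eq)
  qed (use y in auto)
  have inc: "(g ^^ k) y \<le> (g ^^ Suc k) y" for k
    by (induction k) (use W mono in \<open>auto simp: strict_mono_less_eq\<close>)
  have step: "W * (1 - e) ^ k \<le> (g ^^ Suc k) y - (g ^^ k) y \<and> (g ^^ Suc k) y - (g ^^ k) y \<le> W * (1 + e) ^ k" for k
  proof (induction k)
    case (Suc k)
    have n: "(1 - e) * ((g ^^ Suc k) y - (g ^^ k) y) \<le> (g ^^ Suc (Suc k)) y - (g ^^ Suc k) y \<and>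
        (g ^^ Suc (Suc k)) y - (g ^^ Suc k) y \<le> (1 + e) * ((g ^^ Suc k) y - (g ^^ k) y)"
      using near[of "(g ^^ k) y" "(g ^^ Suc k) y"] ran[of k] ran[of "Suc k"] inc[of k] by simp
    have "(1 - e) * (W * (1 - e) ^ k) \<le> (1 - e) * ((g ^^ Suc k) y - (g ^^ k) y)"
      using Suc e by (intro mult_left_mono) auto
    moreover have "(1 + e) * ((g ^^ Suc k) y - (g ^^ k) y) \<le> (1 + e) * (W * (1 + e) ^ k)"
      using Suc e by (intro mult_left_mono) auto
    ultimately show ?case using n by (simp add: mult_ac)
  qed (simp add: W_def)
  have tel: "(g ^^ q) y - y = (\<Sum>k<q. (g ^^ Suc k) y - (g ^^ k) y)"
    by (subst sum_lessThan_telescope) simp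
  have "(\<Sum>k<q. W * (1 - e) ^ q) \<le> (\<Sum>k<q. (g ^^ Suc k) y - (g ^^ k) y)"
  proof (rule sum_mono)
    fix k assume "k \<in> {..<q}"
    then have "W * (1 - e) ^ q \<le> W * (1 - e) ^ k"
      using e W0 by (intro mult_left_mono power_decreasing) auto
    then show "W * (1 - e) ^ q \<le> (g ^^ Suc k) y - (g ^^ k) y" using step[of k] by linarith
  qed
  then show "(g y - y) * q * (1 - e) ^ q \<le> (g ^^ q) y - y"
    unfolding tel W_def[symmetric] by (simp add: mult_ac)
  have "(\<Sum>k<q. (g ^^ Suc k) y - (g ^^ k) y) \<le> (\<Sum>k<q. W * (1 + e) ^ q)"
  proof (rule sum_mono)
    fix k assume "k \<in> {..<q}"
    then have "W * (1 + e) ^ k \<le> W * (1 + e) ^ q"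
      using e W0 by (intro mult_left_mono power_increasing) auto
    then show "(g ^^ Suc k) y - (g ^^ k) y \<le> W * (1 + e) ^ q" using step[of k] by linarith
  qed
  then show "(g ^^ q) y - y \<le> (g y - y) * q * (1 + e) ^ q"
    unfolding tel W_def[symmetric] by (simp add: mult_ac)
qed

text \<open>Near-translations have displacements almost proportional to the order functional. The relative
  displacement of the dominant element of the window at stage n is at most 1, so the dominant value of
  the functional cannot grow exponentially.\<close>

lemma window_subexponential:
  fixes c :: "bool \<Rightarrow> int \<Rightarrow> real \<Rightarrow> real" and w :: "bool \<Rightarrow> int \<Rightarrow> real"
    and y u v T :: "nat \<Rightarrow> real" and r M :: nat
  assumes B: "strict_mono B" and y: "\<And>n. y (Suc n) = B (y n)"
    and uv: "\<And>n. u n < y n" "\<And>n. y n < v n"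
    and conj: "\<And>b k t. B (c b k t) = c b (k + 1) (B t)"
    and mono: "\<And>b k. strict_mono (c b k)"
    and fixd: "\<And>b k n. c b k (u n) = u n" "\<And>b k n. c b k (v n) = v n"
    and order: "\<And>p q b k b' l. real q * w b' l < real p * w b k \<Longrightarrow> (c b' l ^^ q) (y 0) < (c b k ^^ p) (y 0)"
    and near: "\<And>e. e > 0 \<Longrightarrow> \<forall>\<^sub>F n in sequentially. \<forall>b. \<forall>k\<in>{-1..<int r}. \<forall>s t. u n \<le> s \<and> s \<le> t \<and> t \<le> v n \<longrightarrow>
        (1 - e) * (t - s) \<le> c b k t - c b k s \<and> c b k t - c b k s \<le> (1 + e) * (t - s)"
    and distort: "\<And>e. e > 0 \<Longrightarrow> \<forall>\<^sub>F n in sequentially. \<forall>s t. u n \<le> s \<and> s \<le> t \<and> t \<le> v n \<longrightarrow>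
        (1 - e) * ((t - s) / (v n - u n)) \<le> (B t - B s) / (v (Suc n) - u (Suc n))"
    and T: "\<And>n. \<exists>b. \<exists>i<r. T n = w b (int i - int n)" "\<And>n. T n > 0"
      "\<And>n. T (Suc n) \<le> M * T n" "\<And>n. T n \<le> M * T (Suc n)"
    and lam: "lam > 1"
  shows "\<exists>C. \<forall>n. T n \<le> C * lam ^ n"
proof -
  \<comment> \<open>The aim is that T n / R n, with R n the relative displacement, grows by a factor
    of at most lam per stage. So the total loss in one stage must not go below ka = 1 / lam.\<close>
  define ka where "ka = 1 / lam"
  have ka: "0 < ka" "ka < 1" using lam by (auto simp: ka_def)
  have M1: "M \<ge> 1"
  proof (rule ccontr)
    assume "\<not> M \<ge> 1"
    then have "M = 0" by simp
    then show False using T(2)[of 1] T(3)[of 0] by simp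
  qed
  \<comment> \<open>Below, the ratio of consecutive values of T is approximated by q / p from below,
    at the cost of a factor 1 - M / p. This p keeps that factor above (1 + ka) / 2.\<close>
  obtain p :: nat where p: "real p > 2 * M / (1 - ka)" using reals_Archimedean2 by blast
  have "2 * M / (1 - ka) > 0" using M1 ka by (intro divide_pos_pos) auto
  then have p0: "p > 0" using p by simp
  have Mp: "1 - M / p \<ge> (1 + ka) / 2"
    using p p0 ka by (simp add: field_simps)
  \<comment> \<open>N counts the factors 1 - e lost in one stage: at most p M for the powers of
    \<open>g\<close>, p for those of \<open>g'\<close>, and one for the distortion of B. By
    Bernoulli's inequality the choice N e = (1 - ka) / 2 keeps (1 - e)^N above (1 + ka) / 2, and the
    square of (1 + ka) / 2 is at least ka.\<close>
  define N where "N = p * M + 1 + p"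
  define e where "e = (1 - ka) / (2 * N)"
  have N1: "real N \<ge> 1" by (simp add: N_def)
  have e: "0 < e" "e < 1" "N * e = (1 - ka) / 2"
  proof -
    show "0 < e" using ka N1 by (auto simp: e_def)
    show "N * e = (1 - ka) / 2" using N1 by (simp add: e_def)
    have "e \<le> N * e" using N1 \<open>0 < e\<close> by simp
    also have "\<dots> = (1 - ka) / 2" by fact
    also have "\<dots> < 1" using ka by simp
    finally show "e < 1" .
  qed
  have key: "(1 - M / p) * (1 - e) ^ N \<ge> ka"
  proof -
    have "1 + real N * (- e) \<le> (1 + (- e)) ^ N" using e by (intro Bernoulli_inequality) auto
    then have "(1 + ka) / 2 \<le> (1 - e) ^ N" using e(3) by (simp add: field_simps)
    then have "(1 + ka) / 2 * ((1 + ka) / 2) \<le> (1 - M / p) * (1 - e) ^ N"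
      using Mp ka by (intro mult_mono) auto
    moreover have "(1 + ka) / 2 * ((1 + ka) / 2) - ka = ((1 - ka) / 2)\<^sup>2"
      by (simp add: power2_eq_square field_simps)
    ultimately show ?thesis by (smt (verit) zero_le_power2)
  qed
  obtain b i where bi: "\<And>n. i n < r" "\<And>n. T n = w (b n) (int (i n) - int n)" using T(1) by metis
  have shift: "(c s (k + int n) ^^ q) (y n) = (B ^^ n) ((c s k ^^ q) (y 0))" for s k q n
  proof (induction n)
    case (Suc n)
    have *: "B ((c s l ^^ q) t) = (c s (l + 1) ^^ q) (B t)" for l t
      by (induction q) (auto simp: conj)
    show ?case using *[of "k + int n" "y n"] Suc by (simp add: y algebra_simps)
  qed simp
  have Bn: "strict_mono (B ^^ n)" for n
    by (induction n) (use B in \<open>auto simp: strict_mono_def\<close>)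
  have order_n: "(c b' (l + int n) ^^ q) (y n) < (c b (k + int n) ^^ p) (y n)"
    if "real q * w b' l < real p * w b k" for p q b k b' l n
    unfolding shift using order[OF that] Bn[of n] by (simp add: strict_mono_less)
  \<comment> \<open>The dominant element of stage n has index i - n on the first gap; transported by
    \<open>B ^^ n\<close> it has index i < r on the n-th gap. So only finitely many maps occur,
    whatever n is.\<close>
  define W where "W n = c (b n) (int (i n)) (y n) - y n" for n
  define R where "R n = W n / (v n - u n)" for n
  have W0: "W n > 0" for n
    using order_n[of 0 "b n" "int (i n) - int n" 1 "b n" "int (i n) - int n" n] T(2)[of n]
    by (simp add: bi(2)[symmetric] W_def)
  have R0: "R n > 0" for n using W0[of n] uv[of n] by (simp add: R_def)
  have R1: "R n \<le> 1" for n
  proof -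
    have "c (b n) (int (i n)) (y n) < v n" using mono uv fixd by (metis strict_mono_less)
    then show ?thesis using uv[of n] by (simp add: R_def W_def)
  qed
  \<comment> \<open>This is the growth estimate for T n / R n, with the denominators
    cleared.\<close>
  have "\<forall>\<^sub>F n in sequentially. T (Suc n) * R n \<le> lam * T n * R (Suc n)"
    using near[OF e(1)] distort[OF e(1)]
  proof eventually_elim
    case (elim n)
    define g where "g = c (b n) (int (i n))"
    \<comment> \<open>The dominant element of the next stage, viewed already on the n-th gap. Since
      B raises indices by one, its index here is one lower, and the smallest index that occurs is
      -1.\<close>
    define g' where "g' = c (b (Suc n)) (int (i (Suc n)) - 1)"
    define rho where "rho = T (Suc n) / T n"
    have rho: "rho > 0" "rho \<le> M" "1 \<le> M * rho"
      using T(2)[of n] T(2)[of "Suc n"] T(3)[of n] T(4)[of n] by (auto simp: rho_def field_simps)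
    \<comment> \<open>The largest integer strictly below p rho. Strictness is required because only
      strict inequalities between values of the functional yield an order of points.\<close>
    define q where "q = nat (\<lceil>p * rho\<rceil> - 1)"
    have prho: "p * rho > 0" using p0 rho by simp
    then have cl: "\<lceil>p * rho\<rceil> \<ge> 1" by linarith
    have q: "real q < p * rho" "real q \<ge> p * rho - 1"
    proof -
      have "real q = of_int \<lceil>p * rho\<rceil> - 1" using cl by (simp add: q_def)
      then show "real q < p * rho" "real q \<ge> p * rho - 1" by linarith+
    qed
    have qM: "q \<le> p * M"
    proof -
      have "p * rho \<le> p * M" using rho by (simp add: mult_left_mono)
      then have "real q \<le> real (p * M)" using q by simp
      then show ?thesis by (simp only: of_nat_le_iff)
    qed
    have "real q * T n < real p * T (Suc n)"
      using q(1) T(2)[of n] by (simp add: rho_def field_simps)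
    then have lt: "(g ^^ q) (y n) < (g' ^^ p) (y n)"
      using order_n[of q "b n" "int (i n) - int n" p "b (Suc n)" "int (i (Suc n)) - int (Suc n)" n]
      unfolding bi(2)[of n] bi(2)[of "Suc n"] by (simp add: g_def g'_def algebra_simps)
    define D where "D = g' (y n) - y n"
    have D0: "D > 0"
      using order_n[of 0 "b n" 0 1 "b (Suc n)" "int (i (Suc n)) - int (Suc n)" n] T(2)[of "Suc n"]
      unfolding bi(2)[of "Suc n"] by (simp add: D_def g'_def algebra_simps)
    have g_near: "(1 - e) * (t - s) \<le> g t - g s \<and> g t - g s \<le> (1 + e) * (t - s)"
      if "u n \<le> s" "s \<le> t" "t \<le> v n" for s t
      using elim(1) bi(1)[of n] that unfolding g_def by force
    have g'_near: "(1 - e) * (t - s) \<le> g' t - g' s \<and> g' t - g' s \<le> (1 + e) * (t - s)"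
      if "u n \<le> s" "s \<le> t" "t \<le> v n" for s t
      using elim(1) bi(1)[of "Suc n"] that unfolding g'_def by force
    have "W n * q * (1 - e) ^ q \<le> (g ^^ q) (y n) - y n"
      using near_translation_powers(1)[of g "u n" "v n" "y n" e q] W0[of n] mono fixd uv[of n] e g_near
      by (auto simp: g_def W_def less_imp_le)
    moreover have "(g' ^^ p) (y n) - y n \<le> D * p * (1 + e) ^ p"
      using near_translation_powers(2)[of g' "u n" "v n" "y n" e p] D0 mono fixd uv[of n] e g'_near
      by (auto simp: g'_def D_def less_imp_le)
    ultimately have WD: "W n * q * (1 - e) ^ q \<le> D * p * (1 + e) ^ p" using lt by linarith
    have "W n * (rho * ((1 - M / p) * (1 - e) ^ (p * M + p))) \<le> D"
    proof -
      have "rho * (1 - M / p) \<le> q / p"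
      proof -
        have "rho * (1 - M / p) = (p * rho - M * rho) / p" using p0 by (simp add: field_simps)
        also have "\<dots> \<le> q / p" using q rho p0 by (intro divide_right_mono) auto
        finally show ?thesis .
      qed
      moreover have "(1 - e) ^ (p * M) \<le> (1 - e) ^ q" using e qM by (intro power_decreasing) auto
      ultimately have "rho * (1 - M / p) * (1 - e) ^ (p * M) \<le> q / p * (1 - e) ^ q"
        using e by (intro mult_mono) auto
      then have "W n * (rho * (1 - M / p) * (1 - e) ^ (p * M)) * (1 - e) ^ p \<le> W n * (q / p * (1 - e) ^ q) * (1 - e) ^ p"
        using W0[of n] e by (intro mult_right_mono mult_left_mono) auto
      also have "\<dots> = (W n * q * (1 - e) ^ q) * (1 - e) ^ p / p" by simp
      also have "\<dots> \<le> (D * p * (1 + e) ^ p) * (1 - e) ^ p / p"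
        using WD e by (intro divide_right_mono mult_right_mono) auto
      also have "\<dots> = D * (((1 + e) * (1 - e)) ^ p)" using p0 by (simp add: power_mult_distrib)
      also have "\<dots> \<le> D * 1"
        using D0 e mult_le_one[of e e] by (intro mult_left_mono power_le_one) (auto simp: algebra_simps)
      finally show ?thesis by (simp add: power_add mult_ac)
    qed
    then have "(1 - e) * (W n * (rho * ((1 - M / p) * (1 - e) ^ (p * M + p)))) / (v n - u n) \<le> (1 - e) * D / (v n - u n)"
      using e uv[of n] by (intro divide_right_mono mult_left_mono) auto
    \<comment> \<open>B maps the displacement of \<open>g'\<close> on the n-th gap to the
      displacement of the dominant element on the next gap; relative to the gaps this costs one
      factor 1 - e.\<close>
    also have "(1 - e) * D / (v n - u n) \<le> R (Suc n)"
    proof -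
      have "u n \<le> y n" "y n \<le> g' (y n)" "g' (y n) \<le> v n"
        using uv[of n] D0 mono fixd by (auto simp: D_def g'_def less_imp_le) (metis less_imp_le strict_mono_less)
      then have "(1 - e) * (D / (v n - u n)) \<le> (B (g' (y n)) - B (y n)) / (v (Suc n) - u (Suc n))"
        using elim(2) unfolding D_def by blast
      then show ?thesis by (simp add: R_def W_def g'_def conj y)
    qed
    also have "(1 - e) * (W n * (rho * ((1 - M / p) * (1 - e) ^ (p * M + p)))) / (v n - u n) =
        rho * R n * ((1 - M / p) * (1 - e) ^ N)"
      by (simp add: R_def N_def power_add mult_ac)
    finally have "rho * R n * ((1 - M / p) * (1 - e) ^ N) \<le> R (Suc n)" .
    moreover have "rho * R n * ka \<le> rho * R n * ((1 - M / p) * (1 - e) ^ N)"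
      using key rho R0[of n] by (intro mult_left_mono) auto
    ultimately have "rho * R n * ka \<le> R (Suc n)" by linarith
    then show ?case using T(2)[of n] lam by (simp add: rho_def ka_def field_simps)
  qed
  then obtain n0 where n0: "\<And>n. n \<ge> n0 \<Longrightarrow> T (Suc n) * R n \<le> lam * T n * R (Suc n)"
    by (auto simp: eventually_sequentially)
  \<comment> \<open>From stage n0 on, T n / R n is at most C lam^(n - n0). As R n <= 1, this bounds
    T n itself; the finitely many earlier stages are absorbed into C'.\<close>
  define C where "C = T n0 / R n0"
  have C: "T (n0 + n) \<le> C * lam ^ n * R (n0 + n)" for n
  proof (induction n)
    case (Suc n)
    have "T (n0 + Suc n) * R (n0 + n) \<le> lam * T (n0 + n) * R (n0 + Suc n)" using n0[of "n0 + n"] by simp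
    also have "\<dots> \<le> lam * (C * lam ^ n * R (n0 + n)) * R (n0 + Suc n)"
      using Suc lam R0[of "n0 + Suc n"] by (intro mult_right_mono mult_left_mono) auto
    finally show ?case using R0[of "n0 + n"] by (simp add: mult_ac)
  qed (use R0[of n0] in \<open>simp add: C_def\<close>)
  define C' where "C' = C + (\<Sum>k\<le>n0. T k)"
  have C0: "C \<ge> 0" using T(2)[of n0] R0[of n0] by (simp add: C_def)
  have C'0: "C' \<ge> 0"
    unfolding C'_def using C0 T(2) by (intro add_nonneg_nonneg sum_nonneg) (auto simp: less_imp_le)
  have CC': "C \<le> C'"
    unfolding C'_def using T(2) by (simp add: sum_nonneg less_imp_le)
  have "T n \<le> C' * lam ^ n" for n
  proof (cases "n \<le> n0")
    case True
    have "T n \<le> (\<Sum>k\<le>n0. T k)" using True T(2) by (intro member_le_sum) (auto simp: less_imp_le)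
    also have "\<dots> \<le> C'" using C0 by (simp add: C'_def)
    also have "\<dots> \<le> C' * lam ^ n"
      using mult_left_mono[OF one_le_power[of lam n] C'0] lam by simp
    finally show ?thesis .
  next
    case False
    then obtain k where k: "n = n0 + k" using le_Suc_ex nat_le_linear by blast
    have "T n \<le> C * lam ^ k * R n" using C[of k] k by simp
    also have "\<dots> \<le> C * lam ^ k * 1" using R1[of n] C0 lam by (intro mult_left_mono) auto
    also have "\<dots> \<le> C' * lam ^ n"
      using C0 C'0 CC' lam k by (simp, intro mult_mono power_increasing) auto
    finally show ?thesis .
  qed
  then show ?thesis by blast
qed

text \<open>T m is the largest absolute value in a window of r consecutive terms. A window shifted
  by one place contains a single new term, and the recurrence expresses it through the others. The
  coefficient of the new term is a nonzero integer, so dividing by it does not increase the bound,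
  and M can be the sum of the absolute values of the coefficients.\<close>

lemma recurrence_window:
  fixes w :: "int \<Rightarrow> real" and q :: "nat \<Rightarrow> int"
  assumes r: "r \<ge> 1" and rec: "\<And>k. (\<Sum>j\<le>r. of_int (q j) * w (k + int j)) = 0"
    and q: "q 0 \<noteq> 0" "q r \<noteq> 0"
  obtains T :: "int \<Rightarrow> real" and M :: nat
  where "\<And>m. \<exists>i<r. T m = \<bar>w (m + int i)\<bar>" "\<And>m i. i < r \<Longrightarrow> \<bar>w (m + int i)\<bar> \<le> T m"
    "\<And>m. T (m + 1) \<le> M * T m" "\<And>m. T m \<le> M * T (m + 1)"
proof -
  define T where "T m = Max ((\<lambda>i. \<bar>w (m + int i)\<bar>) ` {..<r})" for m
  define M where "M = nat (\<Sum>j\<le>r. \<bar>q j\<bar>)"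
  have ne: "(\<lambda>i. \<bar>w (m + int i)\<bar>) ` {..<r} \<noteq> {}" for m using r by (auto simp: lessThan_empty_iff)
  have att: "\<exists>i<r. T m = \<bar>w (m + int i)\<bar>" for m
    using Max_in[OF _ ne[of m]] unfolding T_def by auto
  have ge: "\<bar>w (m + int i)\<bar> \<le> T m" if "i < r" for m i
    unfolding T_def using that by (intro Max_ge) auto
  have T0: "T m \<ge> 0" for m using att[of m] by (metis abs_ge_zero)
  have M: "real M = (\<Sum>j\<le>r. \<bar>of_int (q j)\<bar>)"
    by (simp add: M_def sum_nonneg)
  have Mq: "\<bar>of_int (q j)\<bar> \<le> real M" if "j \<le> r" for j
    unfolding M using that by (intro member_le_sum) auto
  have M1: "real M \<ge> 1" using Mq[of 0] q(1) by linarith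
  have bound: "\<bar>w (k + int i)\<bar> \<le> M * S" if i: "i \<le> r" "q i \<noteq> 0"
    and S: "\<And>j. j \<le> r \<Longrightarrow> j \<noteq> i \<Longrightarrow> \<bar>w (k + int j)\<bar> \<le> S" "S \<ge> 0" for k i and S :: real
  proof -
    have "(\<Sum>j\<le>r. of_int (q j) * w (k + int j)) =
        of_int (q i) * w (k + int i) + (\<Sum>j\<in>{..r} - {i}. of_int (q j) * w (k + int j))"
      using i by (intro sum.remove) auto
    then have "\<bar>of_int (q i) * w (k + int i)\<bar> = \<bar>\<Sum>j\<in>{..r} - {i}. of_int (q j) * w (k + int j)\<bar>"
      using rec[of k] by linarith
    also have "\<dots> \<le> (\<Sum>j\<in>{..r} - {i}. \<bar>of_int (q j)\<bar> * \<bar>w (k + int j)\<bar>)"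
      by (rule order_trans[OF sum_abs]) (simp add: abs_mult)
    also have "\<dots> \<le> (\<Sum>j\<in>{..r} - {i}. \<bar>of_int (q j)\<bar> * S)"
      using S by (intro sum_mono mult_left_mono) auto
    also have "\<dots> \<le> (\<Sum>j\<le>r. \<bar>of_int (q j)\<bar> * S)"
      using S by (intro sum_mono2) auto
    also have "\<dots> = M * S" by (simp add: M sum_distrib_right)
    finally have "\<bar>of_int (q i)\<bar> * \<bar>w (k + int i)\<bar> \<le> M * S" by (simp add: abs_mult)
    moreover have "1 * \<bar>w (k + int i)\<bar> \<le> \<bar>of_int (q i)\<bar> * \<bar>w (k + int i)\<bar>"
      using i(2) by (intro mult_right_mono) linarith+
    ultimately show ?thesis by simp
  qed
  have T_M: "T m \<le> M * T m" for m using mult_right_mono[OF M1 T0[of m]] by simp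
  show thesis
  proof (rule that[OF att ge])
    fix m
    obtain i where i: "i < r" "T (m + 1) = \<bar>w (m + 1 + int i)\<bar>" using att[of "m + 1"] by blast
    show "T (m + 1) \<le> M * T m"
    proof (cases "Suc i < r")
      case True
      then have "T (m + 1) \<le> T m" using ge[of "Suc i" m] i by (simp add: add.commute add.left_commute)
      then show ?thesis using T_M[of m] by linarith
    next
      case False
      then have "Suc i = r" using i by simp
      then have eq: "m + 1 + int i = m + int r" by linarith
      have "\<bar>w (m + int r)\<bar> \<le> M * T m"
        by (rule bound) (use q ge T0 in auto)
      then show ?thesis unfolding i(2) eq .
    qed
    obtain i where i: "i < r" "T m = \<bar>w (m + int i)\<bar>" using att[of m] by blast
    show "T m \<le> M * T (m + 1)"
    proof (cases i)
      case (Suc l)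
      then have "T m \<le> T (m + 1)" using ge[of l "m + 1"] i by (simp add: add.assoc)
      then show ?thesis using T_M[of "m + 1"] by linarith
    next
      case 0
      have "\<bar>w (m + int j)\<bar> \<le> T (m + 1)" if "j \<le> r" "j \<noteq> 0" for j
        using ge[of "j - 1" "m + 1"] that by (simp add: of_nat_diff algebra_simps)
      then have "\<bar>w (m + int 0)\<bar> \<le> M * T (m + 1)"
        by (intro bound) (use q T0 in auto)
      then show ?thesis using i 0 by simp
    qed
  qed auto
qed

text \<open>The gaps and base points are now the images under \<open>B ^^ n\<close>. The estimates
  for single maps become simultaneous because only two signs and r + 1 indices occur, and
  conjugation carries the fixed endpoints along.\<close>

lemma window_subexponential_orbit:
  fixes c :: "bool \<Rightarrow> int \<Rightarrow> real \<Rightarrow> real" and w :: "bool \<Rightarrow> int \<Rightarrow> real"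
    and T :: "nat \<Rightarrow> real" and r M :: nat
  assumes B: "strict_mono B" and uv: "u < x" "x < v"
    and conj: "\<And>b k t. B (c b k t) = c b (k + 1) (B t)"
    and mono: "\<And>b k. strict_mono (c b k)"
    and fixd: "\<And>b k. c b k u = u" "\<And>b k. c b k v = v"
    and order: "\<And>p q b k b' l. real q * w b' l < real p * w b k \<Longrightarrow> (c b' l ^^ q) x < (c b k ^^ p) x"
    and near: "\<And>b k e. e > 0 \<Longrightarrow> \<forall>\<^sub>F n in sequentially. \<forall>s t. (B ^^ n) u \<le> s \<and> s \<le> t \<and> t \<le> (B ^^ n) v \<longrightarrow>
        (1 - e) * (t - s) \<le> c b k t - c b k s \<and> c b k t - c b k s \<le> (1 + e) * (t - s)"
    and distort: "\<And>e. e > 0 \<Longrightarrow> \<forall>\<^sub>F n in sequentially. \<forall>s t. (B ^^ n) u \<le> s \<and> s \<le> t \<and> t \<le> (B ^^ n) v \<longrightarrow>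
        (1 - e) * ((t - s) / ((B ^^ n) v - (B ^^ n) u)) \<le> (B t - B s) / ((B ^^ Suc n) v - (B ^^ Suc n) u)"
    and T: "\<And>n. \<exists>b. \<exists>i<r. T n = w b (int i - int n)" "\<And>n. T n > 0"
      "\<And>n. T (Suc n) \<le> M * T n" "\<And>n. T n \<le> M * T (Suc n)"
    and lam: "lam > 1"
  shows "\<exists>C. \<forall>n. T n \<le> C * lam ^ n"
proof (rule window_subexponential[where B = B and c = c and w = w and r = r and M = M
      and y = "\<lambda>n. (B ^^ n) x" and u = "\<lambda>n. (B ^^ n) u" and v = "\<lambda>n. (B ^^ n) v"])
  have Bn: "strict_mono (B ^^ n)" for n
    by (induction n) (use B in \<open>auto simp: strict_mono_def\<close>)
  show "(B ^^ n) u < (B ^^ n) x" "(B ^^ n) x < (B ^^ n) v" for n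
    using Bn[of n] uv by (auto simp: strict_mono_less)
  have "c b (k + int n) ((B ^^ n) t) = (B ^^ n) (c b k t)" for b k n t
  proof (induction n)
    case (Suc n)
    then show ?case using conj[of b "k + int n" "(B ^^ n) t"] by (simp add: algebra_simps)
  qed simp
  then have "c b k ((B ^^ n) t) = (B ^^ n) (c b (k - int n) t)" for b k n t
    by (metis diff_add_cancel)
  then show "c b k ((B ^^ n) u) = (B ^^ n) u" "c b k ((B ^^ n) v) = (B ^^ n) v" for b k n
    by (simp_all add: fixd)
  show "\<forall>\<^sub>F n in sequentially. \<forall>b. \<forall>k\<in>{-1..<int r}. \<forall>s t. (B ^^ n) u \<le> s \<and> s \<le> t \<and> t \<le> (B ^^ n) v \<longrightarrow>
        (1 - e) * (t - s) \<le> c b k t - c b k s \<and> c b k t - c b k s \<le> (1 + e) * (t - s)" if "e > 0" for e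
    by (intro eventually_all_finite eventually_ball_finite ballI near that) auto
qed (use assms in auto)

text \<open>The contradiction on a wandering gap, for an abstract additive group E in place of H0
  and the two-sided A-orbit e of one element. The estimates are assumed for both \<open>B\<close>
  and its inverse, one for each direction of time.\<close>

lemma hyperbolic_wandering_trivial:
  fixes C :: "'h :: comm_ring_1 \<Rightarrow> real \<Rightarrow> real" and e :: "int \<Rightarrow> 'h" and P :: "int poly"
  assumes E: "0 \<in> E" "\<And>x y. x \<in> E \<Longrightarrow> y \<in> E \<Longrightarrow> x + y \<in> E" "\<And>x. x \<in> E \<Longrightarrow> - x \<in> E"
    and C: "\<And>h. h \<in> E \<Longrightarrow> strict_mono (C h)" "\<And>h k t. h \<in> E \<Longrightarrow> k \<in> E \<Longrightarrow> C (h + k) t = C h (C k t)"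
      "\<And>t. C 0 t = t"
    and e: "\<And>k. e k \<in> E"
    and B: "strict_mono B" "\<And>t. B (B' t) = t" "\<And>t. B' (B t) = t"
    and conj: "\<And>k t. B (C (e k) t) = C (e (k + 1)) (B t)"
    and uv: "u < x" "x < v" and fixd: "\<And>h. h \<in> E \<Longrightarrow> C h u = u" "\<And>h. h \<in> E \<Longrightarrow> C h v = v"
    and P: "Polynomial.degree P \<ge> 1" "poly.coeff P 0 \<noteq> 0"
      "\<And>z :: complex. poly (map_poly of_int P) z = 0 \<Longrightarrow> cmod z \<noteq> 1"
    and rec: "\<And>k. (\<Sum>j\<le>Polynomial.degree P. of_int (poly.coeff P j) * e (k + int j)) = 0"
    and near: "\<And>\<beta> h \<epsilon>. \<beta> \<in> {B, B'} \<Longrightarrow> h \<in> E \<Longrightarrow> \<epsilon> > 0 \<Longrightarrow> \<forall>\<^sub>F n in sequentially. \<forall>s t.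
        (\<beta> ^^ n) u \<le> s \<and> s \<le> t \<and> t \<le> (\<beta> ^^ n) v \<longrightarrow>
        (1 - \<epsilon>) * (t - s) \<le> C h t - C h s \<and> C h t - C h s \<le> (1 + \<epsilon>) * (t - s)"
    and distort: "\<And>\<beta> \<epsilon>. \<beta> \<in> {B, B'} \<Longrightarrow> \<epsilon> > 0 \<Longrightarrow> \<forall>\<^sub>F n in sequentially. \<forall>s t.
        (\<beta> ^^ n) u \<le> s \<and> s \<le> t \<and> t \<le> (\<beta> ^^ n) v \<longrightarrow>
        (1 - \<epsilon>) * ((t - s) / ((\<beta> ^^ n) v - (\<beta> ^^ n) u)) \<le> (\<beta> t - \<beta> s) / ((\<beta> ^^ Suc n) v - (\<beta> ^^ Suc n) u)"
  shows "C (e 0) x = x"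
proof (rule ccontr)
  assume moved: "C (e 0) x \<noteq> x"
  define r where "r = Polynomial.degree P"
  define q where "q = poly.coeff P"
  have r: "r \<ge> 1" using P by (simp add: r_def)
  have q: "q 0 \<noteq> 0" "q r \<noteq> 0" using P by (auto simp: q_def r_def)
  define le where "le h k \<longleftrightarrow> C h x \<le> C k x" for h k
  have En: "of_nat n * h \<in> E" if "h \<in> E" for n h
    by (induction n) (auto simp: E that distrib_right)
  have le_tr: "le h z" if "le h y" "le y z" for h y z using that by (simp add: le_def)
  have le_lin: "le h y \<or> le y h" for h y by (auto simp: le_def)
  have tr: "le (h + z) (k + z)" if "le h k" "h \<in> E" "k \<in> E" "z \<in> E" for h k z
    using that C(1)[of z] by (simp add: le_def C(2) add.commute[of _ z] strict_mono_less_eq)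
  have le_add: "le (h + z) (y + w)" if "le h y" "le z w" "h \<in> E" "y \<in> E" "z \<in> E" "w \<in> E" for h y z w
    using le_tr[OF tr[of h y z] tr[of z w y, unfolded add.commute[of _ y]]] that by simp
  have le_neg: "le (- y) (- h)" if "le h y" "h \<in> E" "y \<in> E" for h y
    using tr[OF that E(2)[OF E(3)[OF that(2)] E(3)[OF that(3)]]] by simp
  have le_nat: "le (of_nat n * h) (of_nat n * y)" if "le h y" "h \<in> E" "y \<in> E" for n h y
    by (induction n) (use that En in \<open>auto simp: le_def[of 0] distrib_right intro!: le_add\<close>)
  have le_refl: "le h h" for h by (simp add: le_def)
  \<comment> \<open>The first window of the orbit, with signs. Its element moving x farthest to the
    right will be the unit of the order functional.\<close>
  define Z where "Z = e ` (int ` {..<r}) \<union> uminus ` e ` (int ` {..<r})"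
  have Z: "finite Z" "Z \<noteq> {}" "Z \<subseteq> E" "\<And>h. h \<in> Z \<Longrightarrow> - h \<in> Z" using r e E by (auto simp: Z_def lessThan_empty_iff)
  obtain c where c: "c \<in> Z" "\<And>h. h \<in> Z \<Longrightarrow> le h c"
  proof -
    have "Max ((\<lambda>h. C h x) ` Z) \<in> (\<lambda>h. C h x) ` Z" using Z(1,2) by (intro Max_in) auto
    then obtain c where c: "c \<in> Z" "C c x = Max ((\<lambda>h. C h x) ` Z)" by auto
    have "le h c" if "h \<in> Z" for h unfolding le_def c(2) using that Z(1) by (intro Max_ge) auto
    then show thesis using c(1) that by blast
  qed
  have cE: "c \<in> E" using c Z by blast
  \<comment> \<open>\<open>e 0\<close> moves x, so it or its inverse moves x to the right, and the
    maximal element moves x at least as far.\<close>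
  have c0: "le 0 c" and c_pos: "x < C c x"
  proof -
    have "e 0 \<in> Z" using r by (force simp: Z_def)
    then have "le (e 0) c" "le (- e 0) c" using c Z(4) by auto
    moreover have "x < C (e 0) x \<or> x < C (- e 0) x"
    proof (rule ccontr)
      assume "\<not> ?thesis"
      then have "le (e 0) 0" "le (- e 0) 0" by (auto simp: le_def C)
      from le_neg[OF this(2)] E e have "le 0 (e 0)" by auto
      then show False using \<open>le (e 0) 0\<close> moved by (simp add: le_def C)
    qed
    ultimately show "x < C c x" unfolding le_def by linarith
    then show "le 0 c" by (simp add: le_def C)
  qed
  \<comment> \<open>The order on E need not be Archimedean. The elements bounded on both sides by
    multiples of c form a subgroup on which c is an Archimedean unit; the next steps show that it
    contains the whole orbit.\<close>
  define F where "F = {h \<in> E. \<exists>n::nat. le h (of_nat n * c) \<and> le (- h) (of_nat n * c)}"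
  have nc: "le (of_nat m * c) (of_nat n * c)" if "m \<le> n" for m n
  proof -
    have "le (of_nat m * c + of_nat (n - m) * 0) (of_nat m * c + of_nat (n - m) * c)"
      using c0 cE En E by (intro le_add le_nat le_refl) auto
    then show ?thesis using that by (simp add: distrib_right[symmetric] flip: of_nat_add)
  qed
  have F0: "0 \<in> F" using E by (auto simp: F_def intro!: exI[of _ 0] le_refl)
  have F_neg: "- h \<in> F" if "h \<in> F" for h using that E by (auto simp: F_def)
  have F_add: "h + k \<in> F" if hk: "h \<in> F" "k \<in> F" for h k
  proof -
    obtain m n :: nat where mn: "le h (of_nat m * c)" "le (- h) (of_nat m * c)"
        "le k (of_nat n * c)" "le (- k) (of_nat n * c)" using hk by (auto simp: F_def)
    have hkE: "h \<in> E" "k \<in> E" using hk by (auto simp: F_def)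
    have "le (h + k) (of_nat m * c + of_nat n * c)" "le (- h + - k) (of_nat m * c + of_nat n * c)"
      using le_add[OF mn(1,3)] le_add[OF mn(2,4)] hkE E(3) En cE by blast+
    then have "le (h + k) (of_nat (m + n) * c)" "le (- (h + k)) (of_nat (m + n) * c)"
      by (simp_all add: distrib_right)
    then show ?thesis unfolding F_def using E(2)[OF hkE] by blast
  qed
  have F_nat: "of_nat n * h \<in> F" if "h \<in> F" for n h
    by (induction n) (auto simp: F0 F_add that distrib_right)
  have F_int: "of_int i * h \<in> F" if h: "h \<in> F" for i h
  proof (cases i rule: int_cases2)
    case (nonneg n)
    then show ?thesis using F_nat[OF h] by simp
  next
    case (nonpos n)
    then show ?thesis using F_neg[OF F_nat[OF h, of n]] by simp
  qed
  have F_sum: "(\<Sum>j\<in>J. f j) \<in> F" if "\<And>j. j \<in> J \<Longrightarrow> f j \<in> F" for J and f :: "nat \<Rightarrow> 'h"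
    using that by (induction J rule: infinite_finite_induct) (auto simp: F0 F_add)
  \<comment> \<open>The recurrence gives only an integer multiple of an end term. Dividing is
    harmless: h lies between 0 and m h in the order.\<close>
  have F_div_nat: "h \<in> F" if h: "h \<in> E" "of_nat m * h \<in> F" "m > 0" for m h
  proof -
    obtain n :: nat where n: "le (of_nat m * h) (of_nat n * c)" "le (- (of_nat m * h)) (of_nat n * c)"
      using h by (auto simp: F_def)
    have big: "le k (of_nat m * k)" if "le 0 k" "k \<in> E" for k
    proof -
      have "le (k + of_nat (m - 1) * 0) (k + of_nat (m - 1) * k)"
        using that E En by (intro le_add le_nat le_refl) auto
      moreover have "k + of_nat (m - 1) * k = of_nat m * k"
        using h(3) by (cases m) (auto simp: distrib_right)
      ultimately show ?thesis by simp
    qed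
    have c0n: "le 0 (of_nat n * c)" using nc[of 0 n] by simp
    consider "le 0 h" | "le h 0" using le_lin by blast
    then have "le h (of_nat n * c) \<and> le (- h) (of_nat n * c)"
    proof cases
      case 1
      then have "le (- h) 0" using le_neg[OF 1] E h by simp
      then show ?thesis using le_tr[OF big[OF 1 h(1)] n(1)] le_tr[OF _ c0n] by blast
    next
      case 2
      then have "le 0 (- h)" using le_neg[OF 2] E h by simp
      from big[OF this] have "le (- h) (- (of_nat m * h))" using E h by simp
      then show ?thesis using le_tr[OF _ n(2)] le_tr[OF 2 c0n] by blast
    qed
    then show ?thesis using h by (auto simp: F_def)
  qed
  have F_div: "h \<in> F" if h: "h \<in> E" "of_int i * h \<in> F" "i \<noteq> 0" for i h
  proof (cases i rule: int_cases2)
    case (nonneg n)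
    then show ?thesis using F_div_nat[of h n] h by simp
  next
    case (nonpos n)
    then show ?thesis using F_div_nat[of h n] h F_neg[OF h(2)] by simp
  qed
  have eF_solve: "e (k + int i) \<in> F" if i: "i \<le> r" "q i \<noteq> 0" and o: "\<And>j. j \<le> r \<Longrightarrow> j \<noteq> i \<Longrightarrow> e (k + int j) \<in> F" for k i
  proof -
    have "(\<Sum>j\<le>r. of_int (q j) * e (k + int j)) =
        of_int (q i) * e (k + int i) + (\<Sum>j\<in>{..r} - {i}. of_int (q j) * e (k + int j))"
      using i by (intro sum.remove) auto
    then have "of_int (q i) * e (k + int i) = - (\<Sum>j\<in>{..r} - {i}. of_int (q j) * e (k + int j))"
      using rec[of k] by (simp add: q_def r_def eq_neg_iff_add_eq_0)
    moreover have "(\<Sum>j\<in>{..r} - {i}. of_int (q j) * e (k + int j)) \<in> F"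
      using o by (intro F_sum F_int) auto
    ultimately have "of_int (q i) * e (k + int i) \<in> F" using F_neg by metis
    then show ?thesis using F_div e i(2) by blast
  qed
  \<comment> \<open>Upwards the window is continued through the leading coefficient, downwards
    through the constant one; both are nonzero.\<close>
  have eF_win: "\<forall>i<r. e (k + int i) \<in> F" for k
  proof (induction k rule: int_induct[where k = 0])
    case base
    have "e (int i) \<in> F" if "i < r" for i
    proof -
      have "e (int i) \<in> Z" using that by (auto simp: Z_def)
      then have "le (e (int i)) (of_nat 1 * c) \<and> le (- e (int i)) (of_nat 1 * c)" using c Z(4) by simp
      then show ?thesis unfolding F_def using e by blast
    qed
    then show ?case by simp
  next
    case (step1 k)
    have "e (k + int r) \<in> F" by (rule eF_solve) (use q step1 in auto)
    then have "e (k + int i) \<in> F" if "i \<le> r" for i using step1 that by (cases "i = r") auto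
    from this[of "Suc i" for i] show ?case by (auto simp: algebra_simps)
  next
    case (step2 k)
    have *: "e (k - 1 + int j) \<in> F" if "j \<le> r" "j \<noteq> 0" for j
    proof -
      have "j - 1 < r" using that by simp
      then have "e (k + int (j - 1)) \<in> F" using step2 by blast
      moreover have "k + int (j - 1) = k - 1 + int j" using that by (simp add: of_nat_diff)
      ultimately show ?thesis by metis
    qed
    have "e (k - 1 + int 0) \<in> F" by (rule eF_solve) (use q * in auto)
    then have "e (k - 1 + int i) \<in> F" if "i \<le> r" for i using * that by (cases "i = 0") auto
    then show ?case by auto
  qed
  have eF: "e k \<in> F" for k using eF_win[of k] r by (auto dest!: spec[of _ 0])
  have FE: "F \<subseteq> E" by (auto simp: F_def)
  have cF: "c \<in> F" using c(1) eF F_neg by (auto simp: Z_def)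
  obtain \<tau> :: "'h \<Rightarrow> real" where \<tau>: "\<And>h k. h \<in> F \<Longrightarrow> k \<in> F \<Longrightarrow> \<tau> (h + k) = \<tau> h + \<tau> k"
      "\<tau> c = 1" "\<And>h. h \<in> F \<Longrightarrow> \<tau> h > 0 \<Longrightarrow> C 0 x < C h x"
  proof (rule order_functional[where val = "\<lambda>h. C h x" and E = F and c = c])
    show "C (h + z) x \<le> C (k + z) x" if "h \<in> F" "k \<in> F" "z \<in> F" "C h x \<le> C k x" for h k z
      using tr[of h k z] that FE by (auto simp: le_def)
    show "\<exists>n::nat. C h x \<le> C (of_nat n * c) x" if "h \<in> F" for h using that by (auto simp: F_def le_def)
  qed (use F0 F_add F_neg cF c_pos in \<open>auto simp: C\<close>)
  have \<tau>0: "\<tau> 0 = 0" using \<tau>(1)[OF F0 F0] by simp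
  have \<tau>_neg: "\<tau> (- h) = - \<tau> h" if "h \<in> F" for h using \<tau>(1)[OF that F_neg[OF that]] \<tau>0 by simp
  have \<tau>_nat: "\<tau> (of_nat n * h) = n * \<tau> h" if "h \<in> F" for n h
    by (induction n) (auto simp: \<tau>0 \<tau>(1) F_nat that distrib_right)
  have \<tau>_int: "\<tau> (of_int i * h) = of_int i * \<tau> h" if h: "h \<in> F" for i h
  proof (cases i rule: int_cases2)
    case (nonneg n)
    then show ?thesis using \<tau>_nat[OF h] by simp
  next
    case (nonpos n)
    then show ?thesis using \<tau>_neg[OF F_nat[OF h, of n]] \<tau>_nat[OF h, of n] by simp
  qed
  have \<tau>_sum: "\<tau> (\<Sum>j\<in>J. f j) = (\<Sum>j\<in>J. \<tau> (f j))" if "\<And>j. j \<in> J \<Longrightarrow> f j \<in> F" for J and f :: "nat \<Rightarrow> 'h"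
    using that by (induction J rule: infinite_finite_induct) (auto simp: \<tau>0 \<tau>(1) F_sum)
  define w where "w k = \<tau> (e k)" for k
  have w_rec: "(\<Sum>j\<le>r. of_int (q j) * w (k + int j)) = 0" for k
  proof -
    have "\<tau> (\<Sum>j\<le>r. of_int (q j) * e (k + int j)) = (\<Sum>j\<le>r. of_int (q j) * w (k + int j))"
      by (subst \<tau>_sum) (auto simp: F_int eF \<tau>_int w_def)
    then show ?thesis using rec[of k] \<tau>0 by (simp add: q_def r_def)
  qed
  obtain T :: "int \<Rightarrow> real" and M :: nat where T: "\<And>m. \<exists>i<r. T m = \<bar>w (m + int i)\<bar>"
      "\<And>m i. i < r \<Longrightarrow> \<bar>w (m + int i)\<bar> \<le> T m" "\<And>m. T (m + 1) \<le> M * T m" "\<And>m. T m \<le> M * T (m + 1)"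
    using recurrence_window[OF r w_rec q] by metis
  \<comment> \<open>The unit c is some \<open>e i\<close> or its negative, and \<tau> c = 1.\<close>
  have w_nz: "\<exists>k. w k \<noteq> 0"
    using c(1) \<tau>(2) \<tau>_neg[OF eF] by (auto simp: Z_def w_def) (metis zero_neq_one, metis neg_0_equal_iff_equal zero_neq_one)
  have T_pos: "T m > 0" for m
  proof (rule ccontr)
    have nn: "T m \<ge> 0" for m using T(1)[of m] by (metis abs_ge_zero)
    assume "\<not> T m > 0"
    then have m: "T m = 0" using nn[of m] by simp
    have "T l = 0" for l
    proof (induction l rule: int_induct[where k = m])
      case (step1 i)
      then show ?case using T(3)[of i] nn[of "i + 1"] by simp
    next
      case (step2 i)
      then show ?case using T(4)[of "i - 1"] nn[of "i - 1"] by simp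
    qed (rule m)
    then have "w l = 0" for l using T(2)[of 0 l] r by simp
    then show False using w_nz by blast
  qed
  \<comment> \<open>The Boolean is a sign. With it, the absolute value of any \<open>w k\<close> is
    the value of \<tau> at an element of F, so the dominant element of a window moves x to the
    right.\<close>
  define sg where "sg b k = (if b then e k else - e k)" for b k
  define ww where "ww b k = (if b then w k else - w k)" for b k
  have sgF: "sg b k \<in> F" for b k using eF F_neg by (auto simp: sg_def)
  then have sgE: "sg b k \<in> E" for b k using FE by blast
  have \<tau>_sg: "\<tau> (sg b k) = ww b k" for b k using eF \<tau>_neg by (auto simp: sg_def ww_def w_def)
  have C_pow: "C (of_nat n * h) t = (C h ^^ n) t" if "h \<in> E" for n h t
    by (induction n) (use that in \<open>auto simp: C En distrib_right\<close>)
  have order: "(C (sg b' l) ^^ m) x < (C (sg b k) ^^ p) x" if "real m * ww b' l < real p * ww b k" for m p b' l b k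
  proof -
    let ?h = "of_nat p * sg b k" and ?h' = "of_nat m * sg b' l"
    have in_F: "?h \<in> F" "?h' \<in> F" using F_nat sgF by auto
    have "\<tau> (?h + - ?h') > 0"
      using that in_F by (simp only: \<tau>(1) F_neg \<tau>_neg \<tau>_nat sgF \<tau>_sg)
    then have pos: "C 0 x < C (?h + - ?h') x" using \<tau>(3) F_add F_neg in_F by blast
    have "\<not> le ?h ?h'"
    proof
      assume "le ?h ?h'"
      then have "le (?h + - ?h') (?h' + - ?h')" using in_F FE F_neg by (intro tr) auto
      then show False using pos by (simp add: le_def)
    qed
    then show ?thesis by (simp add: le_def C_pow sgE)
  qed
  have conj': "B (C (sg b k) t) = C (sg b (k + 1)) (B t)" for b k t
  proof (cases b)
    case False
    have "C (e (k + 1)) (B (C (- e k) t)) = B (C (e k) (C (- e k) t))" by (simp add: conj)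
    also have "\<dots> = B t" using C(2)[OF e E(3)[OF e], of k k t] by (simp add: C)
    finally have "C (- e (k + 1)) (B t) = C (- e (k + 1)) (C (e (k + 1)) (B (C (- e k) t)))" by simp
    also have "\<dots> = B (C (- e k) t)" using C(2)[OF E(3)[OF e] e, of "k + 1" "k + 1"] by (simp add: C)
    finally show ?thesis using False by (simp add: sg_def)
  qed (simp add: sg_def conj)
  have B'_mono: "strict_mono B'" unfolding strict_mono_def using B by (metis strict_mono_less)
  have sub: "\<exists>K. \<forall>k. cmod (complex_of_real (w k)) \<le> K * l ^ nat \<bar>k\<bar>" if l: "l > 1" for l
  proof -
    \<comment> \<open>Since B raises indices, what it carries to index i at stage n started at index
      i - n: iterating B controls the past of the orbit.\<close>
    have "\<exists>K. \<forall>n. T (- int n) \<le> K * l ^ n"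
    proof (rule window_subexponential_orbit[where B = B and u = u and x = x and v = v and c = "\<lambda>b k. C (sg b k)"
          and w = ww and r = r and M = M])
      show "\<exists>b. \<exists>i<r. T (- int n) = ww b (int i - int n)" for n
      proof -
        obtain i where i: "i < r" "T (- int n) = \<bar>w (- int n + int i)\<bar>" using T(1) by blast
        show ?thesis
          by (rule exI[of _ "w (- int n + int i) \<ge> 0"], rule exI[of _ i]) (use i in \<open>auto simp: ww_def\<close>)
      qed
      show "T (- int (Suc n)) \<le> M * T (- int n)" for n using T(4)[of "- int (Suc n)"] by simp
      show "T (- int n) \<le> M * T (- int (Suc n))" for n using T(3)[of "- int (Suc n)"] by simp
    qed (use B uv conj' C(1) sgE fixd order near[of B] distort[of B] T_pos l in auto)
    then obtain K where K: "\<And>n. T (- int n) \<le> K * l ^ n" by blast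
    \<comment> \<open>For the future, B is replaced by its inverse and the indices are negated. At
      stage n the window consists of the indices n - i with i < r, whose smallest is n - r +
      1.\<close>
    have "\<exists>K. \<forall>n. T (int n - int r + 1) \<le> K * l ^ n"
    proof (rule window_subexponential_orbit[where B = B' and u = u and x = x and v = v
          and c = "\<lambda>b k. C (sg b (- k))" and w = "\<lambda>b k. ww b (- k)" and r = r and M = M])
      show "\<exists>b. \<exists>i<r. T (int n - int r + 1) = ww b (- (int i - int n))" for n
      proof -
        obtain i where i: "i < r" "T (int n - int r + 1) = \<bar>w (int n - int r + 1 + int i)\<bar>" using T(1) by blast
        have eq: "- (int (r - 1 - i) - int n) = int n - int r + 1 + int i" using i by (simp add: of_nat_diff)
        define k where "k = int n - int r + 1 + int i"
        have "T (int n - int r + 1) = ww (w k \<ge> 0) k" using i by (auto simp: ww_def k_def)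
        then have "T (int n - int r + 1) = ww (w k \<ge> 0) (- (int (r - 1 - i) - int n))"
          by (simp only: eq k_def)
        moreover have "r - 1 - i < r" using r by simp
        ultimately show ?thesis by blast
      qed
      show "T (int (Suc n) - int r + 1) \<le> M * T (int n - int r + 1)" for n
        using T(3)[of "int n - int r + 1"] by (simp add: algebra_simps)
      show "T (int n - int r + 1) \<le> M * T (int (Suc n) - int r + 1)" for n
        using T(4)[of "int n - int r + 1"] by (simp add: algebra_simps)
      show "B' (C (sg b (- k)) t) = C (sg b (- (k + 1))) (B' t)" for b k t
        using conj'[of b "- (k + 1)" "B' t"] B by (metis (no_types, opaque_lifting) add.commute add.inverse_inverse add_uminus_conv_diff minus_add_cancel minus_diff_eq)
    qed (use B'_mono uv C(1) sgE fixd order near[of B'] distort[of B'] T_pos l in auto)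
    then obtain K' where K': "\<And>n. T (int n - int r + 1) \<le> K' * l ^ n" by blast
    have "cmod (complex_of_real (w k)) \<le> (\<bar>K\<bar> + \<bar>K'\<bar>) * l ^ nat \<bar>k\<bar>" for k
    proof -
      have lp: "l ^ nat \<bar>k\<bar> \<ge> 0" using l by simp
      consider n where "k = int n" | n where "k = - int n" by (cases k rule: int_cases2)
      then have "\<bar>w k\<bar> \<le> K * l ^ nat \<bar>k\<bar> \<or> \<bar>w k\<bar> \<le> K' * l ^ nat \<bar>k\<bar>"
      proof cases
        case 1
        have eq: "int n - int r + 1 + int (r - 1) = int n" using r by (simp add: of_nat_diff)
        have "\<bar>w (int n)\<bar> \<le> T (int n - int r + 1)"
          using T(2)[of "r - 1" "int n - int r + 1"] r unfolding eq by simp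
        then show ?thesis using K'[of n] 1 by simp
      next
        case 2
        then show ?thesis using T(2)[of 0 "- int n"] K[of n] r by simp
      qed
      moreover have "K * l ^ nat \<bar>k\<bar> \<le> (\<bar>K\<bar> + \<bar>K'\<bar>) * l ^ nat \<bar>k\<bar>" "K' * l ^ nat \<bar>k\<bar> \<le> (\<bar>K\<bar> + \<bar>K'\<bar>) * l ^ nat \<bar>k\<bar>"
        using lp by (auto intro!: mult_right_mono)
      ultimately show ?thesis by auto
    qed
    then show ?thesis by blast
  qed
  have "complex_of_real (w k) = 0" for k
  proof (rule subexponential_recurrence_zero[where P = "map_poly of_int P" and w = "\<lambda>k. complex_of_real (w k)"])
    have d: "Polynomial.degree (map_poly of_int P :: complex poly) = r" by (simp add: r_def)
    show "(map_poly of_int P :: complex poly) \<noteq> 0" using d r by auto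
    have "complex_of_real (\<Sum>j\<le>r. of_int (q j) * w (k + int j)) = 0" for k by (simp only: w_rec of_real_0)
    then show "(\<Sum>j\<le>Polynomial.degree (map_poly of_int P :: complex poly). poly.coeff (map_poly of_int P) j * complex_of_real (w (k + int j))) = 0" for k
      unfolding d by (simp add: coeff_map_poly q_def)
  qed (use P sub in auto)
  then show False using w_nz by simp
qed

subsection \<open>Lifts of C1 diffeomorphisms\<close>

text \<open>Positivity of the derivative encodes that the inverse is again C1.\<close>

definition C1_lift :: "(real \<Rightarrow> real) \<Rightarrow> bool" where
  "C1_lift F \<longleftrightarrow> deg1 F \<and>
     (\<exists>F'. (\<forall>t. (F has_real_derivative F' t) (at t)) \<and> continuous_on UNIV F' \<and> (\<forall>t. F' t > 0))"

text \<open>Near t0 the lift equals \<open>F t0\<close> plus the argument of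
  \<open>cis (F t) / cis (F t0)\<close>, and the principal logarithm is smooth near 1. Continuity
  keeps \<open>F t\<close> within pi of \<open>F t0\<close>, so no branch is crossed.\<close>

lemma lift_differentiable:
  fixes F :: "real \<Rightarrow> real"
  assumes F: "continuous_on UNIV F" and g: "(\<lambda>t. cis (F t)) C1_differentiable_on UNIV"
  obtains F' where "\<And>t. (F has_real_derivative F' t) (at t)" "continuous_on UNIV F'"
proof -
  obtain D where D: "\<And>t. ((\<lambda>t. cis (F t)) has_vector_derivative D t) (at t)" "continuous_on UNIV D"
    using g by (auto simp: C1_differentiable_on_def)
  have "(F has_real_derivative Im (D t0 / cis (F t0))) (at t0)" for t0
  proof -
    have d1: "((\<lambda>t. cis (F t) / cis (F t0)) has_vector_derivative D t0 / cis (F t0)) (at t0)"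
      by (rule has_vector_derivative_divide[OF D(1)])
    have "(Ln has_field_derivative inverse 1) (at (cis (F t0) / cis (F t0)))"
      using has_field_derivative_Ln[of 1] by simp
    from field_vector_diff_chain_at[OF d1 this]
    have "((\<lambda>t. Ln (cis (F t) / cis (F t0))) has_vector_derivative D t0 / cis (F t0)) (at t0)"
      by (simp add: o_def)
    from bounded_linear.has_vector_derivative[OF bounded_linear_Im this]
    have d2: "((\<lambda>t. Im (Ln (cis (F t) / cis (F t0))) + F t0) has_vector_derivative Im (D t0 / cis (F t0))) (at t0)"
      by (auto intro!: derivative_eq_intros)
    have "isCont F t0" using F by (simp add: continuous_on_eq_continuous_at)
    then have "\<forall>\<^sub>F t in nhds t0. F t \<in> {F t0 - pi <..< F t0 + pi}"
      using pi_gt_zero unfolding isCont_def tendsto_at_iff_tendsto_nhds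
      by (intro topological_tendstoD[of F]) auto
    then have ev: "\<forall>\<^sub>F t in nhds t0. Im (Ln (cis (F t) / cis (F t0))) + F t0 = F t"
    proof eventually_elim
      case (elim t)
      have "cis (F t) / cis (F t0) = exp (\<i> * of_real (F t - F t0))" unfolding cis_divide by (rule cis_conv_exp)
      moreover have "Ln (exp (\<i> * of_real (F t - F t0))) = \<i> * of_real (F t - F t0)"
        using elim by (intro Ln_exp) auto
      ultimately show ?case by simp
    qed
    then obtain V where V: "open V" "t0 \<in> V" "\<And>t. t \<in> V \<Longrightarrow> Im (Ln (cis (F t) / cis (F t0))) + F t0 = F t"
      unfolding eventually_nhds by blast
    have "(F has_vector_derivative Im (D t0 / cis (F t0))) (at t0)"
      by (rule has_vector_derivative_transform_within_open[OF d2 V])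
    then show ?thesis by (simp add: has_real_derivative_iff_has_vector_derivative)
  qed
  moreover have "continuous_on UNIV (\<lambda>t. Im (D t / cis (F t)))"
    by (intro continuous_intros D F) auto
  ultimately show thesis by (rule that)
qed

text \<open>The composite of G and F is a translation, so by the chain rule the derivative of F has
  no zero; monotonicity makes it nonnegative.\<close>

lemma C1_lift_of_inverse_pair:
  assumes F: "deg1 F" "\<And>t. (F has_real_derivative F' t) (at t)" "continuous_on UNIV F'"
    and G: "\<And>t. (G has_real_derivative G' t) (at t)"
    and inv: "\<And>t. cis (G (F t)) = cis t"
  shows "C1_lift F"
proof -
  have contG: "continuous_on UNIV G"
    using G by (meson DERIV_continuous_on UNIV_I has_field_derivative_at_within)
  have "continuous_on UNIV (\<lambda>t. G (F t))"
    using F(1) contG by (auto simp: deg1_def intro: continuous_on_compose2)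
  then obtain k where k: "\<And>t. G (F t) = t + 2 * pi * of_int k"
    using lifts_differ_by_period[of "\<lambda>t. G (F t)" "\<lambda>t. t"] inv by (metis continuous_on_id)
  have nz: "F' t \<noteq> 0" for t
  proof
    assume z: "F' t = 0"
    have "((\<lambda>t. G (F t)) has_real_derivative G' (F t) * F' t) (at t)"
      by (rule DERIV_chain2[OF G F(2)])
    moreover have "((\<lambda>t. G (F t)) has_real_derivative 1) (at t)"
      unfolding k by (auto intro!: derivative_eq_intros)
    ultimately show False using z DERIV_unique by fastforce
  qed
  have "F' t \<ge> 0" for t
    using F(1,2) by (intro mono_on_imp_deriv_nonneg[of UNIV F]) (auto simp: deg1_le_iff mono_on_def)
  then show ?thesis unfolding C1_lift_def using F nz by (metis order_le_less)
qed

lemma C1_lift_add_int: "C1_lift F \<Longrightarrow> C1_lift (\<lambda>t. F t + 2 * pi * of_int k)"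
proof -
  assume "C1_lift F"
  then obtain F' where F': "\<And>t. (F has_real_derivative F' t) (at t)" "continuous_on UNIV F'" "\<And>t. F' t > 0"
    and F: "deg1 F" by (auto simp: C1_lift_def)
  have "((\<lambda>t. F t + 2 * pi * of_int k) has_real_derivative F' t) (at t)" for t
    by (auto intro!: derivative_eq_intros F')
  then show ?thesis unfolding C1_lift_def using F' deg1_add_int[OF F] by blast
qed

lemma C1_lift_inv:
  assumes "C1_lift F" shows "C1_lift (inv_into UNIV F)"
proof -
  obtain F' where F': "\<And>t. (F has_real_derivative F' t) (at t)" "continuous_on UNIV F'" "\<And>t. F' t > 0"
    and F: "deg1 F" using assms by (auto simp: C1_lift_def)
  note i = deg1_inv[OF F]
  have ci: "continuous_on UNIV (inv_into UNIV F)" using i(1) by (simp add: deg1_def)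
  have "(inv_into UNIV F has_real_derivative inverse (F' (inv_into UNIV F t))) (at t)" for t
  proof (rule DERIV_inverse_function[where f = F and a = "t - 1" and b = "t + 1"])
    show "isCont (inv_into UNIV F) t" using ci by (simp add: continuous_on_eq_continuous_at)
  qed (use F' i in \<open>auto simp: less_imp_neq[symmetric]\<close>)
  moreover have "continuous_on UNIV (\<lambda>t. inverse (F' (inv_into UNIV F t)))"
    by (intro continuous_on_inverse continuous_on_compose2[OF F'(2) ci]) (use F'(3) in \<open>auto simp: less_imp_neq[symmetric]\<close>)
  ultimately show ?thesis unfolding C1_lift_def using i(1) F'(3) by (metis positive_imp_inverse_positive)
qed

section \<open>Uniform estimates for lifts on small intervals\<close>

lemma periodic_uniformly_continuous:
  fixes f :: "real \<Rightarrow> real"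
  assumes f: "continuous_on UNIV f" and per: "\<And>t. f (t + 2 * pi) = f t"
  shows "uniformly_continuous_on UNIV f"
proof -
  have peri: "f (t + 2 * pi * of_int k) = f t" for t k
  proof (induction k rule: int_induct[where k = 0])
    case (step1 i)
    then show ?case using per[of "t + 2 * pi * of_int i"] by (simp add: algebra_simps)
  next
    case (step2 i)
    then show ?case using per[of "t + 2 * pi * of_int (i - 1)"] by (simp add: algebra_simps)
  qed simp
  \<comment> \<open>One point is moved into [0, 2 pi); a second one less than 2 pi away stays inside
    this larger interval.\<close>
  have uc: "uniformly_continuous_on {-2*pi..4*pi} f"
    by (rule compact_uniformly_continuous) (auto intro: continuous_on_subset[OF f])
  show ?thesis unfolding uniformly_continuous_on_def
  proof (intro allI impI)
    fix e :: real assume "e > 0"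
    then obtain d where d: "d > 0" "\<And>s t. s \<in> {-2*pi..4*pi} \<Longrightarrow> t \<in> {-2*pi..4*pi} \<Longrightarrow> dist t s < d \<Longrightarrow> dist (f t) (f s) < e"
      using uc unfolding uniformly_continuous_on_def by metis
    show "\<exists>d>0. \<forall>x\<in>UNIV. \<forall>x'\<in>UNIV. dist x' x < d \<longrightarrow> dist (f x') (f x) < e"
    proof (intro exI[of _ "min d (2 * pi)"] conjI ballI impI)
      fix s t :: real assume st: "dist t s < min d (2 * pi)"
      obtain u k where u: "0 \<le> u" "u < 2 * pi" "s = u + 2 * pi * of_int k" using period_reduce .
      define t' where "t' = t - 2 * pi * of_int k"
      have "dist (f t') (f u) < e"
        using u st by (intro d(2)) (auto simp: t'_def dist_real_def abs_if split: if_splits)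
      then show "dist (f t) (f s) < e" using peri[of t' k] peri[of u k] u by (simp add: t'_def)
    qed (use d in auto)
  qed
qed

lemma deg1_derivative_uniformly_continuous:
  assumes F: "deg1 F" and F': "\<And>t. (F has_real_derivative F' t) (at t)" "continuous_on UNIV F'"
  shows "uniformly_continuous_on UNIV F'"
proof (rule periodic_uniformly_continuous[OF F'(2)])
  fix t
  have "((\<lambda>t. F (t + 2 * pi)) has_real_derivative F' (t + 2 * pi)) (at t)"
    using F'(1)[of "t + 2 * pi"] by (simp add: DERIV_shift)
  moreover have "((\<lambda>t. F t + 2 * pi) has_real_derivative F' t) (at t)"
    by (auto intro!: derivative_eq_intros F'(1))
  moreover have "(\<lambda>t. F (t + 2 * pi)) = (\<lambda>t. F t + 2 * pi)" using F by (auto simp: deg1_def)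
  ultimately show "F' (t + 2 * pi) = F' t" using DERIV_unique by metis
qed

lemma mean_value:
  fixes F :: "real \<Rightarrow> real"
  assumes "\<And>t. (F has_real_derivative F' t) (at t)" "s \<le> t"
  obtains z where "s \<le> z" "z \<le> t" "F t - F s = F' z * (t - s)"
proof (cases "s = t")
  case True
  then show ?thesis using that[of s] by simp
next
  case False
  then have "s < t" using assms by simp
  then obtain z where "z > s" "z < t" "F t - F s = (t - s) * F' z" using MVT2[of s t F F'] assms(1) by blast
  then show ?thesis using that[of z] by (simp add: mult.commute)
qed

text \<open>As F fixes both endpoints, its derivative equals 1 at some point between them. Uniform
  continuity keeps it within e of 1 on the whole interval once the interval is short.\<close>

lemma near_translation_on_small_intervals:
  fixes a b :: "nat \<Rightarrow> real"
  assumes F: "C1_lift F" and ab: "\<And>n. a n < b n" "(\<lambda>n. b n - a n) \<longlonglongrightarrow> 0"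
    and fixd: "\<And>n. F (a n) = a n" "\<And>n. F (b n) = b n" and e: "e > 0"
  shows "\<forall>\<^sub>F n in sequentially. \<forall>s t. a n \<le> s \<and> s \<le> t \<and> t \<le> b n \<longrightarrow>
    (1 - e) * (t - s) \<le> F t - F s \<and> F t - F s \<le> (1 + e) * (t - s)"
proof -
  obtain F' where F': "\<And>t. (F has_real_derivative F' t) (at t)" "continuous_on UNIV F'" "deg1 F"
    using F by (auto simp: C1_lift_def)
  obtain d where d: "d > 0" "\<And>s t. \<bar>t - s\<bar> < d \<Longrightarrow> \<bar>F' t - F' s\<bar> < e"
    using deg1_derivative_uniformly_continuous[OF F'(3,1,2)] e
    unfolding uniformly_continuous_on_def dist_real_def by (metis UNIV_I)
  have "\<forall>\<^sub>F n in sequentially. b n - a n < d" using order_tendstoD(2)[OF ab(2) d(1)] .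
  then show ?thesis
  proof eventually_elim
    case (elim n)
    obtain z where z: "a n \<le> z" "z \<le> b n" "F (b n) - F (a n) = F' z * (b n - a n)"
      using mean_value[OF F'(1), of "a n" "b n"] ab(1)[of n] by (auto simp: less_imp_le)
    then have z1: "F' z = 1" using fixd[of n] ab(1)[of n] by simp
    show ?case
    proof (intro allI impI)
      fix s t assume st: "a n \<le> s \<and> s \<le> t \<and> t \<le> b n"
      obtain y where y: "s \<le> y" "y \<le> t" "F t - F s = F' y * (t - s)"
        using mean_value[OF F'(1), of s t] st by blast
      have "\<bar>F' y - F' z\<bar> < e" using y z st elim by (intro d(2)) auto
      then have "1 - e \<le> F' y" "F' y \<le> 1 + e" using z1 by auto
      then show "(1 - e) * (t - s) \<le> F t - F s \<and> F t - F s \<le> (1 + e) * (t - s)"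
        unfolding y(3) using st by (auto intro: mult_right_mono)
    qed
  qed
qed

text \<open>By the mean value theorem the relative length changes by a quotient of two derivatives
  at nearby points. The derivative has a positive lower bound m, so a variation below e m makes this
  quotient at least 1 - e.\<close>

lemma distortion_on_small_intervals:
  fixes a b :: "nat \<Rightarrow> real"
  assumes F: "C1_lift F" and ab: "\<And>n. a n < b n" "(\<lambda>n. b n - a n) \<longlonglongrightarrow> 0" and e: "e > 0"
  shows "\<forall>\<^sub>F n in sequentially. \<forall>s t. a n \<le> s \<and> s \<le> t \<and> t \<le> b n \<longrightarrow>
    (1 - e) * ((t - s) / (b n - a n)) \<le> (F t - F s) / (F (b n) - F (a n))"
proof -
  obtain F' where F': "\<And>t. (F has_real_derivative F' t) (at t)" "continuous_on UNIV F'" "deg1 F" "\<And>t. F' t > 0"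
    using F by (auto simp: C1_lift_def)
  note uc = deg1_derivative_uniformly_continuous[OF F'(3,1,2)]
  obtain m where m: "m > 0" "\<And>t. F' t \<ge> m"
  proof -
    have "\<exists>x\<in>{0..2*pi}. \<forall>y\<in>{0..2*pi}. F' x \<le> F' y"
      by (rule continuous_attains_inf) (auto intro: continuous_on_subset[OF F'(2)])
    then obtain x where x: "\<And>y. y \<in> {0..2*pi} \<Longrightarrow> F' x \<le> F' y" by blast
    have per: "F' (s + 2 * pi * of_int k) = F' s" for s k
    proof -
      have "((\<lambda>t. F (t + 2 * pi * of_int k)) has_real_derivative F' (s + 2 * pi * of_int k)) (at s)"
        using F'(1)[of "s + 2 * pi * of_int k"] by (simp add: DERIV_shift)
      moreover have "((\<lambda>t. F t + 2 * pi * of_int k) has_real_derivative F' s) (at s)"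
        by (auto intro!: derivative_eq_intros F'(1))
      ultimately show ?thesis unfolding deg1_int[OF F'(3)] using DERIV_unique by metis
    qed
    have "F' t \<ge> F' x" for t
    proof -
      obtain s k where s: "0 \<le> s" "s < 2 * pi" "t = s + 2 * pi * of_int k" using period_reduce .
      then show ?thesis using x[of s] per[of s k] by simp
    qed
    then show thesis using F'(4) that by blast
  qed
  obtain d where d: "d > 0" "\<And>s t. \<bar>t - s\<bar> < d \<Longrightarrow> \<bar>F' t - F' s\<bar> < e * m"
    using uc mult_pos_pos[OF e m(1)]
    unfolding uniformly_continuous_on_def dist_real_def by (metis UNIV_I)
  have "\<forall>\<^sub>F n in sequentially. b n - a n < d" using order_tendstoD(2)[OF ab(2) d(1)] .
  then show ?thesis
  proof eventually_elim
    case (elim n)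
    obtain z where z: "a n \<le> z" "z \<le> b n" "F (b n) - F (a n) = F' z * (b n - a n)"
      using mean_value[OF F'(1), of "a n" "b n"] ab(1)[of n] by (auto simp: less_imp_le)
    show ?case
    proof (intro allI impI)
      fix s t assume st: "a n \<le> s \<and> s \<le> t \<and> t \<le> b n"
      obtain y where y: "s \<le> y" "y \<le> t" "F t - F s = F' y * (t - s)"
        using mean_value[OF F'(1), of s t] st by blast
      have "\<bar>F' y - F' z\<bar> < e * m" using y z st elim by (intro d(2)) auto
      moreover have "e * m \<le> e * F' z" using e m(2)[of z] by simp
      ultimately have "(1 - e) * F' z \<le> F' y" by (simp add: algebra_simps)
      then have "(1 - e) \<le> F' y / F' z" using F'(4)[of z] by (simp add: pos_le_divide_eq)
      then have "(1 - e) * ((t - s) / (b n - a n)) \<le> F' y / F' z * ((t - s) / (b n - a n))"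
        using st ab(1)[of n] by (intro mult_right_mono) auto
      also have "\<dots> = (F t - F s) / (F (b n) - F (a n))" unfolding y(3) z(3) by simp
      finally show "(1 - e) * ((t - s) / (b n - a n)) \<le> (F t - F s) / (F (b n) - F (a n))" .
    qed
  qed
qed

text \<open>The circle has finite length. The left endpoints of arcs of length at least e, reduced
  to [0, 2 pi), are at least e apart, so their integer parts after division by e are distinct
  numbers in a finite range.\<close>

lemma disjoint_arcs_shrink:
  fixes a b :: "nat \<Rightarrow> real"
  assumes ab: "\<And>n. a n < b n"
    and disj: "\<And>m n k. m \<noteq> n \<Longrightarrow> b m + 2 * pi * of_int k \<le> a n \<or> b n \<le> a m + 2 * pi * of_int k"
  shows "(\<lambda>n. b n - a n) \<longlonglongrightarrow> 0"
proof (rule LIMSEQ_I)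
  fix e :: real assume e: "e > 0"
  define N where "N = {n. b n - a n \<ge> e}"
  have "\<exists>s k. 0 \<le> s \<and> s < 2 * pi \<and> a n = s + 2 * pi * of_int k" for n
    by (rule period_reduce[of "a n"]) blast
  then obtain s k where s: "\<And>n. 0 \<le> s n" "\<And>n. s n < 2 * pi" "\<And>n. a n = s n + 2 * pi * of_int (k n)"
    by metis
  have sep: "\<bar>s n - s m\<bar> \<ge> e" if "n \<in> N" "m \<in> N" "m \<noteq> n" for m n
  proof -
    have "b n - a n \<ge> e" "b m - a m \<ge> e" using that by (auto simp: N_def)
    moreover have "a m + 2 * pi * of_int (k n - k m) = s m + 2 * pi * of_int (k n)"
      by (simp add: s(3)[of m] algebra_simps)
    ultimately show ?thesis using disj[OF that(3), of "k n - k m"] s(3)[of n] by linarith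
  qed
  have "inj_on (\<lambda>n. \<lfloor>s n / e\<rfloor>) N"
  proof (rule inj_onI, rule ccontr)
    fix m n assume mn: "m \<in> N" "n \<in> N" "\<lfloor>s m / e\<rfloor> = \<lfloor>s n / e\<rfloor>" "m \<noteq> n"
    then have "\<bar>s n / e - s m / e\<bar> < 1" by linarith
    then have "\<bar>s n - s m\<bar> < e" using e by (simp add: diff_divide_distrib[symmetric] abs_divide)
    then show False using sep[of n m] mn by simp
  qed
  moreover have "(\<lambda>n. \<lfloor>s n / e\<rfloor>) ` N \<subseteq> {0..\<lfloor>2 * pi / e\<rfloor>}"
  proof clarify
    fix n
    have "0 \<le> s n / e" "s n / e \<le> 2 * pi / e"
      using s(1,2)[of n] e by (auto intro!: divide_right_mono)
    then show "\<lfloor>s n / e\<rfloor> \<in> {0..\<lfloor>2 * pi / e\<rfloor>}" using floor_mono by auto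
  qed
  ultimately have "finite N" using finite_subset finite_imageD by blast
  from finite_nat_set_iff_bounded[THEN iffD1, OF this]
  obtain n0 where n0: "\<And>n. n \<in> N \<Longrightarrow> n < n0" by blast
  show "\<exists>n0. \<forall>n\<ge>n0. norm (b n - a n - 0) < e"
  proof (intro exI[of _ n0] allI impI)
    fix n assume "n \<ge> n0"
    then have "n \<notin> N" using n0 by force
    then show "norm (b n - a n - 0) < e" using ab[of n] by (auto simp: N_def)
  qed
qed

subsection \<open>Lifted actions\<close>

text \<open>At most one lift of a circle map has a fixed point: the translates of p trap every t, so
  its displacement is less than a period. This makes the normalised lifts \<open>C h\<close> below
  well defined.\<close>

lemma deg1_fixed_unique:
  assumes F: "deg1 F" and p: "F p = p" and t: "F t + 2 * pi * of_int k = t"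
  shows "k = 0"
proof -
  obtain s j where s: "0 \<le> s" "s < 2 * pi" "t - p = s + 2 * pi * of_int j" using period_reduce .
  have f: "F (p + 2 * pi * of_int i) = p + 2 * pi * of_int i" for i using deg1_int[OF F] p by simp
  have "p + 2 * pi * of_int j \<le> t" "t < p + 2 * pi * of_int (j + 1)" using s by (auto simp: algebra_simps)
  then have "p + 2 * pi * of_int j \<le> F t" "F t < p + 2 * pi * of_int (j + 1)"
    using f deg1_le_iff[OF F] deg1_less_iff[OF F] by metis+
  then have "\<bar>F t - t\<bar> < 2 * pi"
    using \<open>p + 2 * pi * of_int j \<le> t\<close> \<open>t < p + 2 * pi * of_int (j + 1)\<close> by (simp add: algebra_simps)
  then have "\<bar>2 * pi * real_of_int k\<bar> < 2 * pi * 1" using t by linarith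
  then have "2 * pi * \<bar>real_of_int k\<bar> < 2 * pi * 1" by (simp add: abs_mult)
  then have "\<bar>real_of_int k\<bar> < 1" by (subst (asm) mult_less_cancel_left_pos) auto
  then show ?thesis by linarith
qed

text \<open>If two commuting increasing maps satisfy P t < Q t, the strict inequality persists for
  all positive powers at t.\<close>

lemma commuting_powers_eq:
  assumes F: "deg1 F" and G: "deg1 G" and comm: "\<And>t. F (G t) = G (F t)"
    and eq: "(F ^^ n) t = (G ^^ n) t" and n: "n > 0"
  shows "F t = G t"
proof -
  have lt: "(P ^^ Suc m) t < (Q ^^ Suc m) t"
    if P: "deg1 P" and Q: "deg1 Q" and PQ: "\<And>t. P (Q t) = Q (P t)" and l: "P t < Q t" for P Q m
  proof (induction m)
    case (Suc m)
    have c: "(P ^^ i) (Q s) = Q ((P ^^ i) s)" for i s by (induction i) (auto simp: PQ)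
    have "(P ^^ Suc (Suc m)) t = (P ^^ Suc m) (P t)" by (simp add: funpow_swap1)
    also have "\<dots> < (P ^^ Suc m) (Q t)" using deg1_less_iff[OF deg1_funpow[OF P]] l by blast
    also have "\<dots> = Q ((P ^^ Suc m) t)" by (rule c)
    also have "\<dots> < Q ((Q ^^ Suc m) t)" using Suc deg1_less_iff[OF Q] by blast
    finally show ?case by simp
  qed (use l in simp)
  obtain m where m: "n = Suc m" using n gr0_implies_Suc by blast
  show ?thesis
    using lt[of F G m] lt[of G F m] F G comm eq unfolding m by (metis less_irrefl linorder_neqE_linordered_idom)
qed

lemma deg1_cis_cong:
  assumes F: "deg1 F" and st: "cis s = cis t" shows "cis (F s) = cis (F t)"
proof -
  obtain k :: int where "s = t + 2 * pi * of_int k" using st unfolding cis_eq_iff by blast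
  then have "F s = F t + 2 * pi * of_int k" using deg1_int[OF F] by simp
  then show ?thesis unfolding cis_eq_iff by blast
qed

lemma deg1_cis_inj:
  assumes F: "deg1 F" and st: "cis (F s) = cis (F t)" shows "cis s = cis t"
proof -
  obtain k :: int where "F s = F t + 2 * pi * of_int k" using st unfolding cis_eq_iff by blast
  then have "F s = F (t + 2 * pi * of_int k)" using deg1_int[OF F] by simp
  then have "s = t + 2 * pi * of_int k" using deg1_eq_iff[OF F] by simp
  then show ?thesis unfolding cis_eq_iff by blast
qed

lemma lift_shift:
  assumes F: "deg1 F" and G: "deg1 G" and eq: "\<And>t. cis (F t) = cis (G t)"
  shows "\<exists>k::int. \<forall>t. F t = G t + 2 * pi * of_int k"
proof -
  have "continuous_on UNIV F" "continuous_on UNIV G" using F G by (auto simp: deg1_def)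
  from lifts_differ_by_period[OF this eq] show ?thesis by blast
qed

text \<open>\<open>S\<close> is H, \<alpha> is A, and \<open>B\<close> lifts the generator. Each
  \<open>L h\<close> is an arbitrary lift, so the relations of the group hold only after applying
  \<open>cis\<close>. Integer multiples are written as products with \<open>of_int\<close>, and
  \<open>P\<close> annihilates \<alpha> on \<open>S\<close>.\<close>

locale lifted_action =
  fixes S :: "'h :: comm_ring_1 set" and \<alpha> :: "'h \<Rightarrow> 'h" and L :: "'h \<Rightarrow> real \<Rightarrow> real"
    and B :: "real \<Rightarrow> real" and P :: "int poly"
  assumes S: "0 \<in> S" "\<And>x y. x \<in> S \<Longrightarrow> y \<in> S \<Longrightarrow> x + y \<in> S" "\<And>x. x \<in> S \<Longrightarrow> - x \<in> S"
    and \<alpha>: "\<alpha> ` S = S"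
    and L: "\<And>h. h \<in> S \<Longrightarrow> C1_lift (L h)" and B: "C1_lift B"
    and L_add: "\<And>h k t. h \<in> S \<Longrightarrow> k \<in> S \<Longrightarrow> cis (L (h + k) t) = cis (L h (L k t))"
    and L_conj: "\<And>h t. h \<in> S \<Longrightarrow> cis (B (L h t)) = cis (L (\<alpha> h) (B t))"
    and P: "Polynomial.degree P \<ge> 1" "poly.coeff P 0 \<noteq> 0"
      "\<And>z :: complex. poly (map_poly of_int P) z = 0 \<Longrightarrow> cmod z \<noteq> 1"
    and rec: "\<And>h. h \<in> S \<Longrightarrow> (\<Sum>j\<le>Polynomial.degree P. of_int (poly.coeff P j) * (\<alpha> ^^ j) h) = 0"
begin

lemma \<alpha>_S: "h \<in> S \<Longrightarrow> \<alpha> h \<in> S" using \<alpha> by blast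

lemma L_deg1: "h \<in> S \<Longrightarrow> deg1 (L h)" and B_deg1: "deg1 B"
  using L B by (auto simp: C1_lift_def)

lemma L_zero: "cis (L 0 t) = cis t"
proof -
  have "cis (L 0 t) = cis (L 0 (L 0 t))" using L_add[of 0 0 t] S by simp
  then show ?thesis using deg1_cis_inj[OF L_deg1[OF S(1)]] by metis
qed

lemma L_commute:
  assumes h: "h \<in> S" "k \<in> S" shows "L h (L k t) = L k (L h t)"
proof -
  have "cis (L h (L k t)) = cis (L k (L h t))" for t
    using L_add[OF h] L_add[OF h(2,1)] by (metis add.commute)
  then obtain n :: int where n: "\<And>t. L h (L k t) = L k (L h t) + 2 * pi * of_int n"
    using lift_shift[OF deg1_compose[OF L_deg1[OF h(1)] L_deg1[OF h(2)]] deg1_compose[OF L_deg1[OF h(2)] L_deg1[OF h(1)]]] by blast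
  then have "n = 0" by (rule lifts_commute[OF L_deg1[OF h(1)] L_deg1[OF h(2)]])
  then show ?thesis using n by simp
qed

definition H0 where "H0 = {h \<in> S. \<exists>t. cis (L h t) = cis t}"

text \<open>For h in \<open>H0\<close> this is the lift with a fixed point on the line. Outside
  \<open>H0\<close> the chosen integer is arbitrary, but the result is still a lift.\<close>

definition C where "C h t = L h t + 2 * pi * of_int (SOME m. \<exists>s. L h s + 2 * pi * of_int m = s)"

lemma H0_S: "h \<in> H0 \<Longrightarrow> h \<in> S" by (simp add: H0_def)

lemma C_fixed:
  assumes "h \<in> H0" obtains p where "C h p = p"
proof -
  obtain t where t: "cis (L h t) = cis t" using assms by (auto simp: H0_def)
  obtain m :: int where "t = L h t + 2 * pi * of_int m" using t[symmetric] unfolding cis_eq_iff by blast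
  then have "L h t + 2 * pi * of_int m = t" by simp
  then have "\<exists>m::int. \<exists>s. L h s + 2 * pi * of_int m = s" by blast
  from someI_ex[OF this] show thesis using that unfolding C_def by blast
qed

lemma C_lift: assumes "h \<in> S" shows "C1_lift (C h)"
proof -
  have "C h = (\<lambda>t. L h t + 2 * pi * of_int (SOME m. \<exists>s. L h s + 2 * pi * of_int m = s))"
    by (rule ext) (rule C_def)
  then show ?thesis using C1_lift_add_int[OF L[OF assms]] by simp
qed

lemma C_deg1: "h \<in> S \<Longrightarrow> deg1 (C h)" using C_lift by (simp add: C1_lift_def)

lemma cis_C: "cis (C h t) = cis (L h t)" unfolding cis_eq_iff C_def by blast

lemma C_unique:
  assumes h: "h \<in> H0" and F: "deg1 F" "\<And>t. cis (F t) = cis (L h t)" and p: "F p = p"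
  shows "C h t = F t"
proof -
  obtain k :: int where k: "\<And>t. C h t = F t + 2 * pi * of_int k"
    using lift_shift[OF C_deg1[OF H0_S[OF h]] F(1)] F(2) by (auto simp: cis_C)
  obtain s where "C h s = s" using C_fixed[OF h] .
  then have "k = 0" using deg1_fixed_unique[OF F(1) p, of s k] k by simp
  then show ?thesis using k by simp
qed

lemma C_L_commute: assumes h: "h \<in> S" "k \<in> S" shows "C h (L k t) = L k (C h t)"
  unfolding C_def using deg1_int[OF L_deg1[OF h(2)]] L_commute[OF h] by simp

lemma C_commute: assumes h: "h \<in> S" "k \<in> S" shows "C h (C k t) = C k (C h t)"
  using C_L_commute[OF h] deg1_int[OF C_deg1[OF h(1)]] unfolding C_def[of k] by simp

text \<open>Lifts commute, so the set of common fixed points of the earlier maps is invariant under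
  the next one. It is closed, and the next map has a fixed point on the line, hence also one in this
  set.\<close>

lemma common_fixed_point:
  assumes "finite J" "J \<subseteq> H0" shows "\<exists>t. \<forall>h\<in>J. C h t = t"
  using assms
proof (induction J rule: finite_induct)
  case (insert k J)
  define K where "K = {t. \<forall>h\<in>J. C h t = t}"
  have K: "K = (\<Inter>h\<in>J. {t. C h t = t})" by (auto simp: K_def)
  have "closed {t. C h t = t}" if "h \<in> J" for h
    using C_deg1[OF H0_S] that insert by (intro closed_Collect_eq) (auto simp: deg1_def)
  then have cl: "closed K" unfolding K by blast
  obtain x where x: "x \<in> K" using insert by (auto simp: K_def)
  obtain p where p: "C k p = p" using C_fixed insert by blast
  have "\<exists>t\<in>K. C k t = t"
  proof (rule deg1_fixed_point_in_closed[where G = "C k" and K = K, OF _ p cl x])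
    show "deg1 (C k)" using C_deg1 H0_S insert by blast
    show "C k t \<in> K" if "t \<in> K" for t
      unfolding K_def
    proof (intro CollectI ballI)
      fix h assume h: "h \<in> J"
      then have "C h (C k t) = C k (C h t)" using C_commute H0_S insert by blast
      then show "C h (C k t) = C k t" using that h by (simp add: K_def)
    qed
  qed
  then show ?case by (auto simp: K_def)
qed simp

lemma H0_zero: "0 \<in> H0" using S L_zero by (auto simp: H0_def)

lemma C_zero: "C 0 t = t"
  by (rule C_unique[OF H0_zero, of "\<lambda>t. t" 0]) (auto simp: L_zero)

text \<open>A common fixed point of both maps is fixed by the composite, which is therefore the
  normalised lift of the sum. On \<open>H0\<close> the action thus lifts to a genuine action on the
  line.\<close>

lemma
  assumes h: "h \<in> H0" "k \<in> H0"
  shows H0_add: "h + k \<in> H0" and C_add: "C (h + k) t = C h (C k t)"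
proof -
  have hk: "h \<in> S" "k \<in> S" using h H0_S by auto
  obtain p where p: "C h p = p" "C k p = p" using common_fixed_point[of "{h, k}"] h by auto
  have eq: "cis (C h (C k s)) = cis (L (h + k) s)" for s
    using L_add[OF hk] deg1_cis_cong[OF L_deg1[OF hk(1)] cis_C] by (simp add: cis_C)
  have "cis (L (h + k) p) = cis p" using eq[of p] p by simp
  then show *: "h + k \<in> H0" using S hk by (auto simp: H0_def)
  show "C (h + k) t = C h (C k t)"
    by (rule C_unique[where F = "\<lambda>t. C h (C k t)" and p = p, OF * deg1_compose[OF C_deg1[OF hk(1)] C_deg1[OF hk(2)]] eq]) (use p in simp)
qed

lemma H0_neg: assumes h: "h \<in> H0" shows "- h \<in> H0"
proof -
  have hS: "h \<in> S" using h H0_S by auto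
  obtain p where p: "cis (L h p) = cis p" using h by (auto simp: H0_def)
  have "cis (L (- h) p) = cis (L (- h) (L h p))" using deg1_cis_cong[OF L_deg1[OF S(3)[OF hS]] p] by simp
  also have "\<dots> = cis (L (- h + h) p)" using L_add[OF S(3)[OF hS] hS] by simp
  also have "\<dots> = cis p" by (simp add: L_zero)
  finally show ?thesis using S hS by (auto simp: H0_def)
qed

lemma H0_\<alpha>: assumes h: "h \<in> S" shows "\<alpha> h \<in> H0 \<longleftrightarrow> h \<in> H0"
proof -
  have "(\<exists>t. cis (L (\<alpha> h) t) = cis t) \<longleftrightarrow> (\<exists>t. cis (L h t) = cis t)"
  proof
    assume "\<exists>t. cis (L (\<alpha> h) t) = cis t"
    then obtain t where t: "cis (L (\<alpha> h) t) = cis t" by blast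
    obtain s where s: "B s = t" using deg1_surj[OF B_deg1] by blast
    have "cis (B (L h s)) = cis (B s)" using L_conj[OF h, of s] s t by simp
    then show "\<exists>t. cis (L h t) = cis t" using deg1_cis_inj[OF B_deg1] by blast
  next
    assume "\<exists>t. cis (L h t) = cis t"
    then obtain t where "cis (L h t) = cis t" by blast
    then have "cis (L (\<alpha> h) (B t)) = cis (B t)" using L_conj[OF h, of t] deg1_cis_cong[OF B_deg1, of "L h t" t] by simp
    then show "\<exists>t. cis (L (\<alpha> h) t) = cis t" by blast
  qed
  then show ?thesis using h \<alpha>_S by (auto simp: H0_def)
qed

text \<open>Conjugating by B gives a lift of \<alpha> h that fixes the image of a fixed point, so
  uniqueness of the normalised lift applies.\<close>

lemma C_conj: assumes h: "h \<in> H0" shows "B (C h t) = C (\<alpha> h) (B t)"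
proof -
  have hS: "h \<in> S" and \<alpha>h: "\<alpha> h \<in> H0" using h H0_S H0_\<alpha> by auto
  note iB = deg1_inv[OF B_deg1]
  define F where "F s = B (C h (inv_into UNIV B s))" for s
  obtain p where p: "C h p = p" using C_fixed[OF h] .
  have "C (\<alpha> h) (B t) = F (B t)"
  proof (rule C_unique[OF \<alpha>h, of F "B p"])
    show "deg1 F" unfolding F_def by (rule deg1_compose[OF B_deg1 deg1_compose[OF C_deg1[OF hS] iB(1)]])
    show "cis (F s) = cis (L (\<alpha> h) s)" for s
      unfolding F_def using L_conj[OF hS, of "inv_into UNIV B s"] iB deg1_cis_cong[OF B_deg1 cis_C] by simp
    show "F (B p) = B p" by (simp add: F_def iB p)
  qed
  then show ?thesis by (simp add: F_def iB)
qed

lemma \<alpha>_minus_id: assumes h: "h \<in> S" shows "\<alpha> h - h \<in> H0"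
proof -
  let ?d = "\<alpha> h - h"
  have d: "?d \<in> S" using S(2)[OF \<alpha>_S[OF h] S(3)[OF h]] by simp
  have "cis (B (L h t)) = cis (L ?d (L h (B t)))" for t
    using L_conj[OF h] L_add[OF d h] by simp
  then obtain k :: int where k: "\<And>t. B (L h t) = L ?d (L h (B t)) + 2 * pi * of_int k"
    using lift_shift[OF deg1_compose[OF B_deg1 L_deg1[OF h]] deg1_compose[OF L_deg1[OF d] deg1_compose[OF L_deg1[OF h] B_deg1]]] by blast
  \<comment> \<open>Here Q is the lift of \<alpha> h - h shifted by k periods, so that B F = Q F B
    holds exactly on the line, with F the lift of h.\<close>
  have "\<exists>t. L ?d t + 2 * pi * of_int k = t"
    by (rule commutator_fixed_point[OF deg1_add_int[OF L_deg1[OF d]] L_deg1[OF h] B_deg1])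
      (use k L_commute[OF d h] deg1_int[OF L_deg1[OF h]] in auto)
  then obtain t where "L ?d t + 2 * pi * of_int k = t" by blast
  then have "t = L ?d t + 2 * pi * of_int k" by simp
  then have "cis t = cis (L ?d t)" unfolding cis_eq_iff by blast
  then show ?thesis using d unfolding H0_def by (intro CollectI conjI exI[of _ t]) simp_all
qed

lemma H0_sum: "(\<And>j. j \<in> J \<Longrightarrow> f j \<in> H0) \<Longrightarrow> (\<Sum>j\<in>J. f j) \<in> H0" for f :: "nat \<Rightarrow> 'h"
  by (induction J rule: infinite_finite_induct) (auto simp: H0_zero H0_add)

lemma H0_of_nat: "h \<in> H0 \<Longrightarrow> of_nat n * h \<in> H0"
  by (induction n) (auto simp: H0_zero H0_add distrib_right)

lemma H0_of_int: assumes h: "h \<in> H0" shows "of_int i * h \<in> H0"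
proof (cases i rule: int_cases2)
  case (nonneg n)
  then show ?thesis using H0_of_nat[OF h] by simp
next
  case (nonpos n)
  then show ?thesis using H0_neg[OF H0_of_nat[OF h, of n]] by simp
qed

section \<open>The common fixed point set and finite orbits\<close>

text \<open>Modulo \<open>H0\<close> every power of \<alpha> fixes h, so the relation given by P
  becomes P(1) h = 0. As 1 is not a root of P, a multiple of P(1) by a sign serves as n.\<close>

lemma torsion_mod_H0: obtains n :: nat where "n > 0" "\<And>h. h \<in> S \<Longrightarrow> of_nat n * h \<in> H0"
proof -
  define N where "N = (\<Sum>j\<le>Polynomial.degree P. poly.coeff P j)"
  have "(of_int N :: complex) = poly (map_poly of_int P) 1"
    unfolding N_def poly_altdef by (simp add: coeff_map_poly)
  then have N0: "N \<noteq> 0" using P(3)[of 1] by auto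
  have NH: "of_int N * h \<in> H0" if h: "h \<in> S" for h
  proof -
    have S': "(\<alpha> ^^ j) h \<in> S" for j by (induction j) (auto simp: h \<alpha>_S)
    have d: "(\<alpha> ^^ j) h - h \<in> H0" for j
    proof (induction j)
      case (Suc j)
      from H0_add[OF \<alpha>_minus_id[OF S'[of j]] Suc] show ?case by simp
    qed (simp add: H0_zero)
    have "of_int N * h = - (\<Sum>j\<le>Polynomial.degree P. of_int (poly.coeff P j) * ((\<alpha> ^^ j) h - h))"
      by (simp add: N_def right_diff_distrib sum_subtractf rec[OF h] sum_distrib_right)
    moreover have "\<dots> \<in> H0" by (intro H0_neg H0_sum H0_of_int d)
    ultimately show ?thesis by simp
  qed
  show thesis
  proof (cases N rule: int_cases2)
    case (nonneg n)
    then show ?thesis using that[of n] N0 NH by simp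
  next
    case (nonpos n)
    then show ?thesis using that[of n] N0 H0_neg[OF NH] by simp
  qed
qed

definition K where "K = {t. \<forall>h\<in>H0. C h t = t}"

lemma K_closed: "closed K"
proof -
  have K: "K = (\<Inter>h\<in>H0. {t. C h t = t})" by (auto simp: K_def)
  have "closed {t. C h t = t}" if "h \<in> H0" for h
    using C_deg1[OF H0_S] that by (intro closed_Collect_eq) (auto simp: deg1_def)
  then show ?thesis unfolding K by blast
qed

lemma K_shift: "t + 2 * pi * of_int k \<in> K \<longleftrightarrow> t \<in> K"
  using deg1_int[OF C_deg1[OF H0_S]] by (auto simp: K_def)

text \<open>Finite intersections are covered by \<open>common_fixed_point\<close>. Translating by
  periods brings the points into a compact interval, where the finite intersection property
  applies.\<close>

lemma K_nonempty: "K \<noteq> {}"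
proof -
  have "{0..2*pi} \<inter> (\<Inter>h\<in>H0. {t. C h t = t}) \<noteq> {}"
  proof (rule compact_imp_fip_image)
    show "closed {t. C h t = t}" if "h \<in> H0" for h
      using C_deg1[OF H0_S] that by (intro closed_Collect_eq) (auto simp: deg1_def)
    fix J assume J: "finite J" "J \<subseteq> H0"
    obtain t where t: "\<And>h. h \<in> J \<Longrightarrow> C h t = t" using common_fixed_point[OF J] by blast
    obtain s k where s: "0 \<le> s" "s < 2 * pi" "t = s + 2 * pi * of_int k" using period_reduce .
    have "C h s = s" if "h \<in> J" for h
      using t[OF that] deg1_int[OF C_deg1[OF H0_S], of h s k] J that s by auto
    then have "s \<in> {0..2*pi} \<inter> (\<Inter>h\<in>J. {t. C h t = t})" using s by simp
    then show "{0..2*pi} \<inter> (\<Inter>h\<in>J. {t. C h t = t}) \<noteq> {}" by blast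
  qed auto
  then show ?thesis by (auto simp: K_def)
qed

lemma K_B: "B t \<in> K \<longleftrightarrow> t \<in> K"
proof
  assume t: "t \<in> K"
  show "B t \<in> K" unfolding K_def
  proof (intro CollectI ballI)
    fix h assume h: "h \<in> H0"
    then obtain g where g: "g \<in> S" "h = \<alpha> g" using \<alpha> H0_S by blast
    then have "g \<in> H0" using h H0_\<alpha> by blast
    then show "C h (B t) = B t" using C_conj[of g t] t g by (simp add: K_def)
  qed
next
  assume t: "B t \<in> K"
  have "C h t = t" if h: "h \<in> H0" for h
    using C_conj[OF h, of t] t H0_\<alpha> H0_S h deg1_eq_iff[OF B_deg1] by (simp add: K_def)
  then show "t \<in> K" by (simp add: K_def)
qed

text \<open>Since n h lies in \<open>H0\<close>, the n-th power of \<open>L h\<close> moves t by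
  some number j of periods, and j mod n determines the image of t on the circle. So there are at
  most n images.\<close>

lemma K_finite_orbit:
  assumes t: "t \<in> K" shows "finite ((\<lambda>h. cis (L h t)) ` S)"
proof -
  obtain n :: nat where n: "n > 0" "\<And>h. h \<in> S \<Longrightarrow> of_nat n * h \<in> H0" using torsion_mod_H0 by blast
  have "\<exists>j::int. (L h ^^ n) t = t + 2 * pi * of_int j" if h: "h \<in> S" for h
  proof -
    have "of_nat m * h \<in> S \<and> cis ((L h ^^ m) t) = cis (L (of_nat m * h) t)" for m
    proof (induction m)
      case (Suc m)
      then have "cis ((L h ^^ Suc m) t) = cis (L h (L (of_nat m * h) t))"
        using deg1_cis_cong[OF L_deg1[OF h] conjunct2[OF Suc]] by simp
      then show ?case using Suc L_add[OF h, of "of_nat m * h"] S h by (simp add: distrib_right)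
    qed (simp add: S L_zero)
    then have "cis ((L h ^^ n) t) = cis (C (of_nat n * h) t)" by (simp add: cis_C)
    also have "\<dots> = cis t" using t n(2)[OF h] by (simp add: K_def)
    finally show ?thesis by (simp only: cis_eq_iff)
  qed
  then obtain j :: "'h \<Rightarrow> int" where j: "\<And>h. h \<in> S \<Longrightarrow> (L h ^^ n) t = t + 2 * pi * of_int (j h)" by metis
  have eq: "cis (L h t) = cis (L k t)" if hk: "h \<in> S" "k \<in> S" and m: "j h mod int n = j k mod int n" for h k
  proof -
    obtain q where q: "j h = j k + int n * q" using m by (metis mod_eqE)
    \<comment> \<open>Shifting \<open>L k\<close> by q periods equalises the n-th powers at t; as
      the two maps commute, they already agree at t.\<close>
    define G where "G s = L k s + 2 * pi * of_int q" for s
    have G: "deg1 G" unfolding G_def by (intro deg1_add_int L_deg1 hk)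
    have "(G ^^ m) t = (L k ^^ m) t + 2 * pi * of_int (int m * q)" for m
    proof (induction m)
      case (Suc m)
      then show ?case using deg1_int[OF L_deg1[OF hk(2)], of "(L k ^^ m) t" "int m * q"]
        by (simp add: G_def algebra_simps)
    qed simp
    then have "(L h ^^ n) t = (G ^^ n) t" using j[OF hk(1)] j[OF hk(2)] q by (simp add: algebra_simps)
    then have "L h t = G t"
      using deg1_int[OF L_deg1[OF hk(1)]] L_commute[OF hk]
      by (intro commuting_powers_eq[OF L_deg1[OF hk(1)] G _ _ n(1)]) (auto simp: G_def)
    then show ?thesis unfolding cis_eq_iff G_def by blast
  qed
  define g where "g r = (SOME h. h \<in> S \<and> j h mod int n = r)" for r
  have "(\<lambda>h. cis (L h t)) ` S \<subseteq> (\<lambda>r. cis (L (g r) t)) ` {0..<int n}"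
  proof clarify
    fix h assume h: "h \<in> S"
    define r where "r = j h mod int n"
    have "g r \<in> S \<and> j (g r) mod int n = r" unfolding g_def by (rule someI[of _ h]) (simp add: h r_def)
    then have "cis (L h t) = cis (L (g r) t)" using eq[OF h] by (simp add: r_def)
    moreover have "r \<in> {0..<int n}" using n(1) by (simp add: r_def)
    ultimately show "cis (L h t) \<in> (\<lambda>r. cis (L (g r) t)) ` {0..<int n}" by blast
  qed
  then show ?thesis by (rule finite_subset) simp
qed

lemma K_B_funpow: "(B ^^ n) t \<in> K \<longleftrightarrow> t \<in> K"
  by (induction n) (auto simp: K_B)

lemma periodic_point_imp_finite_invariant:
  assumes q: "q > 0" "(B ^^ q) s = s + 2 * pi * of_int r"
  shows "\<exists>Y. finite Y \<and> Y \<noteq> {} \<and> Y \<subseteq> circle \<and>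
    (\<forall>h\<in>S. \<forall>t. cis t \<in> Y \<longrightarrow> cis (L h t) \<in> Y) \<and> (\<forall>t. cis t \<in> Y \<longrightarrow> cis (B t) \<in> Y)"
proof -
  \<comment> \<open>Subtracting r periods turns the periodic point s into a fixed point, which then
    yields one in the invariant closed set K.\<close>
  define G where "G t = (B ^^ q) t + 2 * pi * of_int (- r)" for t
  obtain x where x: "x \<in> K" using K_nonempty by blast
  have "\<exists>t\<in>K. G t = t"
  proof (rule deg1_fixed_point_in_closed[where G = G and K = K and p = s, OF _ _ K_closed x])
    show "deg1 G" unfolding G_def by (intro deg1_add_int deg1_funpow B_deg1)
    show "G s = s" using q by (simp add: G_def)
    show "G t \<in> K" if "t \<in> K" for t unfolding G_def K_shift K_B_funpow by (rule that)
  qed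
  then obtain t where t: "t \<in> K" "(B ^^ q) t = t + 2 * pi * of_int r" by (auto simp: G_def)
  \<comment> \<open>The finite H-orbits of the first q points of the B-orbit. B permutes them
    cyclically, the last one being mapped back to the first.\<close>
  define Y where "Y = (\<Union>i<q. (\<lambda>h. cis (L h ((B ^^ i) t))) ` S)"
  have Y_elem: "\<exists>i<q. \<exists>k\<in>S. cis y = cis (L k ((B ^^ i) t))" if "cis y \<in> Y" for y
    using that by (auto simp: Y_def)
  have YI: "cis y \<in> Y" if "i < q" "k \<in> S" "cis y = cis (L k ((B ^^ i) t))" for y i k
    using that by (auto simp: Y_def)
  have "finite Y" unfolding Y_def using K_finite_orbit t(1) K_B_funpow by simp
  moreover have "Y \<noteq> {}" using q(1) S(1) by (auto simp: Y_def)
  moreover have "Y \<subseteq> circle" by (auto simp: Y_def)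
  moreover have "cis (L h y) \<in> Y" if h: "h \<in> S" and y: "cis y \<in> Y" for h y
  proof -
    obtain i k where ik: "i < q" "k \<in> S" "cis y = cis (L k ((B ^^ i) t))" using Y_elem[OF y] by blast
    have "cis (L h y) = cis (L (h + k) ((B ^^ i) t))"
      using deg1_cis_cong[OF L_deg1[OF h] ik(3)] L_add[OF h ik(2)] by simp
    then show ?thesis using YI[OF ik(1) S(2)[OF h ik(2)]] by simp
  qed
  moreover have "cis (B y) \<in> Y" if y: "cis y \<in> Y" for y
  proof -
    obtain i k where ik: "i < q" "k \<in> S" "cis y = cis (L k ((B ^^ i) t))" using Y_elem[OF y] by blast
    have e: "cis (B y) = cis (L (\<alpha> k) ((B ^^ Suc i) t))"
      using deg1_cis_cong[OF B_deg1 ik(3)] L_conj[OF ik(2)] by simp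
    show ?thesis
    proof (cases "Suc i < q")
      case True
      then show ?thesis using YI[OF True \<alpha>_S[OF ik(2)] e] by simp
    next
      case False
      then have "Suc i = q" using ik by simp
      then have "cis ((B ^^ Suc i) t) = cis ((B ^^ 0) t)" using t(2) by (auto simp only: cis_eq_iff funpow_0 id_def)
      from deg1_cis_cong[OF L_deg1[OF \<alpha>_S[OF ik(2)]] this] show ?thesis
        using YI[OF q(1) \<alpha>_S[OF ik(2)]] e by metis
    qed
  qed
  ultimately show ?thesis by blast
qed

end

section \<open>Gaps of the common fixed point set\<close>

context lifted_action
begin

lemma K_gap:
  assumes x: "x \<notin> K"
  obtains u v where "u \<in> K" "v \<in> K" "u < x" "x < v" "\<And>t. u < t \<Longrightarrow> t < v \<Longrightarrow> t \<notin> K"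
proof -
  obtain p where p: "p \<in> K" using K_nonempty by blast
  obtain s k where s: "0 \<le> s" "s < 2 * pi" "x - p = s + 2 * pi * of_int k" using period_reduce .
  define Lo where "Lo = K \<inter> {..x}"
  define Hi where "Hi = K \<inter> {x..}"
  \<comment> \<open>K is invariant under periods and therefore has points on both sides of x;
    closedness provides nearest ones.\<close>
  have "p + 2 * pi * of_int k \<in> Lo" using s p K_shift by (simp add: Lo_def)
  then have lo: "Sup Lo \<in> Lo"
    unfolding Lo_def by (intro closed_contains_Sup closed_Int K_closed) (auto intro: bdd_aboveI)
  have "p + 2 * pi * of_int (k + 1) \<in> K" using p K_shift by blast
  then have "p + 2 * pi * of_int (k + 1) \<in> Hi" using s by (simp add: Hi_def algebra_simps)
  then have hi: "Inf Hi \<in> Hi"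
    unfolding Hi_def by (intro closed_contains_Inf closed_Int K_closed) (auto intro: bdd_belowI)
  show thesis
  proof (rule that[of "Sup Lo" "Inf Hi"])
    show "Sup Lo \<in> K" "Inf Hi \<in> K" using lo hi by (auto simp: Lo_def Hi_def)
    then have ne: "Sup Lo \<noteq> x" "Inf Hi \<noteq> x" using x by metis+
    then show "Sup Lo < x" "x < Inf Hi" using lo hi by (auto simp: Lo_def Hi_def)
    fix t assume t: "Sup Lo < t" "t < Inf Hi"
    show "t \<notin> K"
    proof
      assume tK: "t \<in> K"
      show False
      proof (cases "t \<le> x")
        case True
        then have "t \<le> Sup Lo" using tK by (intro cSup_upper) (auto simp: Lo_def intro: bdd_aboveI)
        then show ?thesis using t by simp
      next
        case False
        then have "Inf Hi \<le> t" using tK by (intro cInf_lower) (auto simp: Hi_def intro: bdd_belowI)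
        then show ?thesis using t by simp
      qed
    qed
  qed
qed

text \<open>Images of a gap under an increasing map preserving K are again gaps, so modulo periods
  two of them are disjoint or equal. Equality would make the left endpoint periodic on the
  circle.\<close>

lemma gap_images_shrink:
  assumes \<beta>: "deg1 \<beta>" "\<And>t. \<beta> t \<in> K \<longleftrightarrow> t \<in> K"
    and np: "\<And>q y r. q > 0 \<Longrightarrow> (\<beta> ^^ q) y \<noteq> y + 2 * pi * of_int r"
    and uv: "u \<in> K" "v \<in> K" "u < v" and gap: "\<And>t. u < t \<Longrightarrow> t < v \<Longrightarrow> t \<notin> K"
  shows "(\<lambda>n. (\<beta> ^^ n) v - (\<beta> ^^ n) u) \<longlonglongrightarrow> 0"
proof (rule disjoint_arcs_shrink)
  have lt: "(\<beta> ^^ n) s < (\<beta> ^^ n) t \<longleftrightarrow> s < t" for n s t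
    by (rule deg1_less_iff[OF deg1_funpow[OF \<beta>(1)]])
  have inK: "(\<beta> ^^ n) t \<in> K \<longleftrightarrow> t \<in> K" for n t by (induction n) (auto simp: \<beta>(2))
  show "(\<beta> ^^ n) u < (\<beta> ^^ n) v" for n using uv lt by simp
  have gap_n: "\<not> ((\<beta> ^^ n) u < t \<and> t < (\<beta> ^^ n) v)" if t: "t \<in> K" for n t
  proof
    assume b: "(\<beta> ^^ n) u < t \<and> t < (\<beta> ^^ n) v"
    obtain s where s: "(\<beta> ^^ n) s = t" using deg1_surj[OF deg1_funpow[OF \<beta>(1)]] by blast
    then have "s \<in> K" using t inK by blast
    then show False using gap[of s] b s lt by blast
  qed
  have down: "(\<beta> ^^ n) u \<noteq> (\<beta> ^^ m) u + 2 * pi * of_int k" if mn: "m < n" for m n k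
  proof -
    have "(\<beta> ^^ n) u = (\<beta> ^^ (n - m)) ((\<beta> ^^ m) u)"
      using mn by (metis comp_apply funpow_add le_add_diff_inverse2 less_imp_le)
    then show ?thesis using np[of "n - m" "(\<beta> ^^ m) u" k] mn by simp
  qed
  show "(\<beta> ^^ m) v + 2 * pi * of_int k \<le> (\<beta> ^^ n) u \<or> (\<beta> ^^ n) v \<le> (\<beta> ^^ m) u + 2 * pi * of_int k"
    if mn: "m \<noteq> n" for m n k
  proof (rule ccontr)
    assume "\<not> ?thesis"
    then have o: "(\<beta> ^^ n) u < (\<beta> ^^ m) v + 2 * pi * of_int k" "(\<beta> ^^ m) u + 2 * pi * of_int k < (\<beta> ^^ n) v" by auto
    have "(\<beta> ^^ m) u + 2 * pi * of_int k \<in> K" using K_shift inK uv by blast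
    from gap_n[OF this, of n] have 1: "(\<beta> ^^ m) u + 2 * pi * of_int k \<le> (\<beta> ^^ n) u" using o by linarith
    have "(\<beta> ^^ n) u + 2 * pi * of_int (- k) \<in> K" using K_shift inK uv by blast
    from gap_n[OF this, of m] have 2: "(\<beta> ^^ n) u \<le> (\<beta> ^^ m) u + 2 * pi * of_int k" using o by simp
    from 1 2 have e: "(\<beta> ^^ n) u = (\<beta> ^^ m) u + 2 * pi * of_int k" by simp
    then have e': "(\<beta> ^^ m) u = (\<beta> ^^ n) u + 2 * pi * of_int (- k)" by simp
    show False using down[of m n k] down[of n m "- k"] e e' mn by (metis linorder_neqE_nat)
  qed
qed

text \<open>The locale gives \<alpha> as a surjection of \<open>S\<close>, so the backward half is
  built by choosing preimages; these stay in \<open>H0\<close> by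
  \<open>H0_\<alpha>\<close>.\<close>

lemma two_sided_orbit:
  assumes b: "b \<in> H0"
  obtains e :: "int \<Rightarrow> 'h" where "e 0 = b" "\<And>k. e k \<in> H0" "\<And>k. e (k + 1) = \<alpha> (e k)"
proof -
  define g where "g z = (SOME y. y \<in> S \<and> \<alpha> y = z)" for z
  have g: "g z \<in> H0 \<and> \<alpha> (g z) = z" if z: "z \<in> H0" for z
  proof -
    have "z \<in> \<alpha> ` S" using \<alpha> H0_S[OF z] by simp
    then have "\<exists>y. y \<in> S \<and> \<alpha> y = z" unfolding image_iff by metis
    from someI_ex[OF this] have "g z \<in> S \<and> \<alpha> (g z) = z" by (simp add: g_def)
    then show ?thesis using H0_\<alpha>[of "g z"] z by simp
  qed
  define e where "e k = (if k \<ge> 0 then (\<alpha> ^^ nat k) b else (g ^^ nat (- k)) b)" for k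
  have up: "(\<alpha> ^^ n) b \<in> H0" for n by (induction n) (use b H0_\<alpha> H0_S in auto)
  have dn: "(g ^^ n) b \<in> H0" for n by (induction n) (use b g in auto)
  show thesis
  proof (rule that[of e])
    show "e k \<in> H0" for k using up dn by (simp add: e_def)
    show "e (k + 1) = \<alpha> (e k)" for k
    proof (cases "k \<ge> 0")
      case True
      then show ?thesis by (simp add: e_def nat_add_distrib)
    next
      case False
      define m where "m = nat (- (k + 1))"
      have "nat (- k) = Suc m" using False by (simp add: m_def)
      then have "\<alpha> (e k) = (g ^^ m) b" using False g[OF dn[of m]] by (simp add: e_def)
      then show ?thesis using False by (cases "k = -1") (auto simp: e_def m_def)
    qed
  qed (simp add: e_def)
qed

lemma H0_trivial_of_no_periodic:
  assumes np: "\<And>q y r. q > 0 \<Longrightarrow> (B ^^ q) y \<noteq> y + 2 * pi * of_int r"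
  shows "K = UNIV"
proof (rule ccontr)
  assume "K \<noteq> UNIV"
  then obtain x where x: "x \<notin> K" by blast
  obtain u v where uv: "u \<in> K" "v \<in> K" "u < x" "x < v" and gap: "\<And>t. u < t \<Longrightarrow> t < v \<Longrightarrow> t \<notin> K"
    using K_gap[OF x] by blast
  define B' where "B' = inv_into UNIV B"
  have BB': "B (B' t) = t" "B' (B t) = t" for t using deg1_inv[OF B_deg1] by (auto simp: B'_def)
  have B'_lift: "C1_lift B'" unfolding B'_def by (rule C1_lift_inv[OF B])
  then have B'_deg1: "deg1 B'" by (simp add: C1_lift_def)
  have B'_K: "B' t \<in> K \<longleftrightarrow> t \<in> K" for t using K_B[of "B' t"] BB' by simp
  have np': "(B' ^^ q) y \<noteq> y + 2 * pi * of_int r" if "q > 0" for q y r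
  proof
    assume a: "(B' ^^ q) y = y + 2 * pi * of_int r"
    have "(B ^^ n) ((B' ^^ n) t) = t" for n t
      by (induction n arbitrary: t) (auto simp: BB' funpow_swap1[of B])
    then have "(B ^^ q) (y + 2 * pi * of_int r) = y" by (metis a)
    then have "(B ^^ q) (y + 2 * pi * of_int r) = (y + 2 * pi * of_int r) + 2 * pi * of_int (- r)" by simp
    then show False using np[OF that] by blast
  qed
  have dm: "\<beta> = B \<or> \<beta> = B' \<Longrightarrow> C1_lift \<beta> \<and> deg1 \<beta>" for \<beta> using B B_deg1 B'_lift B'_deg1 by blast
  have shrink: "(\<lambda>n. (\<beta> ^^ n) v - (\<beta> ^^ n) u) \<longlonglongrightarrow> 0" if "\<beta> = B \<or> \<beta> = B'" for \<beta>
    using that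
  proof
    assume "\<beta> = B"
    then show ?thesis using gap_images_shrink[OF B_deg1 K_B np uv(1,2)] uv gap by simp
  next
    assume "\<beta> = B'"
    then show ?thesis using gap_images_shrink[OF B'_deg1 B'_K np' uv(1,2)] uv gap by simp
  qed
  have lt: "(\<beta> ^^ n) u < (\<beta> ^^ n) v" if "\<beta> = B \<or> \<beta> = B'" for \<beta> n
    using deg1_less_iff[OF deg1_funpow] dm[OF that] uv by force
  have pow_K: "(\<beta> ^^ n) t \<in> K \<longleftrightarrow> t \<in> K" if "\<beta> = B \<or> \<beta> = B'" for \<beta> n t
    using that by (induction n) (auto simp: K_B B'_K)
  have "C b x = x" if b: "b \<in> H0" for b
  proof -
    obtain e :: "int \<Rightarrow> 'h" where e: "e 0 = b" "\<And>k. e k \<in> H0" "\<And>k. e (k + 1) = \<alpha> (e k)"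
      using two_sided_orbit[OF b] by blast
    have e_pow: "e (k + int j) = (\<alpha> ^^ j) (e k)" for k j
    proof (induction j)
      case (Suc j)
      then show ?case using e(3)[of "k + int j"] by (simp add: algebra_simps)
    qed simp
    have "C (e 0) x = x"
    proof (rule hyperbolic_wandering_trivial[where E = H0 and e = e and B = B and B' = B' and u = u and v = v and P = P])
      show "strict_mono (C h)" if "h \<in> H0" for h using C_deg1[OF H0_S[OF that]] by (simp add: deg1_def)
      show "strict_mono B" using B_deg1 by (simp add: deg1_def)
      show "B (C (e k) t) = C (e (k + 1)) (B t)" for k t using C_conj[OF e(2)] by (simp add: e(3))
      show "C h u = u" "C h v = v" if "h \<in> H0" for h using uv that by (auto simp: K_def)
      show "(\<Sum>j\<le>Polynomial.degree P. of_int (poly.coeff P j) * e (k + int j)) = 0" for k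
        unfolding e_pow by (rule rec[OF H0_S[OF e(2)]])
      fix \<beta> and \<epsilon> :: real assume \<beta>: "\<beta> \<in> {B, B'}" and \<epsilon>: "\<epsilon> > 0"
      then have \<beta>': "\<beta> = B \<or> \<beta> = B'" by blast
      show "\<forall>\<^sub>F n in sequentially. \<forall>s t. (\<beta> ^^ n) u \<le> s \<and> s \<le> t \<and> t \<le> (\<beta> ^^ n) v \<longrightarrow>
        (1 - \<epsilon>) * (t - s) \<le> C h t - C h s \<and> C h t - C h s \<le> (1 + \<epsilon>) * (t - s)" if h: "h \<in> H0" for h
      proof (rule near_translation_on_small_intervals[OF C_lift[OF H0_S[OF h]] lt[OF \<beta>'] shrink[OF \<beta>'] _ _ \<epsilon>])
        show "C h ((\<beta> ^^ n) u) = (\<beta> ^^ n) u" "C h ((\<beta> ^^ n) v) = (\<beta> ^^ n) v" for n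
          using pow_K[OF \<beta>'] uv h unfolding K_def by blast+
      qed
      show "\<forall>\<^sub>F n in sequentially. \<forall>s t. (\<beta> ^^ n) u \<le> s \<and> s \<le> t \<and> t \<le> (\<beta> ^^ n) v \<longrightarrow>
        (1 - \<epsilon>) * ((t - s) / ((\<beta> ^^ n) v - (\<beta> ^^ n) u)) \<le> (\<beta> t - \<beta> s) / ((\<beta> ^^ Suc n) v - (\<beta> ^^ Suc n) u)"
        using distortion_on_small_intervals[OF conjunct1[OF dm[OF \<beta>']] lt[OF \<beta>'] shrink[OF \<beta>'] \<epsilon>] by simp
    qed (use H0_zero H0_add H0_neg C_add C_zero e BB' uv P in auto)
    then show ?thesis by (simp add: e(1))
  qed
  then show False using x by (simp add: K_def)
qed

text \<open>If K is the whole line, the elements \<alpha> h - h act trivially. The second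
  alternative therefore says that on the circle the generator commutes with all of H.\<close>

theorem finite_invariant_set_or_trivial:
  "(\<exists>Y. finite Y \<and> Y \<noteq> {} \<and> Y \<subseteq> circle \<and>
      (\<forall>h\<in>S. \<forall>t. cis t \<in> Y \<longrightarrow> cis (L h t) \<in> Y) \<and> (\<forall>t. cis t \<in> Y \<longrightarrow> cis (B t) \<in> Y)) \<or>
   (\<forall>h\<in>S. \<forall>t. cis (L (\<alpha> h) t) = cis (L h t))"
proof (cases "\<exists>q y r. q > 0 \<and> (B ^^ q) y = y + 2 * pi * of_int r")
  case True
  then show ?thesis using periodic_point_imp_finite_invariant by blast
next
  case False
  then have K: "K = UNIV" by (intro H0_trivial_of_no_periodic) blast
  have "cis (L (\<alpha> h) t) = cis (L h t)" if h: "h \<in> S" for h t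
  proof -
    have d: "\<alpha> h - h \<in> H0" by (rule \<alpha>_minus_id[OF h])
    have "cis (L (\<alpha> h) t) = cis (L (\<alpha> h - h) (L h t))" using L_add[OF H0_S[OF d] h, of t] by simp
    also have "\<dots> = cis (C (\<alpha> h - h) (L h t))" by (simp add: cis_C)
    also have "C (\<alpha> h - h) (L h t) = L h t" using K d unfolding K_def by blast
    finally show ?thesis .
  qed
  then show ?thesis by blast
qed

end

subsection \<open>From circle diffeomorphisms to lifts\<close>

lemma C1_circle_diffeo_lift:
  assumes f: "C1_circle_diffeo f" "circle_orientation_preserving f"
  obtains F where "C1_lift F" "\<And>t. f (cis t) = cis (F t)"
proof -
  obtain F :: "real \<Rightarrow> real" where F: "continuous_on UNIV F" "strict_mono F" "\<And>t. f (cis t) = cis (F t)"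
    using f(2) by (auto simp: circle_orientation_preserving_def)
  have bij: "bij_betw f circle circle" using f(1) by (simp add: C1_circle_diffeo_def)
  then have inj: "inj_on f circle" by (rule bij_betw_imp_inj_on)
  have F1: "deg1 F" by (rule lift_of_circle_bijection[OF inj F])
  note iF = deg1_inv[OF F1]
  have "(\<lambda>t. cis (F t)) C1_differentiable_on UNIV"
    using f(1) by (simp add: C1_circle_diffeo_def C1_circle_map_def F(3))
  then obtain F' where F': "\<And>t. (F has_real_derivative F' t) (at t)" "continuous_on UNIV F'"
    using lift_differentiable[OF F(1)] by blast
  have inv_lift: "inv_into circle f (cis t) = cis (inv_into UNIV F t)" for t
    using inv_into_f_f[OF inj, of "cis (inv_into UNIV F t)"] by (simp add: F(3) iF)
  have "(\<lambda>t. cis (inv_into UNIV F t)) C1_differentiable_on UNIV"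
    using f(1) by (simp add: C1_circle_diffeo_def C1_circle_map_def inv_lift)
  moreover have "continuous_on UNIV (inv_into UNIV F)" using iF(1) by (simp add: deg1_def)
  ultimately obtain G' where "\<And>t. (inv_into UNIV F has_real_derivative G' t) (at t)"
    using lift_differentiable by blast
  from C1_lift_of_inverse_pair[OF F1 F' this] iF have "C1_lift F" by simp
  then show thesis using F(3) that by blast
qed

subsection \<open>An integral polynomial annihilating the matrix\<close>

lemma common_denominator:
  fixes J :: "rat set"
  assumes "finite J" shows "\<exists>D::int. D > 0 \<and> (\<forall>x\<in>J. of_int D * x \<in> \<int>)"
  using assms
proof (induction J rule: finite_induct)
  case (insert x J)
  then obtain D :: int where D: "D > 0" "\<And>y. y \<in> J \<Longrightarrow> of_int D * y \<in> \<int>" by blast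
  obtain a b where ab: "x = of_int a / of_int b" "b > 0" by (metis Fract_of_int_quotient Rat_cases)
  have "of_int (D * b) * x \<in> \<int>" using ab by simp
  moreover have "of_int (D * b) * y \<in> \<int>" if "y \<in> J" for y
  proof -
    have "of_int (D * b) * y = of_int b * (of_int D * y)" by simp
    then show ?thesis using D(2)[OF that] by (metis Ints_mult Ints_of_int)
  qed
  ultimately show ?case using D ab by (intro exI[of _ "D * b"]) auto
qed (auto intro: exI[of _ 1])

lemma clear_denominators:
  fixes p :: "rat poly"
  obtains q :: "int poly" and D :: int where "D > 0" "\<And>j. of_int (poly.coeff q j) = of_int D * poly.coeff p j"
proof -
  obtain D :: int where D: "D > 0" "\<And>x. x \<in> poly.coeff p ` {..Polynomial.degree p} \<Longrightarrow> of_int D * x \<in> \<int>"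
    using common_denominator[of "poly.coeff p ` {..Polynomial.degree p}"] by auto
  define q where "q = map_poly (\<lambda>x. \<lfloor>of_int D * x\<rfloor>) p"
  have "of_int (poly.coeff q j) = of_int D * poly.coeff p j" for j
  proof (cases "j \<le> Polynomial.degree p")
    case True
    then have "of_int D * poly.coeff p j \<in> \<int>" using D(2) by blast
    then show ?thesis by (simp add: q_def coeff_map_poly)
  next
    case False
    then show ?thesis by (simp add: q_def coeff_map_poly coeff_eq_0)
  qed
  then show thesis using D(1) that by blast
qed

text \<open>A multiple of the characteristic polynomial by a positive integer: it has the same roots
  and the same degree d. Its constant coefficient is nonzero because A is invertible.\<close>

lemma integral_annihilating_polynomial:
  fixes A :: "rat mat"
  assumes d: "d \<ge> 1" and A: "A \<in> carrier_mat d d" "invertible_mat A"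
    and ev: "\<And>z. eigenvalue (map_mat of_rat A :: complex mat) z \<Longrightarrow> cmod z \<noteq> 1"
  obtains P :: "int poly" where "Polynomial.degree P \<ge> 1" "poly.coeff P 0 \<noteq> 0"
    "\<And>z :: complex. poly (map_poly of_int P) z = 0 \<Longrightarrow> cmod z \<noteq> 1"
    "\<And>v i. v \<in> carrier_vec d \<Longrightarrow> i < d \<Longrightarrow>
      (\<Sum>j\<le>Polynomial.degree P. of_int (poly.coeff P j) * (((*\<^sub>v) A ^^ j) v $ i)) = 0"
proof -
  obtain P :: "int poly" and D :: int
    where D: "D > 0" and P: "\<And>j. of_int (poly.coeff P j) = of_int D * poly.coeff (char_poly A) j"
    using clear_denominators[of "char_poly A"] by blast
  have P0: "poly.coeff P j = 0 \<longleftrightarrow> poly.coeff (char_poly A) j = 0" for j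
  proof -
    have "poly.coeff P j = 0 \<longleftrightarrow> (of_int (poly.coeff P j) :: rat) = 0" by simp
    then show ?thesis unfolding P using D by simp
  qed
  have deg: "Polynomial.degree P = Polynomial.degree (char_poly A)"
    unfolding Polynomial.degree_def P0 ..
  have degd: "Polynomial.degree (char_poly A) = d" using degree_monic_char_poly[OF A(1)] by simp
  show thesis
  proof (rule that[of P])
    show "Polynomial.degree P \<ge> 1" using deg degd d by simp
    show "poly.coeff P 0 \<noteq> 0"
    proof
      assume "poly.coeff P 0 = 0"
      then have "poly (char_poly A) 0 = 0" by (simp add: P0 poly_0_coeff_0)
      then have "eigenvalue A 0" using eigenvalue_root_char_poly[OF A(1)] by blast
      then obtain v where v: "v \<in> carrier_vec d" "v \<noteq> 0\<^sub>v d" "A *\<^sub>v v = 0 \<cdot>\<^sub>v v"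
        using A(1) by (auto simp: eigenvalue_def eigenvector_def)
      obtain B where B: "inverts_mat A B" "inverts_mat B A" using A(2) by (auto simp: invertible_mat_def)
      have BA: "B * A = 1\<^sub>m (dim_row B)" and AB: "A * B = 1\<^sub>m d" using B A(1) by (auto simp: inverts_mat_def)
      have "dim_col (A * B) = d" "dim_col (B * A) = dim_row B" unfolding AB BA by auto
      then have Bc: "B \<in> carrier_mat d d" using A(1) by auto
      have z: "0 \<cdot>\<^sub>v v = 0\<^sub>v d" using v(1) by (intro eq_vecI) auto
      have "v = (B * A) *\<^sub>v v" using v(1) Bc BA by simp
      also have "\<dots> = B *\<^sub>v 0\<^sub>v d" using A(1) Bc v z by (simp add: assoc_mult_mat_vec[of B d d A d v])
      also have "\<dots> = 0\<^sub>v d" using Bc by (intro eq_vecI) auto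
      finally show False using v(2) by simp
    qed
    show "cmod z \<noteq> 1" if "poly (map_poly of_int P) z = 0" for z :: complex
    proof -
      have "poly.coeff (map_poly of_int P :: complex poly) j = of_int D * of_rat (poly.coeff (char_poly A) j)" for j
      proof -
        have "of_rat (of_int (poly.coeff P j)) = (of_rat (of_int D * poly.coeff (char_poly A) j) :: complex)" by (simp only: P)
        then show ?thesis by (simp add: coeff_map_poly of_rat_mult)
      qed
      then have "map_poly of_int P = Polynomial.smult (of_int D) (map_poly of_rat (char_poly A) :: complex poly)"
        by (intro poly_eqI) (simp add: coeff_map_poly)
      then have "poly (map_poly of_rat (char_poly A) :: complex poly) z = 0" using that D by simp
      then have "poly (char_poly (map_mat of_rat A :: complex mat)) z = 0"
        by (simp add: of_rat_hom.char_poly_hom[OF A(1)])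
      moreover have "(map_mat of_rat A :: complex mat) \<in> carrier_mat d d" using A(1) by simp
      ultimately show ?thesis using ev eigenvalue_root_char_poly by blast
    qed
    show "(\<Sum>j\<le>Polynomial.degree P. of_int (poly.coeff P j) * (((*\<^sub>v) A ^^ j) v $ i)) = 0"
      if v: "v \<in> carrier_vec d" "i < d" for v i
    proof -
      have "(\<Sum>j\<le>Polynomial.degree P. of_int (poly.coeff P j) * (((*\<^sub>v) A ^^ j) v $ i)) =
          of_int D * (\<Sum>j\<le>Polynomial.degree (char_poly A). poly.coeff (char_poly A) j * (((*\<^sub>v) A ^^ j) v $ i))"
        by (simp add: P deg sum_distrib_left mult.assoc)
      then show ?thesis using cayley_hamilton_vec[OF A(1) v] by simp
    qed
  qed
qed

lemma of_int_fun_apply: "(of_int n :: 'a \<Rightarrow> 'b :: comm_ring_1) x = of_int n"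
  by (cases n rule: int_cases2) (simp_all add: fun_Compl_def)

lemma sum_fun_apply: "(\<Sum>j\<in>J. f j) x = (\<Sum>j\<in>J. f j x)" for f :: "nat \<Rightarrow> 'a \<Rightarrow> 'b :: comm_monoid_add"
  by (induction J rule: infinite_finite_induct) auto

section \<open>From the action of the semidirect product to the lifted action\<close>

theorem theorem1p10:
  fixes d :: nat
    and A :: "rat mat"
    and H :: "rat vec set"
    and G :: "(int \<times> rat vec) monoid"
    and \<phi> :: "int \<times> rat vec \<Rightarrow> complex \<Rightarrow> complex"
  assumes "d \<ge> 1"
    and "A \<in> carrier_mat d d" and "invertible_mat A"
    and "\<And>z. eigenvalue (map_mat of_rat A :: complex mat) z \<Longrightarrow> cmod z \<noteq> 1"
    and "subgroup H (rat_space d)"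
    and "(\<lambda>v. A *\<^sub>v v) ` H = H"
    and "rank_rat (rat_space d\<lparr>carrier := H\<rparr>) = d"
    and "G = int_semidirect (\<lambda>v\<in>H. A *\<^sub>v v) (rat_space d\<lparr>carrier := H\<rparr>)"
    and "group_action G circle \<phi>"
    and "\<And>g. g \<in> carrier G \<Longrightarrow> C1_circle_diffeo (\<phi> g) \<and> circle_orientation_preserving (\<phi> g)"
    and "\<not> comm_group (BijGroup circle\<lparr>carrier := \<phi> ` carrier G\<rparr>)"
  shows "\<exists>x\<in>circle. finite (orbit G \<phi> x)"
proof -
  note A = assms(2,3) and H = assms(5,6)
  define N where "N = rat_space d\<lparr>carrier := H\<rparr>"
  define \<theta> where "\<theta> = (\<lambda>v\<in>H. A *\<^sub>v v)"
  have H_sub: "H \<subseteq> carrier_vec d"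
    using subgroup.subset[OF H(1)] by (simp add: monoid_vec_simps)
  have N_group: "group N"
    unfolding N_def by (rule subgroup.subgroup_is_group[OF H(1) group_rat_space])
  have \<theta>: "\<theta> \<in> auto N"
    unfolding N_def \<theta>_def by (rule mat_auto[OF A H])
  have G_eq: "G = int_semidirect \<theta> N" using assms(8) by (simp add: \<theta>_def N_def)
  interpret N: group N by (rule N_group)
  interpret Aut: group "AutoGroup N" by (rule N.AutoGroup)
  interpret G: group G unfolding G_eq by (rule group_int_semidirect[OF N_group \<theta>])
  interpret act: group_action G circle \<phi> by (rule assms(9))
  have \<theta>': "\<theta> \<in> carrier (AutoGroup N)" using \<theta> by (simp add: AutoGroup_def)
  have H_zero: "0\<^sub>v d \<in> H" using subgroup.one_closed[OF H(1)] by (simp add: monoid_vec_simps)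
  have H_add: "v + w \<in> H" if "v \<in> H" "w \<in> H" for v w
    using subgroup.m_closed[OF H(1) that] by (simp add: monoid_vec_simps)
  have H_neg: "- v \<in> H" if v: "v \<in> H" for v
  proof -
    have vc: "v \<in> carrier_vec d" using v H_sub by blast
    have "inv\<^bsub>rat_space d\<^esub> v = - v"
      by (rule group.inv_equality[OF group_rat_space]) (use vc in \<open>auto simp: monoid_vec_simps\<close>)
    then show ?thesis using subgroup.m_inv_closed[OF H(1) v] by simp
  qed
  have H_A: "A *\<^sub>v v \<in> H" if "v \<in> H" for v using H(2) that by blast
  have pow0: "(\<theta> [^]\<^bsub>AutoGroup N\<^esub> (0::int)) v = v" if "v \<in> H" for v
    using that by (simp add: AutoGroup_def BijGroup_def N_def)
  have pow1: "\<theta> [^]\<^bsub>AutoGroup N\<^esub> (1::int) = \<theta>" using \<theta>' by (simp add: Aut.int_pow_1)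
  have pow_zero: "(\<theta> [^]\<^bsub>AutoGroup N\<^esub> (m::int)) (0\<^sub>v d) = 0\<^sub>v d" for m
  proof -
    have "\<theta> [^]\<^bsub>AutoGroup N\<^esub> m \<in> auto N"
      using Aut.int_pow_closed[OF \<theta>', of m] by (simp add: AutoGroup_def)
    then have "\<theta> [^]\<^bsub>AutoGroup N\<^esub> m \<in> hom N N" by (simp add: auto_def)
    from hom_one[OF this N_group N_group] show ?thesis by (simp add: N_def monoid_vec_simps)
  qed
  have carr: "(m, v) \<in> carrier G \<longleftrightarrow> v \<in> H" for m v
    by (simp add: G_eq int_semidirect_def N_def)
  have mul: "(m, v) \<otimes>\<^bsub>G\<^esub> (n, w) = (m + n, v + (\<theta> [^]\<^bsub>AutoGroup N\<^esub> m) w)" for m n v w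
    by (simp add: G_eq int_semidirect_def N_def monoid_vec_simps)
  have comp: "\<phi> (g \<otimes>\<^bsub>G\<^esub> h) x = \<phi> g (\<phi> h x)" if "g \<in> carrier G" "h \<in> carrier G" "x \<in> circle" for g h x
    using act.composition_rule that by blast
  have on_circle: "\<phi> g x \<in> circle" if "g \<in> carrier G" "x \<in> circle" for g x
    using act.element_image that by blast
  have add_rule: "\<phi> (0, v + w) x = \<phi> (0, v) (\<phi> (0, w) x)" if "v \<in> H" "w \<in> H" "x \<in> circle" for v w x
  proof -
    have "(0, v) \<otimes>\<^bsub>G\<^esub> (0, w) = (0, v + w)" unfolding mul pow0[OF that(2)] by simp
    then show ?thesis using comp[of "(0, v)" "(0, w)" x] that by (simp add: carr)
  qed
  have A_carr: "A *\<^sub>v v \<in> carrier_vec d" if "v \<in> H" for v using H_A[OF that] H_sub by blast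
  have conj_rule: "\<phi> (1, 0\<^sub>v d) (\<phi> (0, v) x) = \<phi> (0, A *\<^sub>v v) (\<phi> (1, 0\<^sub>v d) x)" if v: "v \<in> H" and x: "x \<in> circle" for v x
  proof -
    have "(1, 0\<^sub>v d) \<otimes>\<^bsub>G\<^esub> (0, v) = (0, A *\<^sub>v v) \<otimes>\<^bsub>G\<^esub> (1, 0\<^sub>v d)"
      unfolding mul pow1 pow0[OF H_zero] using v A_carr[OF v] by (simp add: \<theta>_def)
    then show ?thesis
      using comp[of "(1, 0\<^sub>v d)" "(0, v)" x] comp[of "(0, A *\<^sub>v v)" "(1, 0\<^sub>v d)" x] v x H_zero H_A
      by (simp add: carr)
  qed
  have split_rule: "\<phi> (m, v) x = \<phi> (0, v) (\<phi> (m, 0\<^sub>v d) x)" if v: "v \<in> H" and x: "x \<in> circle" for m v x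
  proof -
    have "(0, v) \<otimes>\<^bsub>G\<^esub> (m, 0\<^sub>v d) = (m, v)"
      unfolding mul pow0[OF H_zero] using v H_sub by auto
    then show ?thesis using comp[of "(0, v)" "(m, 0\<^sub>v d)" x] v x H_zero by (simp add: carr)
  qed
  have shift_rule: "\<phi> (m + n, 0\<^sub>v d) x = \<phi> (m, 0\<^sub>v d) (\<phi> (n, 0\<^sub>v d) x)" if x: "x \<in> circle" for m n x
  proof -
    have "(m, 0\<^sub>v d) \<otimes>\<^bsub>G\<^esub> (n, 0\<^sub>v d) = (m + n, 0\<^sub>v d)" unfolding mul pow_zero by simp
    then show ?thesis using comp[of "(m, 0\<^sub>v d)" "(n, 0\<^sub>v d)" x] x H_zero by (simp add: carr)
  qed
  have one: "\<one>\<^bsub>G\<^esub> = (0, 0\<^sub>v d)" by (simp add: G_eq int_semidirect_def N_def monoid_vec_simps)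
  have unit_rule: "\<phi> (0, 0\<^sub>v d) x = x" if "x \<in> circle" for x
    using act.id_eq_one that unfolding one by (metis restrict_apply')
  have inj1: "inj_on (\<phi> (1, 0\<^sub>v d)) circle" using act.inj_prop H_zero by (simp add: carr)
  have ex_lift: "\<exists>F. C1_lift F \<and> (\<forall>t. \<phi> g (cis t) = cis (F t))" if g: "g \<in> carrier G" for g
  proof -
    show ?thesis
      by (rule C1_circle_diffeo_lift[OF conjunct1[OF assms(10)[OF g]] conjunct2[OF assms(10)[OF g]]])
        (intro exI conjI allI)
  qed
  define Lf where "Lf g = (SOME F. C1_lift F \<and> (\<forall>t. \<phi> g (cis t) = cis (F t)))" for g
  have Lf: "C1_lift (Lf g)" "\<phi> g (cis t) = cis (Lf g t)" if "g \<in> carrier G" for g t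
    using someI_ex[OF ex_lift[OF that]] unfolding Lf_def by blast+
  \<comment> \<open>Vectors are encoded as functions that vanish from index d on. With pointwise
    operations these live in a commutative ring, as the locale requires, and addition and negation
    on H become those of the ring.\<close>
  define vf :: "rat vec \<Rightarrow> nat \<Rightarrow> rat" where "vf v = (\<lambda>i. if i < d then v $ i else 0)" for v
  define fv where "fv h = vec d h" for h :: "nat \<Rightarrow> rat"
  have fv_vf: "fv (vf v) = v" if "v \<in> H" for v
    using that H_sub by (intro eq_vecI) (auto simp: fv_def vf_def)
  define \<alpha> where "\<alpha> h = vf (A *\<^sub>v fv h)" for h
  define L where "L h = Lf (0, fv h)" for h
  define B where "B = Lf (1, 0\<^sub>v d)"
  have vf_add: "vf v + vf w = vf (v + w)" if "v \<in> H" "w \<in> H" for v w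
    using that H_sub by (auto simp: vf_def fun_eq_iff)
  have \<alpha>_vf: "\<alpha> (vf v) = vf (A *\<^sub>v v)" if "v \<in> H" for v by (simp add: \<alpha>_def fv_vf that)
  have L_vf: "\<phi> (0, v) (cis t) = cis (L (vf v) t)" if "v \<in> H" for v t
    using Lf(2)[of "(0, v)"] that by (simp add: L_def fv_vf carr)
  have B_cis: "\<phi> (1, 0\<^sub>v d) (cis t) = cis (B t)" for t
    using Lf(2)[of "(1, 0\<^sub>v d)"] H_zero by (simp add: B_def carr)
  obtain P :: "int poly" where P: "Polynomial.degree P \<ge> 1" "poly.coeff P 0 \<noteq> 0"
      "\<And>z :: complex. poly (map_poly of_int P) z = 0 \<Longrightarrow> cmod z \<noteq> 1"
      "\<And>v i. v \<in> carrier_vec d \<Longrightarrow> i < d \<Longrightarrow>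
        (\<Sum>j\<le>Polynomial.degree P. of_int (poly.coeff P j) * (((*\<^sub>v) A ^^ j) v $ i)) = 0"
    using integral_annihilating_polynomial[OF assms(1) A assms(4)] by blast
  interpret lifted_action "vf ` H" \<alpha> L B P
  proof
    show "0 \<in> vf ` H"
      by (rule image_eqI[OF _ H_zero]) (auto simp: vf_def fun_eq_iff)
    show "x + y \<in> vf ` H" if "x \<in> vf ` H" "y \<in> vf ` H" for x y
      using that vf_add H_add by auto
    show "- x \<in> vf ` H" if x: "x \<in> vf ` H" for x
    proof -
      obtain v where v: "v \<in> H" "x = vf v" using x by blast
      have "v \<in> carrier_vec d" using v H_sub by blast
      then have "- x = vf (- v)" using v by (auto simp: vf_def fun_eq_iff)
      then show ?thesis using H_neg[OF v(1)] by blast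
    qed
    have "\<alpha> ` vf ` H = vf ` (\<lambda>v. A *\<^sub>v v) ` H" by (simp add: image_image \<alpha>_vf)
    then show "\<alpha> ` vf ` H = vf ` H" using H(2) by simp
    show "C1_lift (L h)" if "h \<in> vf ` H" for h
      using that Lf(1) by (auto simp: L_def fv_vf carr)
    show "C1_lift B" using Lf(1) H_zero by (simp add: B_def carr)
    show "cis (L (h + k) t) = cis (L h (L k t))" if hk: "h \<in> vf ` H" "k \<in> vf ` H" for h k t
    proof -
      obtain v w where vw: "v \<in> H" "w \<in> H" "h = vf v" "k = vf w" using hk by blast
      then show ?thesis
        using add_rule[OF vw(1,2), of "cis t"] by (simp add: vf_add L_vf H_add)
    qed
    show "cis (B (L h t)) = cis (L (\<alpha> h) (B t))" if h: "h \<in> vf ` H" for h t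
    proof -
      obtain v where v: "v \<in> H" "h = vf v" using h by blast
      then show ?thesis
        using conj_rule[OF v(1), of "cis t"] by (simp add: \<alpha>_vf L_vf B_cis H_A)
    qed
    show "(\<Sum>j\<le>Polynomial.degree P. of_int (poly.coeff P j) * (\<alpha> ^^ j) h) = 0" if h: "h \<in> vf ` H" for h
    proof
      fix i
      obtain v where v: "v \<in> H" "h = vf v" using h by blast
      have pow: "((*\<^sub>v) A ^^ j) v \<in> H \<and> (\<alpha> ^^ j) h = vf (((*\<^sub>v) A ^^ j) v)" for j
        by (induction j) (use v H_A \<alpha>_vf in auto)
      have "v \<in> carrier_vec d" using v H_sub by blast
      then show "(\<Sum>j\<le>Polynomial.degree P. of_int (poly.coeff P j) * (\<alpha> ^^ j) h) i = 0 i"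
        using P(4)[of v i] pow by (cases "i < d") (simp_all add: sum_fun_apply of_int_fun_apply vf_def)
    qed
  qed (use P in auto)
  have circle_cis: "\<exists>t. x = cis t" if "x \<in> circle" for x
    using that rcis_cmod_Arg[of x] by (intro exI[of _ "Arg x"]) (simp add: rcis_def)
  from finite_invariant_set_or_trivial show ?thesis
  proof
    assume "\<exists>Y. finite Y \<and> Y \<noteq> {} \<and> Y \<subseteq> circle \<and>
      (\<forall>h\<in>vf ` H. \<forall>t. cis t \<in> Y \<longrightarrow> cis (L h t) \<in> Y) \<and> (\<forall>t. cis t \<in> Y \<longrightarrow> cis (B t) \<in> Y)"
    then obtain Y where Y: "finite Y" "Y \<noteq> {}" "Y \<subseteq> circle"
        "\<And>h t. h \<in> vf ` H \<Longrightarrow> cis t \<in> Y \<Longrightarrow> cis (L h t) \<in> Y" "\<And>t. cis t \<in> Y \<Longrightarrow> cis (B t) \<in> Y"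
      by blast
    have Y_H: "\<phi> (0, v) y \<in> Y" if vy: "v \<in> H" "y \<in> Y" for v y
    proof -
      obtain t where "y = cis t" using circle_cis Y(3) vy by blast
      then show ?thesis using Y(4)[of "vf v" t] L_vf[of v t] vy by simp
    qed
    have Y_1: "\<phi> (1, 0\<^sub>v d) y \<in> Y" if y: "y \<in> Y" for y
    proof -
      obtain t where "y = cis t" using circle_cis Y(3) y by blast
      then show ?thesis using Y(5)[of t] B_cis[of t] y by simp
    qed
    have "inj_on (\<phi> (1, 0\<^sub>v d)) Y" using inj1 Y(3) by (rule inj_on_subset)
    \<comment> \<open>An injective self-map of a finite set is onto, so the inverse of the generator
      preserves Y as well.\<close>
    then have Y_surj: "\<phi> (1, 0\<^sub>v d) ` Y = Y"
      using Y(1) Y_1 by (intro endo_inj_surj) auto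
    have Y_m: "\<phi> (m, 0\<^sub>v d) y \<in> Y" if y: "y \<in> Y" for m y
    proof (induction m rule: int_induct[where k = 0])
      case base
      then show ?case using unit_rule y Y(3) by auto
    next
      case (step1 i)
      then show ?case using shift_rule[of y 1 i] Y_1 y Y(3) by (auto simp: add.commute)
    next
      case (step2 i)
      have yc: "y \<in> circle" using y Y(3) by blast
      have "\<phi> (1, 0\<^sub>v d) (\<phi> (i - 1, 0\<^sub>v d) y) \<in> \<phi> (1, 0\<^sub>v d) ` Y"
        using shift_rule[OF yc, of 1 "i - 1"] step2 Y_surj by simp
      then obtain z where z: "z \<in> Y" "\<phi> (1, 0\<^sub>v d) (\<phi> (i - 1, 0\<^sub>v d) y) = \<phi> (1, 0\<^sub>v d) z" by blast
      have "\<phi> (i - 1, 0\<^sub>v d) y \<in> circle" using on_circle yc H_zero by (simp add: carr)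
      then have "\<phi> (i - 1, 0\<^sub>v d) y = z" using inj_onD[OF inj1 z(2)] z(1) Y(3) by blast
      then show ?case using z(1) by simp
    qed
    obtain y where y: "y \<in> Y" using Y(2) by blast
    have "\<phi> g y \<in> Y" if g: "g \<in> carrier G" for g
    proof -
      obtain m v where mv: "g = (m, v)" by (cases g)
      then have "v \<in> H" using g carr by simp
      then show ?thesis using split_rule[of v y m] Y_H Y_m y Y(3) mv by auto
    qed
    then have "orbit G \<phi> y \<subseteq> Y" by (auto simp: orbit_def)
    then show ?thesis using Y(1,3) y finite_subset by blast
  next
    assume triv: "\<forall>h\<in>vf ` H. \<forall>t. cis (L (\<alpha> h) t) = cis (L h t)"
    have comm1: "\<phi> (1, 0\<^sub>v d) (\<phi> (0, v) x) = \<phi> (0, v) (\<phi> (1, 0\<^sub>v d) x)" if v: "v \<in> H" and x: "x \<in> circle" for v x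
    proof -
      have "\<phi> (0, A *\<^sub>v v) z = \<phi> (0, v) z" if "z \<in> circle" for z
      proof -
        obtain t where "z = cis t" using circle_cis \<open>z \<in> circle\<close> by blast
        then show ?thesis using triv v L_vf[OF v] L_vf[OF H_A[OF v]] \<alpha>_vf[OF v] by auto
      qed
      then show ?thesis using conj_rule[OF v x] on_circle x H_zero by (simp add: carr)
    qed
    have comm_m: "\<phi> (m, 0\<^sub>v d) (\<phi> (0, v) x) = \<phi> (0, v) (\<phi> (m, 0\<^sub>v d) x)" if v: "v \<in> H" and x: "x \<in> circle" for m v x
    proof -
      have vx: "\<phi> (0, v) x \<in> circle" using on_circle v x by (simp add: carr)
      have mx: "\<phi> (m, 0\<^sub>v d) z \<in> circle" if "z \<in> circle" for m z using on_circle that H_zero by (simp add: carr)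
      show ?thesis
      proof (induction m rule: int_induct[where k = 0])
        case base
        then show ?case using unit_rule x vx by simp
      next
        case (step1 i)
        have "\<phi> (1 + i, 0\<^sub>v d) (\<phi> (0, v) x) = \<phi> (1, 0\<^sub>v d) (\<phi> (0, v) (\<phi> (i, 0\<^sub>v d) x))"
          using shift_rule[OF vx, of 1 i] step1 by simp
        also have "\<dots> = \<phi> (0, v) (\<phi> (1 + i, 0\<^sub>v d) x)"
          using comm1[OF v mx[OF x]] shift_rule[OF x, of 1 i] by simp
        finally show ?case by (simp add: add.commute)
      next
        case (step2 i)
        have "\<phi> (1, 0\<^sub>v d) (\<phi> (i - 1, 0\<^sub>v d) (\<phi> (0, v) x)) = \<phi> (0, v) (\<phi> (i, 0\<^sub>v d) x)"
          using shift_rule[OF vx, of 1 "i - 1"] step2 by simp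
        also have "\<dots> = \<phi> (1, 0\<^sub>v d) (\<phi> (0, v) (\<phi> (i - 1, 0\<^sub>v d) x))"
          using shift_rule[OF x, of 1 "i - 1"] comm1[OF v mx[OF x]] by simp
        finally show ?case
          using inj_onD[OF inj1] mx[OF vx] on_circle[OF _ mx[OF x]] v by (simp add: carr)
      qed
    qed
    have comm: "\<phi> (g \<otimes>\<^bsub>G\<^esub> h) x = \<phi> (h \<otimes>\<^bsub>G\<^esub> g) x" if gh: "g \<in> carrier G" "h \<in> carrier G" and x: "x \<in> circle" for g h x
    proof -
      obtain m v n w where mv: "g = (m, v)" "h = (n, w)" by (metis surj_pair)
      then have vw: "v \<in> H" "w \<in> H" using gh carr by auto
      \<comment> \<open>Collecting the powers of the generator on the right leaves an expression
        symmetric in the two factors.\<close>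
      have prod: "\<phi> (m, v) (\<phi> (n, w) x) = \<phi> (0, v + w) (\<phi> (m + n, 0\<^sub>v d) x)"
        if vw: "v \<in> H" "w \<in> H" for m n v w
      proof -
        have nx: "\<phi> (n, 0\<^sub>v d) x \<in> circle" "\<phi> (n, w) x \<in> circle" using on_circle x vw H_zero by (simp_all add: carr)
        have mnx: "\<phi> (m, 0\<^sub>v d) (\<phi> (n, 0\<^sub>v d) x) \<in> circle" using on_circle nx H_zero by (simp add: carr)
        have "\<phi> (m, v) (\<phi> (n, w) x) = \<phi> (0, v) (\<phi> (m, 0\<^sub>v d) (\<phi> (0, w) (\<phi> (n, 0\<^sub>v d) x)))"
          using split_rule[OF vw(1) nx(2), of m] split_rule[OF vw(2) x, of n] by simp
        also have "\<dots> = \<phi> (0, v) (\<phi> (0, w) (\<phi> (m, 0\<^sub>v d) (\<phi> (n, 0\<^sub>v d) x)))"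
          using comm_m[OF vw(2) nx(1)] by simp
        also have "\<dots> = \<phi> (0, v + w) (\<phi> (m + n, 0\<^sub>v d) x)"
          using add_rule[OF vw mnx] shift_rule[OF x] by simp
        finally show ?thesis .
      qed
      have "v + w = w + v" using vw H_sub by (intro comm_add_vec) auto
      then show ?thesis
        using comp[OF gh x] comp[OF gh(2,1) x] prod[OF vw, of m n] prod[OF vw(2,1), of n m]
        by (simp add: mv add.commute)
    qed
    have hom: "group_hom G (BijGroup circle) \<phi>" by (rule act.group_hom)
    let ?I = "BijGroup circle\<lparr>carrier := \<phi> ` carrier G\<rparr>"
    have sub: "subgroup (\<phi> ` carrier G) (BijGroup circle)"
      by (rule group_hom.img_is_subgroup[OF hom])
    then have "group ?I"
      by (rule subgroup.subgroup_is_group) (rule group_BijGroup)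
    moreover have "a \<otimes>\<^bsub>?I\<^esub> b = b \<otimes>\<^bsub>?I\<^esub> a" if ab: "a \<in> carrier ?I" "b \<in> carrier ?I" for a b
    proof -
      obtain g h where gh: "g \<in> carrier G" "h \<in> carrier G" "a = \<phi> g" "b = \<phi> h" using ab by auto
      have "\<phi> (g \<otimes>\<^bsub>G\<^esub> h) = \<phi> (h \<otimes>\<^bsub>G\<^esub> g)"
      \<comment> \<open>The values of \<phi> are extensional on the circle, so agreement there gives
        equality of functions.\<close>
      proof (rule extensionalityI[of _ circle])
        show "\<phi> (g \<otimes>\<^bsub>G\<^esub> h) \<in> extensional circle" "\<phi> (h \<otimes>\<^bsub>G\<^esub> g) \<in> extensional circle"
          using act.bij_prop0 gh by (auto simp: Bij_def)
      qed (use comm gh in auto)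
      then show ?thesis using group_hom.hom_mult[OF hom] gh by simp
    qed
    ultimately have "comm_group ?I" by (intro group.group_comm_groupI) auto
    then show ?thesis using assms(11) by simp
  qed
qed

end
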